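(* For each $b\in[0,1)$, the set $E_b$ is dense in the complement of $T_b$ (in $\mathbb R/\mathbb Z$). In particular, every (nondegenerate) interval of parameters $a$ either is contained in the closure of one tongue (at level $b$) or intersects $E_b$.
   Context: Let $\mathbb T=\mathbb R/\mathbb Z$. For $a\in\mathbb R/\mathbb Z$ and $b\in[0,1]$ the double standard map $f_{a,b}:\mathbb T\to\mathbb T$ is $f_{a,b}(x)=2x+a+\frac b\pi\sin 2\pi x \pmod 1$. Powers $f_{a,b}^n$ are iterates and primes denote derivatives in $x$. For $b\in[0,1)$: $T_b$ is the set of parameters $a\in\mathbb R/\mathbb Z$ for which $f_{a,b}$ has an attracting periodic orbit; $E_b$ is the set of parameters $a$ for which $f_{a,b}$ is expanding, i.e. there exist $C>0$, $\kappa>0$ with $(f_{a,b}^n)'(x)\ge Ce^{\kappa n}$ for all $n\ge0$ and all $x\in\mathbb T$. Each $f_{a,b}$ has at most one attracting or neutral periodic orbit. A tongue is the set of all $(a,b)$ for which $f_{a,b}$ has an attracting periodic orbit of a given type (period plus combinatorics). Tongues are open, connected and pairwise disjoint, so equivalently a tongue is a connected component of $\{(a,b)\in\mathbb R/\mathbb Z\times[0,1]: f_{a,b}\text{ has an attracting periodic orbit}\}$. The tongue at level $b$ is the set of $a$ such that $(a,b)$ belongs to the tongue; its closure is taken in $\mathbb R/\mathbb Z$. *)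

theory Defs
  imports "HOL-Analysis.Analysis"
begin

quotient_type circle = real / "\<lambda>x y :: real. x - y \<in> \<int>"
  morphisms rep_circle proj
proof (rule equivpI)
  show "reflp (\<lambda>x y :: real. x - y \<in> \<int>)"
    by (simp add: reflp_def)
  show "symp (\<lambda>x y :: real. x - y \<in> \<int>)"
  proof (rule sympI)
    fix x y :: real
    assume "x - y \<in> \<int>"
    then have "- (x - y) \<in> \<int>"
      by (rule Ints_minus)
    then show "y - x \<in> \<int>"
      by simp
  qed
  show "transp (\<lambda>x y :: real. x - y \<in> \<int>)"
  proof (rule transpI)
    fix x y z :: real
    assume "x - y \<in> \<int>" "y - z \<in> \<int>"
    then have "(x - y) + (y - z) \<in> \<int>"
      by (rule Ints_add)
    then show "x - z \<in> \<int>"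
      by simp
  qed
qed

instantiation circle :: topological_space
begin

definition open_circle :: "circle set \<Rightarrow> bool"
  where "open_circle U \<longleftrightarrow> open (proj -` U)"

instance
proof
  show "open (UNIV :: circle set)"
    by (simp add: open_circle_def)
  show "open (S \<inter> T)" if "open S" "open T" for S T :: "circle set"
    using that unfolding open_circle_def vimage_Int by (rule open_Int)
  show "open (\<Union>K)" if "\<forall>S\<in>K. open S" for K :: "circle set set"
    using that unfolding open_circle_def vimage_Union by (rule open_UN)
qed

end

text \<open>
  A circle map is differentiated through a local lift to the real line. Two local lifts that are
  continuous at \<open>x\<close> differ near \<open>x\<close> by a constant integer, and a change of the representative \<open>x\<close>
  translates the lift, so the derivative does not depend on the choices made.
\<close>

definition has_circle_derivative :: "(circle \<Rightarrow> circle) \<Rightarrow> real \<Rightarrow> circle \<Rightarrow> bool"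
  where "has_circle_derivative g D p \<longleftrightarrow>
    (\<exists>G x. proj x = p \<and> (\<forall>\<^sub>F y in nhds x. proj (G y) = g (proj y)) \<and>
      (G has_real_derivative D) (at x))"

definition circle_deriv :: "(circle \<Rightarrow> circle) \<Rightarrow> circle \<Rightarrow> real"
  where "circle_deriv g p = (THE D. has_circle_derivative g D p)"

lemma proj_eq_iff: "proj x = proj y \<longleftrightarrow> x - y \<in> \<int>"
  by (rule circle.abs_eq_iff)

lemma has_circle_derivative_unique:
  assumes "has_circle_derivative g D p" "has_circle_derivative g E p"
  shows "D = E"
proof -
  obtain G x where G: "proj x = p" "\<forall>\<^sub>F y in nhds x. proj (G y) = g (proj y)"
    "(G has_real_derivative D) (at x)"
    using assms(1) unfolding has_circle_derivative_def by blast
  obtain H z where H: "proj z = p" "\<forall>\<^sub>F y in nhds z. proj (H y) = g (proj y)"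
    "(H has_real_derivative E) (at z)"
    using assms(2) unfolding has_circle_derivative_def by blast
  define k where "k = z - x"
  have k: "k \<in> \<int>"
    unfolding k_def by (rule proj_eq_iff[THEN iffD1]) (simp add: G(1) H(1))
  have projk: "proj (y + k) = proj y" for y
    using k by (simp add: proj_eq_iff)
  define H' where "H' = (\<lambda>y. H (y + k))"
  have H'd: "(H' has_real_derivative E) (at x)"
    using H(3) DERIV_shift[of H E x k] by (simp add: H'_def k_def)
  have "filterlim (\<lambda>y. y + k) (nhds z) (nhds x)"
    using tendsto_add[OF filterlim_ident tendsto_const[of k "nhds x"]] by (simp add: k_def)
  then have "\<forall>\<^sub>F y in nhds x. proj (H (y + k)) = g (proj (y + k))"
    using H(2) by (auto simp: filterlim_iff)
  then have H'l: "\<forall>\<^sub>F y in nhds x. proj (H' y) = g (proj y)"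
    by (simp add: H'_def projk)
  have int: "\<forall>\<^sub>F y in nhds x. G y - H' y \<in> \<int>"
    using G(2) H'l by eventually_elim (simp add: proj_eq_iff[symmetric])
  define c where "c = G x - H' x"
  have c: "c \<in> \<int>"
    unfolding c_def by (rule eventually_nhds_x_imp_x[OF int])
  have d: "((\<lambda>y. G y - H' y) has_real_derivative D - E) (at x)"
    by (rule DERIV_diff[OF G(3) H'd])
  then have "isCont (\<lambda>y. G y - H' y) x"
    by (rule DERIV_isCont)
  then have "((\<lambda>y. G y - H' y) \<longlongrightarrow> c) (nhds x)"
    unfolding c_def isCont_def
    by (rule tendsto_at_iff_tendsto_nhds[THEN iffD1, where g1 = "\<lambda>y. G y - H' y"])
  then have "\<forall>\<^sub>F y in nhds x. dist (G y - H' y) c < 1"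
    by (rule tendstoD) simp
  then have "\<forall>\<^sub>F y in nhds x. G y - H' y = c"
    using int
  proof eventually_elim
    case (elim y)
    have "G y - H' y - c \<in> \<int>"
      using elim(2) c by (rule Ints_diff)
    moreover have "\<bar>G y - H' y - c\<bar> < 1"
      using elim(1) unfolding dist_real_def .
    ultimately have "G y - H' y - c = 0"
      by (rule Ints_nonzero_abs_less1)
    then show ?case
      by simp
  qed
  then have "((\<lambda>y. c) has_real_derivative D - E) (at x)"
    by (rule DERIV_cong_ev[OF refl _ refl, THEN iffD1]) (rule d)
  from DERIV_unique[OF this DERIV_const] show ?thesis
    by simp
qed

lemma circle_deriv_eqI: "has_circle_derivative g D p \<Longrightarrow> circle_deriv g p = D"
  unfolding circle_deriv_def by (rule the_equality) (auto intro: has_circle_derivative_unique)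

lift_definition double_standard :: "circle \<Rightarrow> real \<Rightarrow> circle \<Rightarrow> circle"
  is "\<lambda>a b x. 2 * x + a + b / pi * sin (2 * pi * x)"
proof -
  fix a a' b x x' :: real
  assume a: "a - a' \<in> \<int>" and x: "x - x' \<in> \<int>"
  obtain k where "x - x' = of_int k"
    using x by (auto elim: Ints_cases)
  then have k: "x = x' + of_int k"
    by simp
  have "sin (2 * pi * x) = sin (2 * pi * x' + 2 * pi * of_int k)"
    unfolding k by (simp only: distrib_left)
  also have "\<dots> = sin (2 * pi * x')"
    by (simp only: sin_add sin_int_2pin cos_int_2pin mult_1_right mult_zero_right add_0_right)
  finally have s: "sin (2 * pi * x) = sin (2 * pi * x')" .
  have "2 * x + a + b / pi * sin (2 * pi * x) - (2 * x' + a' + b / pi * sin (2 * pi * x'))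
      = 2 * (x - x') + (a - a')"
    unfolding s by (simp only: algebra_simps)
  moreover have "2 * (x - x') + (a - a') \<in> \<int>"
    by (intro Ints_add Ints_mult Ints_numeral a x)
  ultimately show "2 * x + a + b / pi * sin (2 * pi * x)
      - (2 * x' + a' + b / pi * sin (2 * pi * x')) \<in> \<int>"
    by (simp only:)
qed

text \<open>An attracting periodic orbit is given by one of its points \<open>p\<close>, with \<open>n\<close> any period of \<open>p\<close>.\<close>

definition has_attracting_orbit :: "(circle \<Rightarrow> circle) \<Rightarrow> bool"
  where "has_attracting_orbit g \<longleftrightarrow>
    (\<exists>p n. n > 0 \<and> (g ^^ n) p = p \<and> \<bar>circle_deriv (g ^^ n) p\<bar> < 1)"

definition expanding :: "(circle \<Rightarrow> circle) \<Rightarrow> bool"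
  where "expanding g \<longleftrightarrow>
    (\<exists>C>0. \<exists>\<kappa>>0. \<forall>n p. circle_deriv (g ^^ n) p \<ge> C * exp (\<kappa> * real n))"

definition attracting_params :: "real \<Rightarrow> circle set"
  where "attracting_params b = {a. has_attracting_orbit (double_standard a b)}"

definition expanding_params :: "real \<Rightarrow> circle set"
  where "expanding_params b = {a. expanding (double_standard a b)}"

text \<open>
  Tongues of different combinatorial type are open, connected and pairwise disjoint, so they are the
  connected components of the set of parameters with an attracting periodic orbit.
\<close>

definition tongues :: "(circle \<times> real) set set"
  where "tongues = components {(a, b). b \<in> {0..1} \<and> has_attracting_orbit (double_standard a b)}"

definition tongue_level :: "(circle \<times> real) set \<Rightarrow> real \<Rightarrow> circle set"
  where "tongue_level U b = {a. (a, b) \<in> U}"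

text \<open>
  Intervals of the circle are projections of intervals of the line, so the whole circle is one too.
\<close>

definition nondegenerate_circle_interval :: "circle set \<Rightarrow> bool"
  where "nondegenerate_circle_interval J \<longleftrightarrow>
    (\<exists>I. is_interval I \<and> (\<exists>x\<in>I. \<exists>y\<in>I. x < y) \<and> J = proj ` I)"

end

theory Submission
  imports Defs "HOL-Complex_Analysis.Complex_Analysis"
begin

text \<open>
  Work with the lift \<open>F = ds_lift b a\<close>, for which
  \<open>F (x + 1) = F x + 2\<close>, and write \<open>P n x\<close> for the derivative
  of \<open>F ^^ n\<close> at \<open>x\<close>. For \<open>b = 0\<close> the map is linear and
  expanding, so let \<open>0 < b < 1\<close>. The statement on intervals follows from the
  density of the expanding parameters: if an interval of parameters contains no expanding one,
  then its interior consists of attracting parameters; being connected it lies in a single tongue,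
  and the interval lies in the closure of its interior. The proof of density has three
  ingredients.

  If \<open>P n x > 1\<close> at every periodic point, then \<open>F\<close> is expanding
  (\<open>repelling_imp_expanding\<close>, a theorem of Mane for maps without critical points).
  Indeed, there are then no wandering intervals, by the argument of Denjoy and Schwartz, and a
  point with \<open>P n x \<le> 1\<close> for all \<open>n\<close> would have infinitely many
  returns to a small interval, each of which expands the Hilbert metric of that interval by a
  fixed factor, although the density of this metric at the points of return and \<open>P\<close>
  both stay bounded. Consequently a parameter that is neither expanding nor attracting has a
  neutral periodic point, \<open>P n x = 1\<close>. For a given period and translation, the
  points that are neutral at some parameter are isolated (\<open>near_periodic_point\<close>), and
  each determines its parameter, so there are only countably many parameters with a neutral
  periodic point.

  All critical values of the complex extension of \<open>F\<close> are integer translates of one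
  number \<open>v a\<close> and of its conjugate. By Fatou's argument an attracting periodic
  point also attracts the orbit of \<open>v a\<close>, and so does a neutral periodic point that
  attracts real points from one side; in the latter case the orbit approaches from that side.
  Hence an attracting orbit excludes neutral points that attract from a side
  (\<open>attracting_excludes_neutral_side\<close>), and at one parameter it cannot happen that
  some neutral point attracts from the right and some neutral point attracts from the left
  (\<open>opposite_neutral_sides\<close>).

  Suppose now that no parameter near the non-attracting \<open>a0\<close> is expanding. The
  non-attracting parameters near \<open>a0\<close> then form a nonempty countable closed set,
  which has an isolated point \<open>a1\<close> by Baire's theorem. Just below \<open>a1\<close>
  all parameters are attracting, one period serves for all of them by the second ingredient, and
  the attracting points accumulate at a neutral point of \<open>a1\<close>. As
  \<open>F ^^ n\<close> increases with \<open>a\<close>, they approach that point from the left,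
  so it attracts from the left. Symmetrically the parameters above \<open>a1\<close> produce a
  neutral point that attracts from the right. This is the excluded coexistence.
\<close>

section \<open>Lifts of degree two and their distortion\<close>

text \<open>
  The bound is 2 and not 1 because the intervals are translated by integers so that their left
  ends lie in \<open>{0..<1}\<close>; they then stay disjoint, and they are contained in
  \<open>{0..2}\<close>.
\<close>

lemma sum_lengths_disjoint_mod_1:
  fixes u w :: "'i \<Rightarrow> real"
  assumes "finite I" and len: "\<And>i. i \<in> I \<Longrightarrow> u i \<le> w i \<and> w i \<le> u i + 1"
    and disj: "\<And>i j k. \<lbrakk>i \<in> I; j \<in> I; i \<noteq> j\<rbrakk> \<Longrightarrow>
      {u i + of_int k<..<w i + of_int k} \<inter> {u j<..<w j} = {}"
  shows "(\<Sum>i\<in>I. w i - u i) \<le> 2"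
proof -
  define A where "A i = {u i - of_int \<lfloor>u i\<rfloor><..<w i - of_int \<lfloor>u i\<rfloor>}" for i
  have dA: "disjoint_family_on A I"
  proof (unfold disjoint_family_on_def, intro ballI impI)
    fix i j assume ij: "i \<in> I" "j \<in> I" "i \<noteq> j"
    show "A i \<inter> A j = {}"
    proof (rule ccontr)
      assume "A i \<inter> A j \<noteq> {}"
      then obtain x where x: "x \<in> A i" "x \<in> A j" by blast
      have "x + of_int \<lfloor>u j\<rfloor> \<in> {u i + of_int (\<lfloor>u j\<rfloor> - \<lfloor>u i\<rfloor>)<..<w i + of_int (\<lfloor>u j\<rfloor> - \<lfloor>u i\<rfloor>)} \<inter> {u j<..<w j}"
        using x by (auto simp: A_def)
      then show False using disj[OF ij, of "\<lfloor>u j\<rfloor> - \<lfloor>u i\<rfloor>"] by blast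
    qed
  qed
  have sub: "(\<Union>i\<in>I. A i) \<subseteq> {0..2}"
  proof
    fix x assume "x \<in> (\<Union>i\<in>I. A i)"
    then obtain i where i: "i \<in> I" "x \<in> A i" by blast
    have "of_int \<lfloor>u i\<rfloor> \<le> u i" "u i < of_int \<lfloor>u i\<rfloor> + 1" by linarith+
    then show "x \<in> {0..2}" using i(2) len[OF i(1)] unfolding A_def greaterThanLessThan_iff atLeastAtMost_iff by linarith
  qed
  have "(\<Sum>i\<in>I. w i - u i) = (\<Sum>i\<in>I. measure lborel (A i))"
    using len by (intro sum.cong) (auto simp: A_def)
  also have "\<dots> = measure lborel (\<Union>i\<in>I. A i)"
    using dA \<open>finite I\<close>
  proof (intro measure_finite_Union[symmetric])
    show "A ` I \<subseteq> sets lborel" by (auto simp: A_def)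
    show "emeasure lborel (A i) \<noteq> \<infinity>" if "i \<in> I" for i
      using len[OF that] by (simp add: A_def)
  qed
  also have "\<dots> \<le> measure lborel {0..2::real}"
    using sub \<open>finite I\<close> by (intro measure_mono_fmeasurable) (auto simp: A_def fmeasurable_def)
  finally show ?thesis by simp
qed

text \<open>
  The bound on \<open>F2\<close> controls distortion; the one on \<open>F3\<close> serves only to
  compare \<open>F\<close> with projective maps. One constant \<open>M\<close> for both keeps the
  estimates short.
\<close>

locale degree_two_lift =
  fixes F F1 F2 F3 :: "real \<Rightarrow> real" and m M :: real
  assumes DF: "\<And>x. (F has_real_derivative F1 x) (at x)"
    and DF1: "\<And>x. (F1 has_real_derivative F2 x) (at x)"
    and DF2: "\<And>x. (F2 has_real_derivative F3 x) (at x)"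
    and F_add_1: "\<And>x. F (x + 1) = F x + 2"
    and m_pos: "0 < m" and F1_ge: "\<And>x. m \<le> F1 x"
    and F2_le: "\<And>x. \<bar>F2 x\<bar> \<le> M" and F3_le: "\<And>x. \<bar>F3 x\<bar> \<le> M"
begin

text \<open>The derivative of \<open>F ^^ n\<close>, see \<open>DERIV_funpow\<close>.\<close>

definition P :: "nat \<Rightarrow> real \<Rightarrow> real"
  where "P n x = (\<Prod>i<n. F1 ((F ^^ i) x))"

lemma F1_pos: "0 < F1 x"
  using m_pos F1_ge[of x] by linarith

lemma F_strict_mono: "x < y \<Longrightarrow> F x < F y"
  by (rule DERIV_pos_imp_increasing[of x y F]) (use DF F1_pos in blast)+

lemma funpow_strict_mono: "x < y \<Longrightarrow> (F ^^ n) x < (F ^^ n) y"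
  by (induction n) (auto intro: F_strict_mono)

lemma funpow_less_iff: "(F ^^ n) x < (F ^^ n) y \<longleftrightarrow> x < y"
  using funpow_strict_mono by (metis linorder_neqE_linordered_idom order_less_asym)

lemma funpow_le_iff: "(F ^^ n) x \<le> (F ^^ n) y \<longleftrightarrow> x \<le> y"
  using funpow_less_iff by (metis linorder_not_le)

lemma funpow_eq_iff: "(F ^^ n) x = (F ^^ n) y \<longleftrightarrow> x = y"
  using funpow_less_iff by (metis linorder_neqE_linordered_idom order_less_irrefl)

lemma F_add_int: "F (x + of_int k) = F x + 2 * of_int k"
proof (induction k rule: int_induct[where k=0])
  case (step1 i) then show ?case using F_add_1[of "x + of_int i"] by (simp add: algebra_simps)
next
  case (step2 i) then show ?case using F_add_1[of "x + of_int (i - 1)"] by (simp add: algebra_simps)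
qed simp

lemma funpow_add_int: "(F ^^ n) (x + of_int k) = (F ^^ n) x + 2 ^ n * of_int k"
proof (induction n)
  case (Suc n)
  have "F ((F ^^ n) x + of_int (2 ^ n * k)) = F ((F ^^ n) x) + 2 * of_int (2 ^ n * k)"
    by (rule F_add_int)
  then show ?case using Suc by (simp add: algebra_simps)
qed simp

lemma F1_add_1: "F1 (x + 1) = F1 x"
proof -
  have "((\<lambda>x. F (x + 1)) has_real_derivative F1 (x + 1)) (at x)"
    using DF[of "x + 1"] DERIV_shift by blast
  moreover have "((\<lambda>x. F x + 2) has_real_derivative F1 x) (at x)"
    by (auto intro!: derivative_eq_intros DF)
  ultimately show ?thesis using F_add_1 by (auto intro: DERIV_unique)
qed

lemma F1_add_int: "F1 (x + of_int k) = F1 x"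
proof (induction k rule: int_induct[where k=0])
  case (step1 i) then show ?case using F1_add_1[of "x + of_int i"] by (simp add: algebra_simps)
next
  case (step2 i) then show ?case using F1_add_1[of "x + of_int (i - 1)"] by (simp add: algebra_simps)
qed simp

lemma P_0 [simp]: "P 0 x = 1" and P_Suc: "P (Suc n) x = P n x * F1 ((F ^^ n) x)"
  by (auto simp: P_def)

lemma P_pos: "0 < P n x"
  by (auto simp: P_def intro: prod_pos F1_pos)

lemma P_add: "P (n + k) x = P n x * P k ((F ^^ n) x)"
proof (induction k)
  case (Suc k)
  have "(F ^^ (n + k)) x = (F ^^ k) ((F ^^ n) x)"
    by (metis add.commute comp_apply funpow_add)
  then show ?case using Suc by (simp add: P_Suc)
qed simp

lemma P_add_int: "P n (x + of_int k) = P n x"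
proof -
  have "F1 ((F ^^ i) (x + of_int k)) = F1 ((F ^^ i) x)" for i
    using F1_add_int[of "(F ^^ i) x" "2 ^ i * k"] by (simp add: funpow_add_int)
  then show ?thesis by (simp add: P_def)
qed

lemma P_periodic_power:
  assumes "(F ^^ n) p = p + of_int k"
  shows "P (t * n) p = P n p ^ t"
proof (induction t)
  case (Suc t)
  have "P (Suc t * n) p = P n p * P (t * n) ((F ^^ n) p)" using P_add[of n "t * n" p] by simp
  then show ?case using Suc by (simp add: assms P_add_int)
qed simp

lemma P_periodic_orbit:
  assumes "(F ^^ n) p = p + of_int k"
  shows "P n ((F ^^ s) p) = P n p"
proof -
  have "P s p * P n ((F ^^ s) p) = P (s + n) p" by (simp add: P_add)
  also have "\<dots> = P n p * P s ((F ^^ n) p)" by (simp add: P_add[symmetric] add.commute)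
  also have "\<dots> = P s p * P n p" by (simp add: assms P_add_int)
  finally show ?thesis using P_pos[of s p] by simp
qed

lemma DERIV_funpow: "((F ^^ n) has_real_derivative P n x) (at x)"
proof (induction n)
  case 0 then show ?case by (simp add: id_def)
next
  case (Suc n)
  have "((\<lambda>y. F ((F ^^ n) y)) has_real_derivative F1 ((F ^^ n) x) * P n x) (at x)"
    by (rule DERIV_chain2[OF DF Suc])
  then show ?case by (simp add: P_Suc mult.commute o_def)
qed

lemma isCont_funpow: "isCont (F ^^ n) x"
  using DERIV_funpow DERIV_isCont by blast

lemma continuous_on_funpow: "continuous_on S (F ^^ n)"
  using isCont_funpow continuous_at_imp_continuous_on by blast

lemma F_surj: "\<exists>x. F x = y"
proof -
  define k where "k = \<lceil>\<bar>y - F 0\<bar>\<rceil>"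
  have "\<bar>y - F 0\<bar> \<le> of_int k" by (simp add: k_def)
  then have "F (0 + of_int (-k)) \<le> y \<and> y \<le> F (0 + of_int k)" "k \<ge> 0"
    unfolding F_add_int by auto
  moreover have "continuous_on {of_int (- k)..of_int k} F"
    using continuous_on_funpow[of _ 1] by simp
  ultimately show ?thesis
    using IVT'[of F "of_int (-k)" y "of_int k"] by auto
qed

lemma funpow_surj: "\<exists>x. (F ^^ n) x = y"
proof (induction n arbitrary: y)
  case (Suc n)
  obtain z where "F z = y" using F_surj by blast
  moreover obtain x where "(F ^^ n) x = z" using Suc by blast
  ultimately show ?case by auto
qed auto

text \<open>A Lipschitz constant of \<open>ln \<circ> F1\<close>.\<close>

definition K :: real where "K = M / m"

lemma M_nonneg: "0 \<le> M" using F2_le[of 0] by linarith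
lemma K_nonneg: "0 \<le> K" using m_pos M_nonneg by (simp add: K_def)

lemma F1_distortion: "F1 x \<le> exp (K * \<bar>x - y\<bar>) * F1 y"
proof -
  have d: "((\<lambda>x. ln (F1 x)) has_real_derivative F2 x / F1 x) (at x)" for x
    by (auto intro!: derivative_eq_intros DF1 simp: F1_pos divide_inverse mult.commute)
  have b: "norm (F2 x / F1 x) \<le> K" for x
  proof -
    have "\<bar>F2 x\<bar> / F1 x \<le> M / m"
      using F2_le[of x] F1_ge[of x] m_pos M_nonneg by (intro frac_le) auto
    then show ?thesis using F1_pos[of x] by (simp add: K_def)
  qed
  have "norm (ln (F1 x) - ln (F1 y)) \<le> K * norm (x - y)"
    by (rule field_differentiable_bound[of UNIV "\<lambda>x. ln (F1 x)" "\<lambda>x. F2 x / F1 x"]) (use d b in auto)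
  then have "ln (F1 x) \<le> K * \<bar>x - y\<bar> + ln (F1 y)" by (auto simp: abs_le_iff)
  then have "exp (ln (F1 x)) \<le> exp (K * \<bar>x - y\<bar> + ln (F1 y))" by simp
  then show ?thesis by (simp add: exp_add F1_pos)
qed

lemma P_distortion: "P n x \<le> exp (K * (\<Sum>i<n. \<bar>(F ^^ i) x - (F ^^ i) y\<bar>)) * P n y"
proof (induction n)
  case (Suc n)
  have "P n x * F1 ((F ^^ n) x) \<le> (exp (K * (\<Sum>i<n. \<bar>(F ^^ i) x - (F ^^ i) y\<bar>)) * P n y) * (exp (K * \<bar>(F ^^ n) x - (F ^^ n) y\<bar>) * F1 ((F ^^ n) y))"
    using Suc F1_distortion P_pos F1_pos less_imp_le by (intro mult_mono) (auto intro!: mult_nonneg_nonneg simp: less_imp_le)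
  then show ?case by (simp add: P_Suc exp_add algebra_simps)
qed simp

text \<open>
  In the following estimates \<open>s\<close> bounds the total length of the first
  \<open>n\<close> images of the interval, which by \<open>P_distortion\<close> is all that
  distortion depends on. Below, \<open>s\<close> is always 2 or 4.
\<close>

lemma P_distortion_interval:
  assumes "x \<in> {u..w}" "y \<in> {u..w}" and s: "(\<Sum>i<n. (F ^^ i) w - (F ^^ i) u) \<le> s"
  shows "P n x \<le> exp (K * s) * P n y"
proof -
  have "(\<Sum>i<n. \<bar>(F ^^ i) x - (F ^^ i) y\<bar>) \<le> (\<Sum>i<n. (F ^^ i) w - (F ^^ i) u)"
  proof (rule sum_mono)
    fix i
    have "(F ^^ i) u \<le> (F ^^ i) x" "(F ^^ i) x \<le> (F ^^ i) w" "(F ^^ i) u \<le> (F ^^ i) y" "(F ^^ i) y \<le> (F ^^ i) w"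
      using assms by (auto simp: funpow_le_iff)
    then show "\<bar>(F ^^ i) x - (F ^^ i) y\<bar> \<le> (F ^^ i) w - (F ^^ i) u" by linarith
  qed
  then have "K * (\<Sum>i<n. \<bar>(F ^^ i) x - (F ^^ i) y\<bar>) \<le> K * s"
    using s K_nonneg by (intro mult_left_mono) auto
  then have "exp (K * (\<Sum>i<n. \<bar>(F ^^ i) x - (F ^^ i) y\<bar>)) * P n y \<le> exp (K * s) * P n y"
    using P_pos[of n y] by (intro mult_right_mono) auto
  then show ?thesis using P_distortion[of n x y] by linarith
qed

lemma length_distortion:
  assumes "x \<in> {u..w}" "u \<le> y" "y \<le> z" "z \<le> w" and s: "(\<Sum>i<n. (F ^^ i) w - (F ^^ i) u) \<le> s"
  shows "(F ^^ n) z - (F ^^ n) y \<le> exp (K * s) * P n x * (z - y)"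
    and "P n x * (z - y) \<le> exp (K * s) * ((F ^^ n) z - (F ^^ n) y)"
proof -
  have "(F ^^ n) z - (F ^^ n) y \<le> exp (K * s) * P n x * (z - y) \<and> P n x * (z - y) \<le> exp (K * s) * ((F ^^ n) z - (F ^^ n) y)"
  proof (cases "y = z")
    case False
    then have "y < z" using assms by auto
    obtain \<xi> where \<xi>: "y < \<xi>" "\<xi> < z" "(F ^^ n) z - (F ^^ n) y = (z - y) * P n \<xi>"
      using MVT2[OF \<open>y < z\<close>, of "F ^^ n" "P n"] DERIV_funpow by blast
    have "P n \<xi> \<le> exp (K * s) * P n x" "P n x \<le> exp (K * s) * P n \<xi>"
      using P_distortion_interval[OF _ _ s] assms \<xi> by auto
    then have "(z - y) * P n \<xi> \<le> (z - y) * (exp (K * s) * P n x)" "(z - y) * P n x \<le> (z - y) * (exp (K * s) * P n \<xi>)"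
      using \<open>y < z\<close> by (auto intro!: mult_left_mono)
    then show ?thesis unfolding \<xi>(3) by (simp only: mult_ac)
  qed simp
  then show "(F ^^ n) z - (F ^^ n) y \<le> exp (K * s) * P n x * (z - y)"
    and "P n x * (z - y) \<le> exp (K * s) * ((F ^^ n) z - (F ^^ n) y)" by auto
qed

lemma ratio_distortion:
  assumes "u \<le> y" "y \<le> z" "z \<le> w" "u \<le> y'" "y' \<le> z'" "z' \<le> w"
    and s: "(\<Sum>i<n. (F ^^ i) w - (F ^^ i) u) \<le> s"
  shows "((F ^^ n) z - (F ^^ n) y) * (z' - y') \<le> exp (2 * K * s) * ((F ^^ n) z' - (F ^^ n) y') * (z - y)"
proof -
  have 1: "(F ^^ n) z - (F ^^ n) y \<le> exp (K * s) * P n u * (z - y)"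
    using length_distortion(1)[of u u w y z n s] assms by auto
  have 2: "P n u * (z' - y') \<le> exp (K * s) * ((F ^^ n) z' - (F ^^ n) y')"
    using length_distortion(2)[of u u w y' z' n s] assms by auto
  have "((F ^^ n) z - (F ^^ n) y) * (z' - y') \<le> (exp (K * s) * P n u * (z - y)) * (z' - y')"
    using 1 assms by (intro mult_right_mono) auto
  also have "\<dots> = exp (K * s) * (z - y) * (P n u * (z' - y'))" by simp
  also have "\<dots> \<le> exp (K * s) * (z - y) * (exp (K * s) * ((F ^^ n) z' - (F ^^ n) y'))"
    using 2 assms by (intro mult_left_mono) auto
  also have "\<dots> = exp (2 * K * s) * ((F ^^ n) z' - (F ^^ n) y') * (z - y)"
    by (simp add: algebra_simps flip: exp_add mult_2)
  finally show ?thesis .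
qed

text \<open>
  The doubled interval is controlled by induction on \<open>n\<close>: as long as the images of
  the enlarged interval are at most twice as long as those of \<open>{l..r}\<close>, their total
  length is at most 4, so that the distortion is at most \<open>exp (8 * K)\<close>; by the
  choice of \<open>\<eta>\<close> the two added pieces remain shorter than \<open>{l..r}\<close>
  after one more step.
\<close>

lemma Schwartz_extension:
  assumes "l < r" "0 \<le> \<eta>" "2 * \<eta> * exp (8 * K) \<le> r - l"
    and sm: "\<And>n. n \<le> N \<Longrightarrow> (\<Sum>i<n. (F ^^ i) r - (F ^^ i) l) \<le> 2" and "n \<le> N"
  shows "((F ^^ n) (r + \<eta>) - (F ^^ n) r) * (r - l) \<le> \<eta> * exp (8 * K) * ((F ^^ n) r - (F ^^ n) l)"
    and "((F ^^ n) l - (F ^^ n) (l - \<eta>)) * (r - l) \<le> \<eta> * exp (8 * K) * ((F ^^ n) r - (F ^^ n) l)"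
    and "(F ^^ n) (r + \<eta>) - (F ^^ n) (l - \<eta>) \<le> 2 * ((F ^^ n) r - (F ^^ n) l)"
proof -
  have "((F ^^ n) (r + \<eta>) - (F ^^ n) r) * (r - l) \<le> \<eta> * exp (8 * K) * ((F ^^ n) r - (F ^^ n) l) \<and>
    ((F ^^ n) l - (F ^^ n) (l - \<eta>)) * (r - l) \<le> \<eta> * exp (8 * K) * ((F ^^ n) r - (F ^^ n) l) \<and>
    (F ^^ n) (r + \<eta>) - (F ^^ n) (l - \<eta>) \<le> 2 * ((F ^^ n) r - (F ^^ n) l)"
    using \<open>n \<le> N\<close>
  proof (induction n rule: less_induct)
    case (less n)
    have "(\<Sum>i<n. (F ^^ i) (r + \<eta>) - (F ^^ i) (l - \<eta>)) \<le> (\<Sum>i<n. 2 * ((F ^^ i) r - (F ^^ i) l))"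
    proof (rule sum_mono)
      fix i assume "i \<in> {..<n}"
      then have "i < n" "i \<le> N" using less.prems by auto
      from less.IH[OF this]
      show "(F ^^ i) (r + \<eta>) - (F ^^ i) (l - \<eta>) \<le> 2 * ((F ^^ i) r - (F ^^ i) l)" by blast
    qed
    also have "\<dots> \<le> 4" using sm[OF less.prems] by (simp only: sum_distrib_left[symmetric])
    finally have s: "(\<Sum>i<n. (F ^^ i) (r + \<eta>) - (F ^^ i) (l - \<eta>)) \<le> 4" .
    have 1: "((F ^^ n) (r + \<eta>) - (F ^^ n) r) * (r - l) \<le> \<eta> * exp (8 * K) * ((F ^^ n) r - (F ^^ n) l)"
      using ratio_distortion[OF _ _ _ _ _ _ s, of r "r + \<eta>" l r] assms(1,2) by (simp add: mult_ac)
    have 2: "((F ^^ n) l - (F ^^ n) (l - \<eta>)) * (r - l) \<le> \<eta> * exp (8 * K) * ((F ^^ n) r - (F ^^ n) l)"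
      using ratio_distortion[OF _ _ _ _ _ _ s, of "l - \<eta>" l l r] assms(1,2) by (simp add: mult_ac)
    have pos: "0 < (F ^^ n) r - (F ^^ n) l" using assms(1) by (simp add: funpow_less_iff)
    have "(2 * \<eta> * exp (8 * K)) * ((F ^^ n) r - (F ^^ n) l) \<le> (r - l) * ((F ^^ n) r - (F ^^ n) l)"
      using assms(3) pos by (intro mult_right_mono) auto
    moreover have "((F ^^ n) (r + \<eta>) - (F ^^ n) r + ((F ^^ n) l - (F ^^ n) (l - \<eta>))) * (r - l)
        \<le> (2 * \<eta> * exp (8 * K)) * ((F ^^ n) r - (F ^^ n) l)"
      using add_mono[OF 1 2] by (simp only: distrib_right mult_2 mult.assoc)
    ultimately have "((F ^^ n) (r + \<eta>) - (F ^^ n) r + ((F ^^ n) l - (F ^^ n) (l - \<eta>))) * (r - l) \<le> ((F ^^ n) r - (F ^^ n) l) * (r - l)"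
      by (simp only: mult.commute)
    then have "(F ^^ n) (r + \<eta>) - (F ^^ n) r + ((F ^^ n) l - (F ^^ n) (l - \<eta>)) \<le> (F ^^ n) r - (F ^^ n) l"
      by (rule mult_right_le_imp_le) (use assms(1) in simp)
    then have "(F ^^ n) (r + \<eta>) - (F ^^ n) (l - \<eta>) \<le> 2 * ((F ^^ n) r - (F ^^ n) l)" by simp
    with 1 2 show ?case by blast
  qed
  then show "((F ^^ n) (r + \<eta>) - (F ^^ n) r) * (r - l) \<le> \<eta> * exp (8 * K) * ((F ^^ n) r - (F ^^ n) l)"
    and "((F ^^ n) l - (F ^^ n) (l - \<eta>)) * (r - l) \<le> \<eta> * exp (8 * K) * ((F ^^ n) r - (F ^^ n) l)"
    and "(F ^^ n) (r + \<eta>) - (F ^^ n) (l - \<eta>) \<le> 2 * ((F ^^ n) r - (F ^^ n) l)" by auto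
qed

text \<open>
  If both fixed points of \<open>\<lambda>x. (F ^^ n) x - k\<close> are repelling, then the
  graph lies above the diagonal just to the right of \<open>L\<close> and must cross it downwards
  at its first return.
\<close>

lemma nonrepelling_between_fixed_points:
  assumes "L < R" "(F ^^ n) L = L + k" "(F ^^ n) R = R + k"
  shows "\<exists>p. (F ^^ n) p = p + k \<and> P n p \<le> 1"
proof (rule ccontr)
  assume "\<not> ?thesis"
  then have rep: "1 < P n p" if "(F ^^ n) p = p + k" for p
    using that not_le by blast
  define g where "g x = (F ^^ n) x - x - k" for x
  have dg: "(g has_real_derivative P n x - 1) (at x)" for x
    unfolding g_def by (auto intro!: derivative_eq_intros DERIV_funpow)
  have cg: "continuous_on S g" for S using dg DERIV_isCont continuous_at_imp_continuous_on by blast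
  have "P n L - 1 > 0" using rep assms by auto
  then obtain d where d: "d > 0" "\<And>h. 0 < h \<Longrightarrow> h < d \<Longrightarrow> g L < g (L + h)"
    using DERIV_pos_inc_right[OF dg] by blast
  define h where "h = min d (R - L) / 2"
  have h: "0 < h" "h < d" "L + h < R" using d assms by (auto simp: h_def min_def field_simps)
  have gh: "0 < g (L + h)" using d(2)[OF h(1,2)] assms by (simp add: g_def)
  define Z where "Z = {L + h..R} \<inter> g -` {..0}"
  have "closed Z" unfolding Z_def
    by (intro continuous_closed_preimage cg closed_atLeastAtMost closed_atMost)
  moreover have "bounded Z" using bounded_closed_interval[of "L + h" R] by (rule bounded_subset) (auto simp: Z_def)
  ultimately have "compact Z" by (simp add: compact_eq_bounded_closed)
  moreover have "R \<in> Z" using h assms by (auto simp: Z_def g_def)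
  ultimately obtain p where p: "p \<in> Z" "\<And>z. z \<in> Z \<Longrightarrow> p \<le> z"
    using compact_attains_inf[of Z] by blast
  have lp: "L + h < p"
  proof (rule ccontr)
    assume "\<not> L + h < p"
    then have "p = L + h" using p(1) by (auto simp: Z_def)
    then show False using gh p(1) by (auto simp: Z_def)
  qed
  have gp: "0 < g y" if "L + h \<le> y" "y < p" for y
      proof (rule ccontr)
    assume "\<not> 0 < g y"
    then have "y \<in> Z" using that p(1) by (auto simp: Z_def)
    then show False using p(2)[of y] that by auto
  qed
  have "g p = 0"
  proof (rule ccontr)
    assume "g p \<noteq> 0"
    then have "g p < 0" using p by (auto simp: Z_def)
    then have "\<exists>y\<ge>L + h. y \<le> p \<and> g y = 0"
      using gh lp cg by (intro IVT2') auto
    then obtain y where y: "L + h \<le> y" "y \<le> p" "g y = 0" by blast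
    then have "y < p" using \<open>g p < 0\<close> by (cases "y = p") auto
    then show False using gp[of y] y by auto
  qed
  then have "P n p - 1 > 0" using rep[of p] by (simp add: g_def)
  then obtain d' where d': "d' > 0" "\<And>h. 0 < h \<Longrightarrow> h < d' \<Longrightarrow> g (p - h) < g p"
    using DERIV_pos_inc_left[OF dg] by blast
  define h' where "h' = min d' (p - (L + h)) / 2"
  have h': "0 < h'" "h' < d'" "L + h \<le> p - h'" using d' lp by (auto simp: h'_def min_def field_simps)
  show False using d'(2)[OF h'(1,2)] gp[of "p - h'"] h' \<open>g p = 0\<close> by auto
qed

end

section \<open>Absence of wandering intervals\<close>

locale repelling_lift = degree_two_lift +
  assumes repelling: "\<And>n x k. \<lbrakk>0 < n; (F ^^ n) x = x + of_int k\<rbrakk> \<Longrightarrow> 1 < P n x"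
begin

text \<open>
  Points with \<open>near x y\<close> will turn out to be equal. The relation is transitive
  although distances add up, because a gap larger than 1 exceeds 2 after one step
  (\<open>gap_doubles\<close>): the bound 2 for all times already implies the bound 1.
\<close>

definition near :: "real \<Rightarrow> real \<Rightarrow> bool"
  where "near x y \<longleftrightarrow> (\<forall>n. \<bar>(F ^^ n) x - (F ^^ n) y\<bar> \<le> 1)"

lemma gap_doubles: "1 < y - x \<Longrightarrow> 2 < F y - F x"
  using F_strict_mono[of "x + 1" y] F_add_1[of x] by linarith

lemma gap_grows:
  assumes "1 < (F ^^ n) y - (F ^^ n) x" "n \<le> k"
  shows "1 < (F ^^ k) y - (F ^^ k) x"
  using assms(2)
proof (induction k rule: dec_induct)
  case (step k)
  then have "2 < F ((F ^^ k) y) - F ((F ^^ k) x)" by (intro gap_doubles) auto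
  then show ?case by simp
qed (rule assms(1))

lemma near_if_le_2: "(\<And>n. \<bar>(F ^^ n) x - (F ^^ n) y\<bar> \<le> 2) \<Longrightarrow> near x y"
proof (unfold near_def, rule ccontr)
  assume b: "\<And>n. \<bar>(F ^^ n) x - (F ^^ n) y\<bar> \<le> 2" and "\<not> (\<forall>n. \<bar>(F ^^ n) x - (F ^^ n) y\<bar> \<le> 1)"
  then obtain n where "1 < \<bar>(F ^^ n) x - (F ^^ n) y\<bar>" by (meson not_le)
  then consider "1 < (F ^^ n) x - (F ^^ n) y" | "1 < (F ^^ n) y - (F ^^ n) x" by linarith
  then have "2 < \<bar>(F ^^ Suc n) x - (F ^^ Suc n) y\<bar>"
    by cases (use gap_doubles in fastforce)+
  then show False using b[of "Suc n"] by linarith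
qed

lemma near_sym: "near x y \<longleftrightarrow> near y x"
  by (simp add: near_def abs_minus_commute)

lemma near_trans: "near x y \<Longrightarrow> near y z \<Longrightarrow> near x z"
proof (rule near_if_le_2)
  fix n assume "near x y" "near y z"
  then have "\<bar>(F ^^ n) x - (F ^^ n) y\<bar> \<le> 1" "\<bar>(F ^^ n) y - (F ^^ n) z\<bar> \<le> 1" by (auto simp: near_def)
  then show "\<bar>(F ^^ n) x - (F ^^ n) z\<bar> \<le> 2" by linarith
qed

lemma near_F: "near (F x) (F y) \<longleftrightarrow> near x y"
proof
  assume n: "near x y"
  have "\<bar>(F ^^ n) (F x) - (F ^^ n) (F y)\<bar> \<le> 1" for n
    using n[unfolded near_def, rule_format, of "Suc n"] by (simp add: funpow_swap1)
  then show "near (F x) (F y)" by (simp add: near_def)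
next
  assume n: "near (F x) (F y)"
  show "near x y"
  proof (rule near_if_le_2)
    fix k
    show "\<bar>(F ^^ k) x - (F ^^ k) y\<bar> \<le> 2"
    proof (cases k)
      case 0
      have "\<bar>F x - F y\<bar> \<le> 1" using n[unfolded near_def, rule_format, of 0] by simp
      then have "\<not> 1 < x - y" "\<not> 1 < y - x" using gap_doubles[of x y] gap_doubles[of y x] by auto
      then show ?thesis using 0 by simp
    next
      case (Suc j)
      then show ?thesis using n[unfolded near_def, rule_format, of j] by (simp add: funpow_swap1)
    qed
  qed
qed

lemma near_funpow: "near ((F ^^ n) x) ((F ^^ n) y) \<longleftrightarrow> near x y"
  by (induction n) (auto simp: near_F)

lemma near_add_int: "near (x + of_int k) (y + of_int k) \<longleftrightarrow> near x y"
  by (simp add: near_def funpow_add_int)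

lemma closed_near: "closed {y. near x y}"
  unfolding near_def
  by (intro closed_Collect_all closed_Collect_le continuous_intros continuous_on_funpow)

lemma near_between: "near x z \<Longrightarrow> x \<le> y \<Longrightarrow> y \<le> z \<Longrightarrow> near x y"
proof (unfold near_def, intro allI)
  fix n assume z: "\<forall>n. \<bar>(F ^^ n) x - (F ^^ n) z\<bar> \<le> 1" and "x \<le> y" "y \<le> z"
  then have "(F ^^ n) x \<le> (F ^^ n) y" "(F ^^ n) y \<le> (F ^^ n) z" by (auto simp: funpow_le_iff)
  then show "\<bar>(F ^^ n) x - (F ^^ n) y\<bar> \<le> 1" using z[rule_format, of n] by linarith
qed

text \<open>
  Suppose that the class of \<open>x\<close> is a nondegenerate interval \<open>{l..r}\<close>.
  Its images are again full classes. If two of them meet modulo 1, then they coincide and yield a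
  periodic interval, which contains a nonrepelling periodic point. If they are disjoint modulo 1,
  then their total length is at most 2, and the extension lemma shows that a neighbourhood of
  \<open>{l..r}\<close> still has images of length at most 2, hence lies in the class.
\<close>

theorem no_homterval: assumes "near x y" shows "x = y"
proof (rule ccontr)
  assume "x \<noteq> y"
  define A where "A = {z. near x z}"
  have xA: "x \<in> A" and yA: "y \<in> A" using assms by (auto simp: A_def near_def)
  have "A \<subseteq> {x - 1..x + 1}"
  proof
    fix z assume "z \<in> A"
    then have "\<bar>(F ^^ 0) x - (F ^^ 0) z\<bar> \<le> 1" unfolding A_def near_def by blast
    then show "z \<in> {x - 1..x + 1}" by (simp add: abs_le_iff)
  qed
  then have "bounded A" by (rule bounded_subset[OF bounded_closed_interval])
  then have "compact A" using closed_near[of x] unfolding A_def by (simp add: compact_eq_bounded_closed)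
  then obtain l r where l: "l \<in> A" "\<And>z. z \<in> A \<Longrightarrow> l \<le> z" and r: "r \<in> A" "\<And>z. z \<in> A \<Longrightarrow> z \<le> r"
    using compact_attains_inf[of A] compact_attains_sup[of A] xA by blast
  have "l < r" using \<open>x \<noteq> y\<close> l(2)[OF xA] l(2)[OF yA] r(2)[OF xA] r(2)[OF yA] by linarith
  have nlr: "near l r" using l(1) r(1) near_trans near_sym unfolding A_def by blast
  have max0: "l \<le> z \<and> z \<le> r" if "near l z" for z
    using l r that near_trans[of x l z] unfolding A_def by blast
  have max: "(F ^^ i) l \<le> z \<and> z \<le> (F ^^ i) r" if n: "near ((F ^^ i) l) z" for i z
  proof -
    obtain w where w: "z = (F ^^ i) w" using funpow_surj by metis
    then have "near l w" using n near_funpow by blast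
    then show ?thesis using max0[of w] w by (simp add: funpow_le_iff)
  qed
  have len: "(F ^^ i) l \<le> (F ^^ i) r \<and> (F ^^ i) r \<le> (F ^^ i) l + 1" for i
  proof -
    have "\<bar>(F ^^ i) l - (F ^^ i) r\<bar> \<le> 1" using nlr unfolding near_def by blast
    then show ?thesis using funpow_strict_mono[OF \<open>l < r\<close>, of i] by linarith
  qed
  (* Two images that meet belong to the same class, up to the translation. *)
  have same: "(F ^^ i) l + of_int k = (F ^^ j) l \<and> (F ^^ i) r + of_int k = (F ^^ j) r"
    if meet: "{(F ^^ i) l + of_int k<..<(F ^^ i) r + of_int k} \<inter> {(F ^^ j) l<..<(F ^^ j) r} \<noteq> {}" for i j k
  proof -
    obtain z where "z \<in> {(F ^^ i) l + of_int k<..<(F ^^ i) r + of_int k} \<inter> {(F ^^ j) l<..<(F ^^ j) r}"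
      using meet by blast
    then have z: "(F ^^ i) l + of_int k < z" "z < (F ^^ i) r + of_int k" "(F ^^ j) l < z" "z < (F ^^ j) r"
      by simp_all
    have ni: "near ((F ^^ i) l + of_int k) ((F ^^ i) r + of_int k)" and nj: "near ((F ^^ j) l) ((F ^^ j) r)"
      using nlr by (simp_all only: near_add_int near_funpow)
    have zi: "near ((F ^^ i) l + of_int k) z" by (rule near_between[OF ni]) (use z in linarith)+
    have zj: "near ((F ^^ j) l) z" by (rule near_between[OF nj]) (use z in linarith)+
    have e: "near ((F ^^ i) l + of_int k) ((F ^^ j) l)"
      using near_trans[OF zi] zj near_sym[of z] by blast
    have e': "near ((F ^^ i) l) ((F ^^ j) l + of_int (- k))"
      using e near_add_int[of "(F ^^ i) l" k "(F ^^ j) l + of_int (-k)"] by simp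
    have "near ((F ^^ i) l) ((F ^^ j) r + of_int (- k))"
      using near_trans[OF e'] nj near_add_int[of "(F ^^ j) l" "-k" "(F ^^ j) r"] by blast
    moreover have e2: "near ((F ^^ j) l) ((F ^^ i) l + of_int k)"
      using e by (rule near_sym[THEN iffD1])
    moreover have "near ((F ^^ j) l) ((F ^^ i) r + of_int k)"
      by (rule near_trans[OF e2 ni])
    ultimately have "(F ^^ j) r + of_int (- k) \<le> (F ^^ i) r" "(F ^^ j) l \<le> (F ^^ i) l + of_int k"
        "(F ^^ i) r + of_int k \<le> (F ^^ j) r" "(F ^^ i) l \<le> (F ^^ j) l + of_int (- k)"
      using max e' by blast+
    then show ?thesis by auto
  qed
  show False
  proof (cases "\<exists>i j k. i < j \<and> {(F ^^ i) l + of_int k<..<(F ^^ i) r + of_int k} \<inter> {(F ^^ j) l<..<(F ^^ j) r} \<noteq> {}")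
    case True
    then obtain i j k where ij: "i < j" and
      ne: "{(F ^^ i) l + of_int k<..<(F ^^ i) r + of_int k} \<inter> {(F ^^ j) l<..<(F ^^ j) r} \<noteq> {}" by blast
    have eq: "(F ^^ j) z = (F ^^ (j - i)) ((F ^^ i) z)" for z
      using ij by (metis add.commute comp_apply funpow_add le_add_diff_inverse2 less_imp_le)
    have "(F ^^ (j - i)) ((F ^^ i) l) = (F ^^ i) l + of_int k" "(F ^^ (j - i)) ((F ^^ i) r) = (F ^^ i) r + of_int k"
      using same[OF ne] by (simp_all only: eq)
    then obtain p where "(F ^^ (j - i)) p = p + of_int k" "P (j - i) p \<le> 1"
      using nonrepelling_between_fixed_points[OF funpow_strict_mono[OF \<open>l < r\<close>]] by blast
    then show False using repelling[of "j - i" p k] ij by auto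
  next
    case False
    have disj: "{(F ^^ i) l + of_int k<..<(F ^^ i) r + of_int k} \<inter> {(F ^^ j) l<..<(F ^^ j) r} = {}" if "i \<noteq> j" for i j k
    proof (cases "i < j")
      case True then show ?thesis using False by blast
    next
      case not: False
      show ?thesis
      proof (rule ccontr)
        assume "\<not> ?thesis"
        then obtain z where "z \<in> {(F ^^ i) l + of_int k<..<(F ^^ i) r + of_int k}" "z \<in> {(F ^^ j) l<..<(F ^^ j) r}" by blast
        then have "z + of_int (-k) \<in> {(F ^^ j) l + of_int (-k)<..<(F ^^ j) r + of_int (-k)} \<inter> {(F ^^ i) l<..<(F ^^ i) r}" by auto
        then have "\<not> j < i" using False by blast
        then show False using not that by linarith
      qed
    qed
    have sum: "(\<Sum>i<n. (F ^^ i) r - (F ^^ i) l) \<le> 2" for n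
      by (rule sum_lengths_disjoint_mod_1) (use len disj in auto)
    define \<eta> where "\<eta> = (r - l) / (2 * exp (8 * K))"
    have "\<eta> > 0" using \<open>l < r\<close> by (simp add: \<eta>_def)
    have ext: "(F ^^ n) (r + \<eta>) - (F ^^ n) (l - \<eta>) \<le> 2 * ((F ^^ n) r - (F ^^ n) l)" for n
      by (rule Schwartz_extension(3)[where N = n]) (use \<open>l < r\<close> \<open>\<eta> > 0\<close> sum in \<open>auto simp: \<eta>_def\<close>)
    have "near l (r + \<eta>)"
    proof (rule near_if_le_2)
      fix n
      have "(F ^^ n) (l - \<eta>) \<le> (F ^^ n) l" "(F ^^ n) l \<le> (F ^^ n) (r + \<eta>)"
        using \<open>\<eta> > 0\<close> \<open>l < r\<close> by (auto simp: funpow_le_iff)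
      moreover have "2 * ((F ^^ n) r - (F ^^ n) l) \<le> 2" using conjunct2[OF len[of n]] by simp
      then have "(F ^^ n) (r + \<eta>) - (F ^^ n) (l - \<eta>) \<le> 2" using ext[of n] by linarith
      ultimately show "\<bar>(F ^^ n) l - (F ^^ n) (r + \<eta>)\<bar> \<le> 2" unfolding abs_le_iff by linarith
    qed
    then show False using max0[of "r + \<eta>"] \<open>\<eta> > 0\<close> by linarith
  qed
qed

lemma mesh_small:
  assumes "0 < \<epsilon>"
  shows "\<exists>N. \<forall>n\<ge>N. \<forall>x y. \<bar>(F ^^ n) x - (F ^^ n) y\<bar> \<le> 1 \<longrightarrow> \<bar>x - y\<bar> < \<epsilon>"
proof -
  have main: "\<exists>N. \<forall>x y. x \<le> y \<longrightarrow> (F ^^ N) y - (F ^^ N) x \<le> 1 \<longrightarrow> y - x < \<epsilon>"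
  proof (rule ccontr)
    assume "\<not> ?thesis"
    then have "\<exists>x y. x \<le> y \<and> (F ^^ N) y - (F ^^ N) x \<le> 1 \<and> \<epsilon> \<le> y - x" for N
      by (meson not_le)
    then obtain X Y where XY: "\<And>N. X N \<le> Y N" "\<And>N. (F ^^ N) (Y N) - (F ^^ N) (X N) \<le> 1" "\<And>N. \<epsilon> \<le> Y N - X N"
      by metis
    have le1: "(F ^^ n) (Y N) - (F ^^ n) (X N) \<le> 1" if "n \<le> N" for n N
      using gap_grows[of n "Y N" "X N" N] XY(2)[of N] that by linarith
    define U where "U N = X N - of_int \<lfloor>X N\<rfloor>" for N
    define V where "V N = Y N - of_int \<lfloor>X N\<rfloor>" for N
    have UV: "(F ^^ n) (V N) - (F ^^ n) (U N) \<le> 1" if "n \<le> N" for n N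
      using le1[OF that] funpow_add_int[of n "Y N" "- \<lfloor>X N\<rfloor>"] funpow_add_int[of n "X N" "- \<lfloor>X N\<rfloor>"]
      by (simp add: U_def V_def)
    have "U N \<in> {0..1}" for N unfolding U_def atLeastAtMost_iff by linarith
    moreover have "V N \<in> {0..2}" for N
      using UV[of 0 N] XY(1)[of N] \<open>U N \<in> {0..1}\<close> unfolding U_def V_def by simp linarith
    ultimately have "(U N, V N) \<in> {0..1} \<times> {0..2}" for N by auto
    moreover have "compact ({0..1::real} \<times> {0..2::real})" by (intro compact_Times compact_Icc)
    ultimately obtain p s where s: "strict_mono (s :: nat \<Rightarrow> nat)" "((\<lambda>N. (U N, V N)) \<circ> s) \<longlonglongrightarrow> p"
      unfolding compact_def by (meson)
    then have s2: "(\<lambda>N. (U (s N), V (s N))) \<longlonglongrightarrow> p" by (simp add: o_def)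
    obtain u v where p: "p = (u, v)" by force
    have u: "(\<lambda>N. U (s N)) \<longlonglongrightarrow> u" and v: "(\<lambda>N. V (s N)) \<longlonglongrightarrow> v"
      using tendsto_fst[OF s2] tendsto_snd[OF s2] p by auto
    have "\<epsilon> \<le> v - u"
      by (rule tendsto_lowerbound[OF tendsto_diff[OF v u]]) (use XY(3) in \<open>auto simp: U_def V_def\<close>)
    have "near u v"
    proof (rule near_if_le_2)
      fix n
      have "(\<lambda>N. (F ^^ n) (V (s N)) - (F ^^ n) (U (s N))) \<longlonglongrightarrow> (F ^^ n) v - (F ^^ n) u"
        by (intro tendsto_diff isCont_tendsto_compose[OF isCont_funpow] u v)
      moreover have "\<forall>\<^sub>F N in sequentially. (F ^^ n) (V (s N)) - (F ^^ n) (U (s N)) \<le> 1"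
        using UV s(1) by (intro eventually_sequentiallyI[of n]) (meson le_trans seq_suble)
      ultimately have "(F ^^ n) v - (F ^^ n) u \<le> 1" by (intro tendsto_upperbound) auto
      moreover have "(F ^^ n) u \<le> (F ^^ n) v" using \<open>\<epsilon> \<le> v - u\<close> assms by (auto simp: funpow_le_iff)
      ultimately show "\<bar>(F ^^ n) u - (F ^^ n) v\<bar> \<le> 2" by linarith
    qed
    then show False using no_homterval[of u v] \<open>\<epsilon> \<le> v - u\<close> assms by auto
  qed
  then obtain N where N: "\<And>x y. x \<le> y \<Longrightarrow> (F ^^ N) y - (F ^^ N) x \<le> 1 \<Longrightarrow> y - x < \<epsilon>" by blast
  have "\<bar>x - y\<bar> < \<epsilon>" if "N \<le> n" "\<bar>(F ^^ n) x - (F ^^ n) y\<bar> \<le> 1" for n x y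
  proof -
    have "(F ^^ N) y - (F ^^ N) x \<le> 1" "(F ^^ N) x - (F ^^ N) y \<le> 1"
      using gap_grows[of N y x n] gap_grows[of N x y n] that by linarith+
    then show ?thesis using N[of x y] N[of y x] by (cases "x \<le> y") auto
  qed
  then show ?thesis by blast
qed

section \<open>Cylinders and first entries\<close>

text \<open>
  A fixed point of \<open>F\<close>. The preimages of \<open>q + \<int>\<close> under
  \<open>F ^^ n\<close> cut the line into the cylinders of level \<open>n\<close>:
  \<open>idx n x\<close> numbers the one that contains \<open>x\<close>, \<open>lo n j\<close>
  is the left end of the one with number \<open>j\<close>, and \<open>len n j\<close> is its
  length. Since \<open>F\<close> maps \<open>q + j\<close> to \<open>q + 2 * j\<close>, the
  number at level \<open>n\<close> is obtained from that at level \<open>Suc n\<close> by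
  dropping the last binary digit, and \<open>F\<close> itself leaves the number unchanged while
  the level decreases by one. A translation by 1 adds \<open>2 ^ n\<close>, so the residue class
  \<open>idx n x mod 2 ^ n\<close> determines the cylinder modulo 1.
\<close>

definition q :: real where "q = (SOME x. F x = x)"

lemma F_q: "F q = q"
proof -
  have "\<exists>x. F x - x = 0"
  proof -
    define k where "k = \<lceil>\<bar>F 0\<bar>\<rceil>"
    have "\<bar>F 0\<bar> \<le> of_int k" "k \<ge> 0" by (auto simp: k_def)
    then have "F (0 + of_int (-k)) - of_int (-k) \<le> 0 \<and> 0 \<le> F (0 + of_int k) - of_int k"
      unfolding F_add_int by auto
    moreover have "continuous_on {of_int (- k)..of_int k} (\<lambda>x. F x - x)"
      using continuous_on_funpow[of _ 1] by (intro continuous_intros) simp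
    ultimately show ?thesis
      using IVT'[of "\<lambda>x. F x - x" "of_int (-k)" 0 "of_int k"] \<open>k \<ge> 0\<close> by auto
  qed
  then show ?thesis unfolding q_def by (intro someI_ex[where P = "\<lambda>x. F x = x"]) auto
qed

lemma funpow_q: "(F ^^ n) (q + of_int k) = q + of_int (2 ^ n * k)"
proof -
  have "(F ^^ n) q = q" by (induction n) (auto simp: F_q)
  then show ?thesis by (simp add: funpow_add_int)
qed

definition idx :: "nat \<Rightarrow> real \<Rightarrow> int" where "idx n x = \<lfloor>(F ^^ n) x - q\<rfloor>"

lemma idx_Suc: "idx (Suc n) x div 2 = idx n x"
proof -
  define y where "y = (F ^^ n) x"
  define j where "j = idx n x"
  have "q + of_int j \<le> y" "y < q + of_int (j + 1)" unfolding j_def idx_def y_def by linarith+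
  then have "(F ^^ 1) (q + of_int j) \<le> (F ^^ 1) y" "(F ^^ 1) y < (F ^^ 1) (q + of_int (j + 1))"
    using funpow_le_iff funpow_less_iff by blast+
  then have "q + of_int (2 * j) \<le> F y" "F y < q + of_int (2 * j + 2)"
    unfolding funpow_q by (simp_all add: algebra_simps)
  then have "2 * j \<le> idx (Suc n) x" "idx (Suc n) x < 2 * j + 2"
    unfolding idx_def y_def by (simp_all add: le_floor_iff floor_less_iff algebra_simps)
  then show ?thesis unfolding j_def by linarith
qed

lemma idx_div: "idx (n + k) x div 2 ^ k = idx n x"
proof (induction k)
  case (Suc k)
  have "idx (n + Suc k) x div 2 ^ Suc k = idx (Suc (n + k)) x div 2 div 2 ^ k"
    by (simp add: div_mult2_eq' zdiv_zmult2_eq)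
  then show ?case using Suc idx_Suc by simp
qed simp

lemma idx_eq_mono: "n \<le> n' \<Longrightarrow> idx n' x = idx n' y \<Longrightarrow> idx n x = idx n y"
  using idx_div[of n "n' - n"] by (metis le_add_diff_inverse)

lemma idx_funpow: "idx n ((F ^^ i) x) = idx (n + i) x"
  by (simp add: idx_def funpow_add)

lemma idx_add_int: "idx n (x + of_int k) = idx n x + 2 ^ n * k"
proof -
  have "(F ^^ n) (x + of_int k) - q = (F ^^ n) x - q + of_int (2 ^ n * k)"
    by (simp add: funpow_add_int)
  then show ?thesis unfolding idx_def by (simp only: floor_add_int)
qed

definition lo :: "nat \<Rightarrow> int \<Rightarrow> real" where "lo n j = (THE x. (F ^^ n) x = q + of_int j)"

lemma funpow_lo: "(F ^^ n) (lo n j) = q + of_int j"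
  unfolding lo_def by (rule theI') (metis funpow_surj funpow_eq_iff)

lemma lo_eqI: "(F ^^ n) x = q + of_int j \<Longrightarrow> lo n j = x"
  using funpow_lo funpow_eq_iff by metis

lemma funpow_lo_add: "(F ^^ i) (lo (n + i) j) = lo n j"
proof (rule lo_eqI[symmetric])
  show "(F ^^ n) ((F ^^ i) (lo (n + i) j)) = q + of_int j"
    using funpow_lo[of "n + i" j] by (simp add: funpow_add)
qed

lemma lo_add_int: "lo n (j + 2 ^ n * k) = lo n j + of_int k"
  by (rule lo_eqI) (simp add: funpow_add_int funpow_lo)

lemma lo_less_iff: "lo n j < lo n k \<longleftrightarrow> j < k"
  using funpow_less_iff[of n "lo n j" "lo n k"] by (simp add: funpow_lo)

lemma lo_le_iff: "lo n j \<le> lo n k \<longleftrightarrow> j \<le> k"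
  using funpow_le_iff[of n "lo n j" "lo n k"] by (simp add: funpow_lo)

lemma idx_eq_iff: "idx n x = j \<longleftrightarrow> lo n j \<le> x \<and> x < lo n (j + 1)"
proof -
  have "lo n j \<le> x \<longleftrightarrow> q + of_int j \<le> (F ^^ n) x" "x < lo n (j + 1) \<longleftrightarrow> (F ^^ n) x < q + of_int (j + 1)"
    using funpow_le_iff[of n "lo n j" x] funpow_less_iff[of n x "lo n (j + 1)"] by (simp_all add: funpow_lo)
  then show ?thesis unfolding idx_def floor_eq_iff by auto
qed

definition len :: "nat \<Rightarrow> int \<Rightarrow> real" where "len n j = lo n (j + 1) - lo n j"

lemma len_pos: "0 < len n j"
  by (simp add: len_def lo_less_iff)

lemma len_add_int: "len n (j + 2 ^ n * k) = len n j"
  using lo_add_int[of n "j + 1" k] lo_add_int[of n j k] by (simp add: len_def algebra_simps)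

lemma len_mod: "len n (j mod 2 ^ n) = len n j"
proof -
  have "j = j mod 2 ^ n + 2 ^ n * (j div 2 ^ n)" by simp
  then show ?thesis using len_add_int[of n "j mod 2 ^ n" "j div 2 ^ n"] by simp
qed

lemma spread_lo: "(F ^^ n) (lo n (j + 1)) - (F ^^ n) (lo n j) = 1"
  by (simp add: funpow_lo)

lemma len_le_1: "len n j \<le> 1"
proof (rule ccontr)
  assume "\<not> ?thesis"
  then have "1 < (F ^^ 0) (lo n (j + 1)) - (F ^^ 0) (lo n j)" by (simp add: len_def)
  then have "1 < (F ^^ n) (lo n (j + 1)) - (F ^^ n) (lo n j)" by (rule gap_grows) simp
  then show False by (simp add: spread_lo)
qed

lemma len_small: "0 < \<epsilon> \<Longrightarrow> \<exists>N. \<forall>n\<ge>N. \<forall>j. len n j < \<epsilon>"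
proof -
  assume "0 < \<epsilon>"
  then obtain N where N: "\<And>n x y. N \<le> n \<Longrightarrow> \<bar>(F ^^ n) x - (F ^^ n) y\<bar> \<le> 1 \<Longrightarrow> \<bar>x - y\<bar> < \<epsilon>"
    using mesh_small by blast
  have "len n j < \<epsilon>" if "N \<le> n" for n j
    using N[OF that, of "lo n (j + 1)" "lo n j"] by (simp add: spread_lo len_def)
  then show ?thesis by blast
qed

lemma F1_le: "F1 x \<le> 2 * exp K"
proof -
  obtain \<xi> where \<xi>: "x < \<xi>" "\<xi> < x + 1" "F (x + 1) - F x = (x + 1 - x) * F1 \<xi>"
    using MVT2[of x "x + 1" F F1] DF by auto
  then have "F1 \<xi> = 2" by (simp add: F_add_1)
  then have "F1 x \<le> exp (K * \<bar>x - \<xi>\<bar>) * 2" using F1_distortion[of x \<xi>] by simp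
  moreover have "exp (K * \<bar>x - \<xi>\<bar>) \<le> exp K"
    using \<xi> K_nonneg mult_left_le[of "\<bar>x - \<xi>\<bar>" K] by simp
  ultimately show ?thesis by linarith
qed

lemma P_le: "P n x \<le> (2 * exp K) ^ n"
  using prod_mono[of "{..<n}" "\<lambda>i. F1 ((F ^^ i) x)" "\<lambda>i. 2 * exp K"] F1_le F1_pos
  by (simp add: P_def less_imp_le)

lemma len_ge: "1 / (2 * exp K) ^ n \<le> len n j"
proof -
  have "lo n j < lo n (j + 1)" by (simp add: lo_less_iff)
  then obtain \<xi> where "(F ^^ n) (lo n (j + 1)) - (F ^^ n) (lo n j) = (lo n (j + 1) - lo n j) * P n \<xi>"
    using MVT2[of "lo n j" "lo n (j + 1)" "F ^^ n" "P n"] DERIV_funpow by blast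
  then have "1 = len n j * P n \<xi>" by (simp add: spread_lo len_def)
  also have "\<dots> \<le> len n j * (2 * exp K) ^ n"
    using P_le[of n \<xi>] len_pos[of n j] by (intro mult_left_mono) linarith+
  finally show ?thesis by (simp add: divide_le_eq)
qed

lemma len_ge_uniform: "n \<le> N \<Longrightarrow> 1 / (2 * exp K) ^ N \<le> len n j"
proof -
  assume "n \<le> N"
  have "1 \<le> 2 * exp K" using K_nonneg one_le_exp_iff[of K] by linarith
  then have "(2 * exp K) ^ n \<le> (2 * exp K) ^ N" using \<open>n \<le> N\<close> by (rule power_increasing[rotated])
  then have "1 / (2 * exp K) ^ N \<le> 1 / (2 * exp K) ^ n" by (intro divide_left_mono) auto
  then show ?thesis using len_ge[of n j] by linarith
qed

lemma div_pow_cong: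
  fixes a b :: int
  assumes "a mod 2 ^ (k + e) = b mod 2 ^ (k + e)"
  shows "(a div 2 ^ e) mod 2 ^ k = (b div 2 ^ e) mod 2 ^ k"
proof -
  have "2 ^ (k + e) dvd a - b" using assms by (simp add: mod_eq_dvd_iff)
  then obtain c where "a - b = 2 ^ (k + e) * c" by blast
  then have "a = b + 2 ^ e * (2 ^ k * c)" by (simp add: power_add algebra_simps)
  then have "a div 2 ^ e = b div 2 ^ e + 2 ^ k * c" by simp
  then show ?thesis by simp
qed

text \<open>
  In terms of binary digits, the class at level \<open>N\<close> is a word of length
  \<open>N\<close> and the classes of the images at level \<open>k\<close> are its subwords of
  length \<open>k\<close>.
\<close>

lemma idx_word:
  assumes "idx N x mod 2 ^ N = idx N y mod 2 ^ N" "k + s \<le> N"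
  shows "idx (k + s) x mod 2 ^ k = idx (k + s) y mod 2 ^ k"
proof -
  define e where "e = N - (k + s)"
  have N: "N = k + s + e" using assms(2) by (simp add: e_def)
  have "idx N x mod 2 ^ (k + e) = idx N y mod 2 ^ (k + e)"
  proof -
    have d: "(2::int) ^ (k + e) dvd 2 ^ N" by (rule le_imp_power_dvd) (simp add: N)
    show ?thesis using assms(1) mod_mod_cancel[OF d] by metis
  qed
  then have "(idx N x div 2 ^ e) mod 2 ^ k = (idx N y div 2 ^ e) mod 2 ^ k" by (rule div_pow_cong)
  then show ?thesis unfolding N idx_div .
qed

text \<open>
  If the images with indices \<open>i < j\<close> of the cylinder at level
  \<open>n + p\<close> met modulo 1, then the orbit of \<open>x\<close> would visit its final
  class of level \<open>n\<close> already at time \<open>p - (j - i)\<close>. So they are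
  disjoint modulo 1.
\<close>

lemma first_entry_sum:
  assumes first: "\<And>i. 0 < i \<Longrightarrow> i < p \<Longrightarrow> idx (n + i) x mod 2 ^ n \<noteq> idx (n + p) x mod 2 ^ n"
    and J: "J = idx (n + p) x" and "t \<le> p"
  shows "(\<Sum>i<t. (F ^^ i) (lo (n + p) (J + 1)) - (F ^^ i) (lo (n + p) J)) \<le> 2"
proof (rule sum_lengths_disjoint_mod_1)
  have lo_i: "(F ^^ i) (lo (n + p) j) = lo (n + p - i) j" if "i < p" for i j
    using funpow_lo_add[of i "n + p - i" j] that by simp
  show "finite {..<t}" by simp
  show "(F ^^ i) (lo (n + p) J) \<le> (F ^^ i) (lo (n + p) (J + 1)) \<and>
        (F ^^ i) (lo (n + p) (J + 1)) \<le> (F ^^ i) (lo (n + p) J) + 1" if "i \<in> {..<t}" for i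
    using that \<open>t \<le> p\<close> len_le_1[of "n + p - i" J] len_pos[of "n + p - i" J] by (simp add: lo_i len_def)
  have dis: False if ij: "i < j" "j < p" and z: "idx (n + p - i) (z + of_int (- k)) = J" "idx (n + p - j) z = J" for i j k z
  proof -
    define d where "d = j - i"
    define N where "N = n + p - j"
    have Nd: "n + p - i = N + d" using ij by (simp add: N_def d_def)
    have 1: "idx N (z + of_int (- k)) = J div 2 ^ d"
      using idx_div[of N d "z + of_int (-k)"] z(1) by (simp add: Nd)
    have "J - J div 2 ^ d = 2 ^ N * k" using 1 z(2) idx_add_int[of N z "-k"] by (simp add: N_def)
    moreover have "(2::int) ^ n dvd 2 ^ N" using ij by (intro le_imp_power_dvd) (simp add: N_def)
    ultimately have Jm: "J mod 2 ^ n = (J div 2 ^ d) mod 2 ^ n"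
      by (simp add: mod_eq_dvd_iff)
    have dp: "0 < p - d" "p - d < p" using ij by (auto simp: d_def)
    have "J div 2 ^ d = idx (n + (p - d)) x"
      using idx_div[of "n + (p - d)" d x] dp by (simp add: J)
    then show False using first[OF dp] J Jm by metis
  qed
  have in_cyl: "idx N z = J" if "z \<in> {lo N J<..<lo N (J + 1)}" for N z
    using that by (auto simp: idx_eq_iff)
  show "{(F ^^ i) (lo (n + p) J) + of_int k<..<(F ^^ i) (lo (n + p) (J + 1)) + of_int k} \<inter>
       {(F ^^ j) (lo (n + p) J)<..<(F ^^ j) (lo (n + p) (J + 1))} = {}"
    if ij: "i \<in> {..<t}" "j \<in> {..<t}" "i \<noteq> j" for i j k
  proof (rule ccontr)
    assume "\<not> ?thesis"
    then obtain z where z: "z \<in> {(F ^^ i) (lo (n + p) J) + of_int k<..<(F ^^ i) (lo (n + p) (J + 1)) + of_int k}"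
      "z \<in> {(F ^^ j) (lo (n + p) J)<..<(F ^^ j) (lo (n + p) (J + 1))}" by blast
    have ip: "i < p" "j < p" using ij \<open>t \<le> p\<close> by auto
    have a: "idx (n + p - i) (z + of_int (- k)) = J" "idx (n + p - j) z = J"
      using z by (auto intro!: in_cyl simp: lo_i[OF ip(1)] lo_i[OF ip(2)])
    show False
    proof (cases "i < j")
      case True then show ?thesis using dis a ip by blast
    next
      case False
      then show ?thesis using dis[of j i "z + of_int (- k)" "-k"] a ip ij by simp
    qed
  qed
qed

lemma first_entry_P:
  assumes first: "\<And>i. 0 < i \<Longrightarrow> i < p \<Longrightarrow> idx (n + i) x mod 2 ^ n \<noteq> idx (n + p) x mod 2 ^ n"
    and J: "J = idx (n + p) x"
  shows "len n J \<le> exp (2 * K) * P p x * len (n + p) J"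
proof -
  have "x \<in> {lo (n + p) J..lo (n + p) (J + 1)}" using idx_eq_iff[of "n + p" x J] J by auto
  from length_distortion(1)[OF this _ _ _ first_entry_sum[OF first J order_refl], of "lo (n + p) J" "lo (n + p) (J + 1)"]
  show ?thesis by (simp add: funpow_lo_add len_def lo_le_iff mult.commute)
qed

end

section \<open>The density of the Hilbert metric\<close>

text \<open>
  The density at \<open>z\<close> of the Hilbert metric of the interval \<open>{u<..<w}\<close>.
  It is invariant under projective maps, almost invariant under smooth maps of short intervals,
  and it drops by a definite factor when the interval is enlarged proportionally.
\<close>

definition hilbert_density :: "real \<Rightarrow> real \<Rightarrow> real \<Rightarrow> real"
  where "hilbert_density u w z = 1 / (z - u) + 1 / (w - z)"

lemma hilbert_density_pos: "u < z \<Longrightarrow> z < w \<Longrightarrow> 0 < hilbert_density u w z"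
  by (simp add: hilbert_density_def add_pos_pos)

text \<open>
  For the parts \<open>\<alpha>\<close> and \<open>\<beta>\<close> of the interval on the two
  sides of \<open>z\<close>, with \<open>t = \<alpha> + \<beta>\<close>, the claim is
  \<open>(1 + 2 * \<eta>)\<^sup>2 * \<alpha> * \<beta> \<le> (\<alpha> + \<eta> * t) * (\<beta> + \<eta> * t)\<close>,
  which amounts to \<open>4 * \<alpha> * \<beta> \<le> t\<^sup>2\<close>.
\<close>

lemma hilbert_density_enlarge:
  assumes "u < z" "z < w" "0 \<le> \<eta>" "u' \<le> u - \<eta> * (w - u)" "w + \<eta> * (w - u) \<le> w'"
  shows "(1 + 2 * \<eta>) * hilbert_density u' w' z \<le> hilbert_density u w z"
proof -
  define \<alpha> \<beta> t where d: "\<alpha> = z - u" "\<beta> = w - z" "t = w - u"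
  have pos: "0 < \<alpha>" "0 < \<beta>" "t = \<alpha> + \<beta>" "0 < t" using assms by (auto simp: d)
  have et: "0 \<le> \<eta> * t" using assms pos by simp
  have "hilbert_density u' w' z \<le> 1 / (\<alpha> + \<eta> * t) + 1 / (\<beta> + \<eta> * t)"
    unfolding hilbert_density_def
  proof -
    have "\<alpha> + \<eta> * t \<le> z - u'" "\<beta> + \<eta> * t \<le> w' - z" using assms by (auto simp: d)
    moreover have "0 < \<alpha> + \<eta> * t" "0 < \<beta> + \<eta> * t" using pos et by auto
    ultimately show "1 / (z - u') + 1 / (w' - z) \<le> 1 / (\<alpha> + \<eta> * t) + 1 / (\<beta> + \<eta> * t)"
      by (intro add_mono divide_left_mono mult_pos_pos) auto
  qed
  also have "\<dots> = (1 + 2 * \<eta>) * t / ((\<alpha> + \<eta> * t) * (\<beta> + \<eta> * t))"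
    using pos et by (simp add: field_simps add_pos_nonneg)
  finally have 1: "hilbert_density u' w' z \<le> (1 + 2 * \<eta>) * t / ((\<alpha> + \<eta> * t) * (\<beta> + \<eta> * t))" .
  have sq: "4 * (\<alpha> * \<beta>) \<le> t * t"
    using zero_le_square[of "\<alpha> - \<beta>"] unfolding pos(3) by (simp add: algebra_simps)
  have "(1 + 2 * \<eta>) * (1 + 2 * \<eta>) * (\<alpha> * \<beta>) = \<alpha> * \<beta> + (\<eta> + \<eta> * \<eta>) * (4 * (\<alpha> * \<beta>))" by (simp add: algebra_simps)
  also have "\<dots> \<le> \<alpha> * \<beta> + (\<eta> + \<eta> * \<eta>) * (t * t)"
    using sq assms by (intro add_left_mono mult_left_mono) auto
  also have "\<dots> = (\<alpha> + \<eta> * t) * (\<beta> + \<eta> * t)" unfolding pos(3) by (simp add: algebra_simps)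
  finally have 2: "(1 + 2 * \<eta>) * (1 + 2 * \<eta>) * (\<alpha> * \<beta>) \<le> (\<alpha> + \<eta> * t) * (\<beta> + \<eta> * t)" .
  have p: "0 < (\<alpha> + \<eta> * t) * (\<beta> + \<eta> * t)" using pos et by (intro mult_pos_pos) auto
  have "(1 + 2 * \<eta>) * ((1 + 2 * \<eta>) * t / ((\<alpha> + \<eta> * t) * (\<beta> + \<eta> * t))) = t * ((1 + 2 * \<eta>) * (1 + 2 * \<eta>)) / ((\<alpha> + \<eta> * t) * (\<beta> + \<eta> * t))"
    by simp
  also have "\<dots> \<le> t * (1 / (\<alpha> * \<beta>))"
    using 2 p pos mult_left_mono[OF 2, of t] by (simp add: divide_le_eq field_simps)
  also have "\<dots> = hilbert_density u w z" unfolding hilbert_density_def using pos by (simp add: d field_simps)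
  finally show ?thesis using 1 assms(3) mult_left_mono[OF 1, of "1 + 2 * \<eta>"] by linarith
qed

context degree_two_lift
begin

lemma F_taylor2:
  "\<bar>F y - F z - F1 z * (y - z) - F2 z / 2 * (y - z)\<^sup>2\<bar> \<le> M / 6 * \<bar>y - z\<bar> ^ 3"
proof (cases "y = z")
  case False
  define diff where "diff k = (if k = 0 then F else if k = 1 then F1 else if k = 2 then F2 else F3)" for k :: nat
  have "\<exists>t. (if y < z then y < t \<and> t < z else z < t \<and> t < y) \<and>
      F y = (\<Sum>k<3. diff k z / fact k * (y - z) ^ k) + diff 3 t / fact 3 * (y - z) ^ 3"
  proof (rule Taylor[where a = "min y z" and b = "max y z"])
    show "\<forall>k t. k < 3 \<and> min y z \<le> t \<and> t \<le> max y z \<longrightarrow> (diff k has_real_derivative diff (Suc k) t) (at t)"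
    proof (intro allI impI)
      fix k :: nat and t assume "k < 3 \<and> min y z \<le> t \<and> t \<le> max y z"
      then consider "k = 0" | "k = 1" | "k = 2" by linarith
      then show "(diff k has_real_derivative diff (Suc k) t) (at t)"
        by cases (auto simp: diff_def DF DF1 DF2)
    qed
  qed (use False in \<open>auto simp: diff_def\<close>)
  then obtain t where "F y = (\<Sum>k<3. diff k z / fact k * (y - z) ^ k) + diff 3 t / fact 3 * (y - z) ^ 3" by blast
  then have "F y - F z - F1 z * (y - z) - F2 z / 2 * (y - z)\<^sup>2 = F3 t / 6 * (y - z) ^ 3"
    by (simp add: diff_def eval_nat_numeral)
  then have "\<bar>F y - F z - F1 z * (y - z) - F2 z / 2 * (y - z)\<^sup>2\<bar> = \<bar>F3 t\<bar> / 6 * \<bar>y - z\<bar> ^ 3"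
    by (simp only: abs_mult power_abs abs_divide abs_numeral)
  also have "\<dots> \<le> M / 6 * \<bar>y - z\<bar> ^ 3" using F3_le[of t] by (intro mult_right_mono) auto
  finally show ?thesis .
qed simp

definition C0 :: real where "C0 = K\<^sup>2 / 2 + K / 3"

lemma C0_nonneg: "0 \<le> C0" using K_nonneg by (simp add: C0_def)

text \<open>
  Let \<open>A\<close> and \<open>B\<close> be the difference quotients of \<open>F\<close> on the
  two sides of \<open>z\<close>. The contributions of \<open>F2\<close> to
  \<open>F1 z * (a * A + c * B)\<close> and to \<open>L * (A * B)\<close> agree up to
  a multiple of \<open>B - A\<close>, so that the two sides of the comparison differ only in
  third order of the length \<open>L\<close>.
\<close>

lemma hilbert_density_step:
  assumes uzw: "u < z" "z < w" and "w - u \<le> 1"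
  shows "(1 - C0 * (w - u)\<^sup>2) * hilbert_density u w z \<le> F1 z * hilbert_density (F u) (F w) (F z)"
proof -
  define a c L where d: "a = z - u" "c = w - z" "L = w - u"
  have ac: "0 < a" "0 < c" "L = a + c" "L \<le> 1" "0 < L" using assms by (auto simp: d)
  define A B where AB: "A = (F z - F u) / a" "B = (F w - F z) / c"
  define \<rho>1 where "\<rho>1 = A - (F1 z - F2 z / 2 * a)"
  define \<rho>2 where "\<rho>2 = B - (F1 z + F2 z / 2 * c)"
  have r1: "\<bar>\<rho>1\<bar> \<le> M / 6 * a\<^sup>2"
  proof -
    have "F u - F z - F1 z * (u - z) - F2 z / 2 * (u - z)\<^sup>2 = - (a * \<rho>1)"
      using ac(1) by (simp add: \<rho>1_def AB d field_simps power2_eq_square)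
    then have "a * \<bar>\<rho>1\<bar> \<le> M / 6 * a ^ 3" using F_taylor2[of u z] ac(1) by (simp add: d abs_mult abs_minus_commute)
    then have "a * \<bar>\<rho>1\<bar> \<le> a * (M / 6 * a\<^sup>2)" by (simp add: power3_eq_cube power2_eq_square mult_ac)
    then show ?thesis using ac(1) by (simp only: mult_le_cancel_left_pos)
  qed
  have r2: "\<bar>\<rho>2\<bar> \<le> M / 6 * c\<^sup>2"
  proof -
    have "F w - F z - F1 z * (w - z) - F2 z / 2 * (w - z)\<^sup>2 = c * \<rho>2"
      using ac(2) by (simp add: \<rho>2_def AB d field_simps power2_eq_square)
    then have "c * \<bar>\<rho>2\<bar> \<le> M / 6 * c ^ 3" using F_taylor2[of w z] ac(2) by (simp add: d abs_mult)
    then have "c * \<bar>\<rho>2\<bar> \<le> c * (M / 6 * c\<^sup>2)" by (simp add: power3_eq_cube power2_eq_square mult_ac)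
    then show ?thesis using ac(2) by (simp only: mult_le_cancel_left_pos)
  qed
  have Am: "m \<le> A"
  proof -
    obtain \<xi> where "F z - F u = (z - u) * F1 \<xi>" using MVT2[OF uzw(1), of F F1] DF by blast
    then show ?thesis using F1_ge[of \<xi>] ac(1) by (simp add: AB d)
  qed
  have Bm: "m \<le> B"
  proof -
    obtain \<xi> where "F w - F z = (w - z) * F1 \<xi>" using MVT2[OF uzw(2), of F F1] DF by blast
    then show ?thesis using F1_ge[of \<xi>] ac(2) by (simp add: AB d)
  qed
  have ABpos: "0 < A" "0 < B" using Am Bm m_pos by auto
  have aL: "a \<le> L" "c \<le> L" using ac by auto
  have asq: "a\<^sup>2 \<le> L\<^sup>2" "c\<^sup>2 \<le> L\<^sup>2" using aL ac by (auto intro!: power_mono)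
  have r1L: "\<bar>\<rho>1\<bar> \<le> M / 6 * L\<^sup>2" and r2L: "\<bar>\<rho>2\<bar> \<le> M / 6 * L\<^sup>2"
    using order_trans[OF r1 mult_left_mono[OF asq(1), of "M / 6"]]
      order_trans[OF r2 mult_left_mono[OF asq(2), of "M / 6"]] M_nonneg by auto
  have L2: "L\<^sup>2 \<le> L" using ac by (simp add: power2_eq_square mult_left_le)
  have BA: "\<bar>B - A\<bar> \<le> M * L"
  proof -
    have "B - A = F2 z / 2 * L + (\<rho>2 - \<rho>1)" by (simp add: \<rho>1_def \<rho>2_def ac(3) algebra_simps)
    moreover have "\<bar>F2 z / 2 * L\<bar> \<le> M / 2 * L"
      using F2_le[of z] ac by (simp add: abs_mult)
    moreover have "\<bar>\<rho>1\<bar> \<le> M / 6 * L" "\<bar>\<rho>2\<bar> \<le> M / 6 * L"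
      using r1 r2 order_trans[OF asq(1) L2] order_trans[OF asq(2) L2] M_nonneg
      by (meson divide_nonneg_pos mult_left_mono order_trans zero_less_numeral)+
    ultimately show ?thesis using mult_nonneg_nonneg[OF M_nonneg, of L] ac(5) by linarith
  qed
  have t1: "\<bar>a * c * (F2 z / 2) * (B - A)\<bar> \<le> K\<^sup>2 / 2 * L ^ 3 * (A * B)"
  proof -
    have "\<bar>a * c * (F2 z / 2) * (B - A)\<bar> = a * c * (\<bar>F2 z\<bar> / 2 * \<bar>B - A\<bar>)" using ac by (simp add: abs_mult)
    also have "\<dots> \<le> L * L * (M / 2 * (M * L))"
      using aL ac BA F2_le[of z] M_nonneg by (intro mult_mono) auto
    also have "\<dots> = K\<^sup>2 / 2 * L ^ 3 * (m * m)" using m_pos by (simp add: K_def power2_eq_square power3_eq_cube)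
    also have "\<dots> \<le> K\<^sup>2 / 2 * L ^ 3 * (A * B)"
      using Am Bm m_pos ac by (intro mult_left_mono mult_mono) auto
    finally show ?thesis .
  qed
  have t2: "\<bar>a * A * \<rho>2\<bar> \<le> K / 6 * L ^ 3 * (A * B)"
  proof -
    have "\<bar>a * A * \<rho>2\<bar> = a * \<bar>\<rho>2\<bar> * A" using ac ABpos by (simp add: abs_mult)
    also have "\<dots> \<le> L * (M / 6 * L\<^sup>2) * A"
      using aL ac(1,5) ABpos r2L M_nonneg by (intro mult_right_mono mult_mono) simp_all
    also have "\<dots> = K / 6 * L ^ 3 * (A * m)" using m_pos by (simp add: K_def power2_eq_square power3_eq_cube)
    also have "\<dots> \<le> K / 6 * L ^ 3 * (A * B)"
      using Am Bm m_pos ac K_nonneg ABpos by (intro mult_left_mono) auto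
    finally show ?thesis .
  qed
  have t3: "\<bar>c * B * \<rho>1\<bar> \<le> K / 6 * L ^ 3 * (A * B)"
  proof -
    have "\<bar>c * B * \<rho>1\<bar> = c * \<bar>\<rho>1\<bar> * B" using ac ABpos by (simp add: abs_mult)
    also have "\<dots> \<le> L * (M / 6 * L\<^sup>2) * B"
      using aL ac(1,5) ABpos r1L M_nonneg by (intro mult_right_mono mult_mono) simp_all
    also have "\<dots> = K / 6 * L ^ 3 * (m * B)" using m_pos by (simp add: K_def power2_eq_square power3_eq_cube)
    also have "\<dots> \<le> K / 6 * L ^ 3 * (A * B)"
      using Am Bm m_pos ac K_nonneg ABpos by (intro mult_left_mono mult_right_mono) auto
    finally show ?thesis .
  qed
  have "F1 z * (a * A + c * B) - L * (A * B) = a * c * (F2 z / 2) * (B - A) - a * A * \<rho>2 - c * B * \<rho>1"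
    unfolding \<rho>1_def \<rho>2_def ac(3) by (simp add: field_simps)
  moreover have "(K\<^sup>2 / 2 + K / 3) * L ^ 3 * (A * B) = K\<^sup>2 / 2 * L ^ 3 * (A * B) + K / 6 * L ^ 3 * (A * B) + K / 6 * L ^ 3 * (A * B)"
    by (simp add: field_simps)
  ultimately have "L * (A * B) - C0 * L ^ 3 * (A * B) \<le> F1 z * (a * A + c * B)"
    unfolding C0_def using t1 t2 t3 by linarith
  then have main: "(1 - C0 * L\<^sup>2) * L * (A * B) \<le> F1 z * (a * A + c * B)"
    by (simp add: power3_eq_cube power2_eq_square algebra_simps)
  have e1: "hilbert_density u w z = L / (a * c)"
    unfolding hilbert_density_def using ac by (simp add: d field_simps)
  have e2: "hilbert_density (F u) (F w) (F z) = (a * A + c * B) / (a * c * (A * B))"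
  proof -
    have "F z - F u = a * A" "F w - F z = c * B" using ac by (auto simp: AB)
    then have "hilbert_density (F u) (F w) (F z) = 1 / (a * A) + 1 / (c * B)" by (simp add: hilbert_density_def)
    then show ?thesis using ac ABpos by (simp add: field_simps)
  qed
  have "(1 - C0 * L\<^sup>2) * (L / (a * c)) = (1 - C0 * L\<^sup>2) * L * (A * B) / (a * c * (A * B))"
    using ac ABpos by simp
  also have "\<dots> \<le> F1 z * (a * A + c * B) / (a * c * (A * B))"
    using main ac ABpos by (intro divide_right_mono) auto
  finally show ?thesis unfolding e1 e2 using d(3) by simp
qed

lemma hilbert_density_iterate:
  assumes uzw: "u < z" "z < w" and len: "\<And>i. i < n \<Longrightarrow> (F ^^ i) w - (F ^^ i) u \<le> 1"
  shows "(1 - (\<Sum>i<n. C0 * ((F ^^ i) w - (F ^^ i) u)\<^sup>2)) * hilbert_density u w z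
    \<le> P n z * hilbert_density ((F ^^ n) u) ((F ^^ n) w) ((F ^^ n) z)"
  using len
proof (induction n)
  case (Suc n)
  define S where "S = (\<Sum>i<n. C0 * ((F ^^ i) w - (F ^^ i) u)\<^sup>2)"
  define c where "c = C0 * ((F ^^ n) w - (F ^^ n) u)\<^sup>2"
  define h where "h k = hilbert_density ((F ^^ k) u) ((F ^^ k) w) ((F ^^ k) z)" for k
  have hpos: "0 < h k" for k unfolding h_def using uzw by (intro hilbert_density_pos funpow_strict_mono)
  have S0: "0 \<le> S" unfolding S_def by (intro sum_nonneg mult_nonneg_nonneg C0_nonneg) auto
  have c0: "0 \<le> c" unfolding c_def by (intro mult_nonneg_nonneg C0_nonneg) auto
  have IH: "(1 - S) * h 0 \<le> P n z * h n" using Suc by (simp add: S_def h_def)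
  have st: "(1 - c) * h n \<le> F1 ((F ^^ n) z) * h (Suc n)"
    unfolding c_def h_def using hilbert_density_step[of "(F ^^ n) u" "(F ^^ n) z" "(F ^^ n) w"] uzw Suc.prems[of n]
    by (simp add: funpow_strict_mono)
  have "(1 - (S + c)) * h 0 \<le> P (Suc n) z * h (Suc n)"
  proof (cases "c \<le> 1")
    case True
    have "(1 - (S + c)) * h 0 \<le> (1 - c) * ((1 - S) * h 0)"
      using mult_nonneg_nonneg[OF mult_nonneg_nonneg[OF c0 S0], of "h 0"] hpos[of 0] by (simp add: algebra_simps)
    also have "\<dots> \<le> (1 - c) * (P n z * h n)" using IH True by (intro mult_left_mono) auto
    also have "\<dots> = P n z * ((1 - c) * h n)" by simp
    also have "\<dots> \<le> P n z * (F1 ((F ^^ n) z) * h (Suc n))" using st P_pos[of n z] by (intro mult_left_mono) auto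
    finally show ?thesis by (simp add: P_Suc)
  next
    case False
    then have "(1 - (S + c)) * h 0 \<le> 0" using S0 hpos[of 0] by (intro mult_nonpos_nonneg) auto
    also have "0 \<le> P (Suc n) z * h (Suc n)" using P_pos[of "Suc n" z] hpos[of "Suc n"] by simp
    finally show ?thesis .
  qed
  then show ?case by (simp add: S_def c_def h_def)
qed simp

end

section \<open>Return branches with collars\<close>

context repelling_lift
begin

text \<open>
  Here \<open>{D0..D1}\<close> is the cylinder of \<open>y\<close>, and the next two returns to
  its class take the times \<open>r\<close> and \<open>r'\<close>. The points of the cylinder that
  return together with \<open>y\<close> form an interval \<open>{t0..t1}\<close>, those that
  return like \<open>y'\<close> form \<open>{u0..u1}\<close>, and \<open>{s0..s1}\<close> is the
  part of \<open>{t0..t1}\<close> that \<open>F ^^ r\<close> maps to \<open>{u0..u1}\<close>.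
  The first two are disjoint and \<open>F ^^ r\<close> maps \<open>{t0..t1}\<close> to
  \<open>{D0..D1}\<close> with bounded distortion. On the side of \<open>{u0..u1}\<close>, this
  interval itself, which is comparable to \<open>{s0..s1}\<close> or longer, lies in the collar.
  On the other side, the image of the collar contains \<open>{t0..t1}\<close>, which is at least
  as long as \<open>{u0..u1}\<close>.
\<close>

lemma collar:
  assumes ret: "idx (n + r) y mod 2 ^ n = c" "\<And>s. 0 < s \<Longrightarrow> s < r \<Longrightarrow> idx (n + s) y mod 2 ^ n \<noteq> c"
    and y: "idx n y mod 2 ^ n = c" and "0 < r" "0 < r'"
    and ret': "idx (n + r') y' mod 2 ^ n = c" "\<And>s. 0 < s \<Longrightarrow> s < r' \<Longrightarrow> idx (n + s) y' mod 2 ^ n \<noteq> c"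
    and y': "y' = (F ^^ r) y"
    and diff: "\<not> (r = r' \<and> idx (n + r) y mod 2 ^ (n + r) = idx (n + r') y' mod 2 ^ (n + r'))"
    and size: "len (n + r') (idx (n + r') y') \<le> len (n + r) (idx (n + r) y)"
    and J: "J = idx (n + r + r') y" and D: "D = idx n y"
  shows "len (n + r + r') J \<le> exp (4 * K) * (lo (n + r + r') J - lo n D)"
    and "len (n + r + r') J \<le> exp (4 * K) * (lo n (D + 1) - lo (n + r + r') (J + 1))"
proof -
  define j1 where "j1 = idx (n + r) y"
  have iy': "idx n y' = j1" by (simp add: y' idx_funpow j1_def)
  have "j1 mod 2 ^ n = D mod 2 ^ n" using ret(1) y by (simp add: j1_def D)
  (* All intervals are translated into the cylinder of y; a is the translation after the first
     return. *)
  then obtain a where a: "j1 = D + 2 ^ n * a"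
    by (metis (no_types, lifting) diff_add_cancel dvdE mod_eq_dvd_iff add.commute)
  have J': "idx (n + r') y' = J" by (simp add: y' idx_funpow J add.assoc add.commute add.left_commute)
  define z where "z = y' + of_int (- a)"
  define j2 where "j2 = idx (n + r') z"
  have j2: "j2 = J - 2 ^ (n + r') * a" unfolding j2_def z_def idx_add_int J' by simp
  have zD: "idx n z = D" unfolding z_def idx_add_int iy' a by simp
  have z_mod: "idx (n + s) z mod 2 ^ n = idx (n + s) y' mod 2 ^ n" for s
    unfolding z_def idx_add_int by (simp add: power_add mod_eq_dvd_iff mult.assoc)
  define t0 t1 where "t0 = lo (n + r) j1" and "t1 = lo (n + r) (j1 + 1)"
  define u0 u1 where "u0 = lo (n + r') j2" and "u1 = lo (n + r') (j2 + 1)"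
  define s0 s1 where "s0 = lo (n + r + r') J" and "s1 = lo (n + r + r') (J + 1)"
  define D0 D1 where "D0 = lo n D" and "D1 = lo n (D + 1)"
  define E where "E = exp (4 * K)"
  have E1: "1 \<le> E" using K_nonneg by (simp add: E_def)
  have lt: "t0 < t1" "u0 < u1" "s0 < s1" "D0 < D1"
    by (simp_all add: t0_def t1_def u0_def u1_def s0_def s1_def D0_def D1_def lo_less_iff)
  have lo_up: "lo (N + e) (i * 2 ^ e) = lo N i" for N e i
  proof (rule lo_eqI)
    show "(F ^^ (N + e)) (lo N i) = q + of_int (i * 2 ^ e)"
      using funpow_q[of e i] funpow_lo[of N i] by (simp add: funpow_add add.commute[of N e] mult.commute)
  qed
  have sub: "lo N i \<le> lo (N + e) j \<and> lo (N + e) (j + 1) \<le> lo N (i + 1)" if "j div 2 ^ e = i" for N e i j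
  proof -
    have "i * 2 ^ e \<le> j" "j + 1 \<le> (i + 1) * 2 ^ e"
    proof -
      have "j = i * 2 ^ e + j mod 2 ^ e" using that div_mult_mod_eq[of j "2 ^ e"] by simp
      moreover have "0 \<le> j mod 2 ^ e" "j mod 2 ^ e < 2 ^ e" by simp_all
      ultimately show "i * 2 ^ e \<le> j" "j + 1 \<le> (i + 1) * 2 ^ e" unfolding distrib_right mult_1 by linarith+
    qed
    then show ?thesis using lo_le_iff[of "N + e" "i * 2 ^ e" j] lo_le_iff[of "N + e" "j + 1" "(i + 1) * 2 ^ e"]
      by (simp add: lo_up)
  qed
  have tD: "D0 \<le> t0" "t1 \<le> D1"
    using sub[where N = n and e = r and i = D and j = j1] idx_div[of n r y] by (auto simp: D0_def D1_def t0_def t1_def j1_def D)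
  have uD: "D0 \<le> u0" "u1 \<le> D1"
    using sub[where N = n and e = r' and i = D and j = j2] idx_div[of n r' z] zD by (auto simp: D0_def D1_def u0_def u1_def j2_def)
  have sT: "t0 \<le> s0" "s1 \<le> t1"
    using sub[where N = "n + r" and e = r' and i = j1 and j = J] idx_div[of "n + r" r' y] by (auto simp: s0_def s1_def t0_def t1_def j1_def J)
  have sizes: "u1 - u0 \<le> t1 - t0"
  proof -
    have "len (n + r') j2 = len (n + r') J" using len_add_int[of "n + r'" j2 a] by (simp add: j2)
    then show ?thesis using size unfolding J' by (simp add: len_def u0_def u1_def t0_def t1_def j1_def)
  qed
  have disj: "u1 \<le> t0 \<or> t1 \<le> u0"
  proof (rule ccontr)
    assume "\<not> ?thesis"
    then obtain p where p: "t0 \<le> p" "p < t1" "u0 \<le> p" "p < u1"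
      using lt by (metis linorder_not_le max.cobounded1 max.cobounded2 max_def)
    then have ip: "idx (n + r) p = j1" "idx (n + r') p = j2"
      by (simp_all add: idx_eq_iff t0_def t1_def u0_def u1_def)
    consider "r = r'" | "r < r'" | "r' < r" by linarith
    then show False
    proof cases
      case 1
      then have "j1 = j2" using ip by simp
      then have "idx (n + r) y mod 2 ^ (n + r) = idx (n + r') y' mod 2 ^ (n + r')"
        unfolding J' using 1 j2 by (simp add: j1_def mod_eq_dvd_iff)
      then show False using diff 1 by blast
    next
      case 2
      have "idx (n + r) z = idx (n + r) p"
        by (rule idx_eq_mono[of "n + r" "n + r'"]) (use 2 ip in \<open>auto simp: j2_def\<close>)
      then have "idx (n + r) y' mod 2 ^ n = c" using z_mod[of r] ip ret(1) by (simp add: j1_def)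
      then show False using ret'(2)[of r] \<open>0 < r\<close> 2 by blast
    next
      case 3
      have "idx (n + r') y = idx (n + r') p"
        by (rule idx_eq_mono[of "n + r'" "n + r"]) (use 3 ip in \<open>auto simp: j1_def\<close>)
      then have "idx (n + r') y mod 2 ^ n = c" using z_mod[of r'] ip ret'(1) by (simp add: j2_def)
      then show False using ret(2)[of r'] \<open>0 < r'\<close> 3 by blast
    qed
  qed
  have im_t: "(F ^^ r) t0 = D0 + of_int a" "(F ^^ r) t1 = D1 + of_int a"
    using lo_add_int[of n D a] lo_add_int[of n "D + 1" a]
    by (simp_all add: t0_def t1_def funpow_lo_add D0_def D1_def a algebra_simps)
  have im_s: "(F ^^ r) s0 = u0 + of_int a" "(F ^^ r) s1 = u1 + of_int a"
    using lo_add_int[of "n + r'" j2 a] lo_add_int[of "n + r'" "j2 + 1" a] funpow_lo_add[of r "n + r'" J] funpow_lo_add[of r "n + r'" "J + 1"]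
    by (simp_all add: s0_def s1_def u0_def u1_def j2 algebra_simps)
  have sm: "(\<Sum>i<r. (F ^^ i) t1 - (F ^^ i) t0) \<le> 2"
    unfolding t0_def t1_def using ret by (intro first_entry_sum[of r n y j1]) (auto simp: j1_def)
  have ratio: "((F ^^ r) z - (F ^^ r) w) * (z' - w') \<le> E * ((F ^^ r) z' - (F ^^ r) w') * (z - w)"
    if "t0 \<le> w" "w \<le> z" "z \<le> t1" "t0 \<le> w'" "w' \<le> z'" "z' \<le> t1" for w z w' z'
    using ratio_distortion[OF that sm] by (simp add: E_def)
  have "s1 - s0 \<le> E * (s0 - D0) \<and> s1 - s0 \<le> E * (D1 - s1)"
  proof -
    have "(D1 - D0) * (s1 - s0) \<le> E * (u1 - u0) * (t1 - t0)"
      using ratio[of t0 t1 s0 s1] sT lt by (simp add: im_t im_s)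
    also have "\<dots> \<le> E * (u1 - u0) * (D1 - D0)" using tD lt E1 by (intro mult_left_mono) auto
    finally have su: "s1 - s0 \<le> E * (u1 - u0)" using lt(4) by (simp add: mult.commute)
    from disj show ?thesis
    proof
      assume left: "u1 \<le> t0"
      have "s1 - s0 \<le> E * (s0 - D0)" using su E1 left uD sT
        by (smt (verit) mult_left_mono)
      moreover have "s1 - s0 \<le> E * (D1 - s1)"
      proof -
        have "(u1 - u0) * (s1 - s0) \<le> (D1 - u1) * (s1 - s0)"
          using left tD sizes lt by (intro mult_right_mono) auto
        also have "\<dots> \<le> E * (u1 - u0) * (t1 - s1)"
          using ratio[of s1 t1 s0 s1] sT lt by (simp add: im_t im_s)
        also have "\<dots> \<le> E * (u1 - u0) * (D1 - s1)" using tD lt E1 by (intro mult_left_mono) auto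
        finally have "(u1 - u0) * (s1 - s0) \<le> (u1 - u0) * (E * (D1 - s1))" by (simp add: mult_ac)
        then show ?thesis using lt(2) by simp
      qed
      ultimately show ?thesis ..
    next
      assume right: "t1 \<le> u0"
      have "s1 - s0 \<le> E * (D1 - s1)" using su E1 right uD sT
        by (smt (verit) mult_left_mono)
      moreover have "s1 - s0 \<le> E * (s0 - D0)"
      proof -
        have "(u1 - u0) * (s1 - s0) \<le> (u0 - D0) * (s1 - s0)"
          using right tD sizes lt by (intro mult_right_mono) auto
        also have "\<dots> \<le> E * (u1 - u0) * (s0 - t0)"
          using ratio[of t0 s0 s0 s1] sT lt by (simp add: im_t im_s)
        also have "\<dots> \<le> E * (u1 - u0) * (s0 - D0)" using tD lt E1 by (intro mult_left_mono) auto
        finally have "(u1 - u0) * (s1 - s0) \<le> (u1 - u0) * (E * (s0 - D0))" by (simp add: mult_ac)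
        then show ?thesis using lt(2) by simp
      qed
      ultimately show ?thesis by blast
    qed
  qed
  then show "len (n + r + r') J \<le> exp (4 * K) * (lo (n + r + r') J - lo n D)"
    and "len (n + r + r') J \<le> exp (4 * K) * (lo n (D + 1) - lo (n + r + r') (J + 1))"
    by (simp_all add: len_def s0_def s1_def D0_def D1_def E_def)
qed

end

section \<open>Points with bounded derivatives\<close>

text \<open>
  The assumption leads to a contradiction (\<open>no_bad_point\<close>). The orbit of such a point
  is infinite modulo 1, since it would otherwise end in a repelling cycle along which
  \<open>P\<close> grows.
\<close>

locale bad_point = repelling_lift +
  fixes x :: real
  assumes bad: "\<And>n. P n x \<le> 1"
begin

lemma not_preperiodic: assumes "i < j" shows "(F ^^ j) x \<noteq> (F ^^ i) x + of_int k"
proof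
  assume eq: "(F ^^ j) x = (F ^^ i) x + of_int k"
  define p where "p = (F ^^ i) x"
  define n where "n = j - i"
  have n: "0 < n" "j = n + i" using assms by (auto simp: n_def)
  have pk: "(F ^^ n) p = p + of_int k" using eq by (simp add: p_def n funpow_add)
  define \<mu> where "\<mu> = P n p"
  have \<mu>: "1 < \<mu>" using repelling[OF n(1) pk] by (simp add: \<mu>_def)
  have "P (t * n) p = \<mu> ^ t" for t by (simp add: P_periodic_power[OF pk] \<mu>_def)
  then have "P i x * \<mu> ^ t \<le> 1" for t
    using bad[of "i + t * n"] P_add[of i "t * n" x] by (simp add: p_def)
  then have "\<mu> ^ t \<le> 1 / P i x" for t using P_pos[of i x] by (simp add: field_simps)
  then show False using real_arch_pow[OF \<mu>, of "1 / P i x"] not_less by blast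
qed

text \<open>
  The number \<open>ret n c i\<close> is meaningful when the class \<open>c\<close> is visited
  infinitely often; \<open>vis n c\<close> then enumerates the visits.
\<close>

definition visit :: "nat \<Rightarrow> int \<Rightarrow> nat \<Rightarrow> bool"
  where "visit n c i \<longleftrightarrow> idx (n + i) x mod 2 ^ n = c"

definition ret :: "nat \<Rightarrow> int \<Rightarrow> nat \<Rightarrow> nat"
  where "ret n c i = (LEAST r. 0 < r \<and> visit n c (i + r))"

primrec vis :: "nat \<Rightarrow> int \<Rightarrow> nat \<Rightarrow> nat"
  where "vis n c 0 = (LEAST i. visit n c i)"
  | "vis n c (Suc l) = vis n c l + ret n c (vis n c l)"

lemma ret:
  assumes "infinite {i. visit n c i}"
  shows "0 < ret n c i" "visit n c (i + ret n c i)"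
    and "\<And>s. 0 < s \<Longrightarrow> s < ret n c i \<Longrightarrow> \<not> visit n c (i + s)"
proof -
  obtain j where "i < j" "visit n c j" using assms by (auto simp: infinite_nat_iff_unbounded)
  then have ex: "0 < j - i \<and> visit n c (i + (j - i))" by simp
  show "0 < ret n c i" "visit n c (i + ret n c i)"
    using LeastI[of "\<lambda>r. 0 < r \<and> visit n c (i + r)", OF ex] by (auto simp: ret_def)
  show "\<not> visit n c (i + s)" if "0 < s" "s < ret n c i" for s
    using not_less_Least[of s "\<lambda>r. 0 < r \<and> visit n c (i + r)"] that by (auto simp: ret_def)
qed

lemma ret_least: "0 < s \<Longrightarrow> visit n c (i + s) \<Longrightarrow> ret n c i \<le> s"
  unfolding ret_def by (rule Least_le) simp

lemma visit_vis: assumes "infinite {i. visit n c i}" shows "visit n c (vis n c l)"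
proof (cases l)
  case 0
  obtain i where "visit n c i" using assms not_finite_existsD by blast
  then show ?thesis using 0 by (simp add: LeastI)
next
  case (Suc k) then show ?thesis using ret(2)[OF assms] by simp
qed

lemma strict_mono_vis: assumes "infinite {i. visit n c i}" shows "strict_mono (vis n c)"
  unfolding strict_mono_Suc_iff using ret(1)[OF assms] by simp

text \<open>
  Take the first visit whose return time exceeds a large \<open>R\<close>. Among the points of the
  orbit up to that moment it is the first one with its itinerary up to the return, so both the way
  to it and the way back are first entries, of bounded distortion. Together they map a very short
  cylinder onto the cylinder of \<open>c\<close>, which is impossible with derivative at most 1.
\<close>

lemma ret_bounded:
  assumes inf: "infinite {i. visit n c i}"
  shows "\<exists>R. \<forall>i. visit n c i \<longrightarrow> ret n c i \<le> R"
proof (rule ccontr)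
  assume "\<not> ?thesis"
  then have unb: "\<exists>i. visit n c i \<and> R < ret n c i" for R by (meson not_le)
  define \<epsilon> where "\<epsilon> = exp (- 4 * K) * len n c"
  have "\<epsilon> > 0" using len_pos by (simp add: \<epsilon>_def)
  then obtain R where R: "\<And>k j. R \<le> k \<Longrightarrow> len k j < \<epsilon>" using len_small by blast
  define i where "i = (LEAST i. visit n c i \<and> R < ret n c i)"
  have i: "visit n c i" "R < ret n c i" using LeastI_ex[OF unb] by (auto simp: i_def)
  have imin: "\<not> (visit n c t \<and> R < ret n c t)" if "t < i" for t
    using not_less_Least that unfolding i_def by blast
  define r where "r = ret n c i"
  define N where "N = n + r"
  define J where "J = idx (N + i) x"
  (* An earlier visit to the same class of level n + r would have the same return time. *)
  have fst: "idx (N + t) x mod 2 ^ N \<noteq> idx (N + i) x mod 2 ^ N" if "t < i" for t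
  proof
    assume eq: "idx (N + t) x mod 2 ^ N = idx (N + i) x mod 2 ^ N"
    have same: "visit n c (t + s) \<longleftrightarrow> visit n c (i + s)" if "s \<le> r" for s
    proof -
      have "idx N ((F ^^ t) x) mod 2 ^ N = idx N ((F ^^ i) x) mod 2 ^ N" using eq by (simp add: idx_funpow)
      from idx_word[OF this, of n s] that show ?thesis by (simp add: visit_def N_def idx_funpow ac_simps)
    qed
    have vt: "visit n c t" using same[of 0] i by simp
    have "ret n c t = r"
    proof (rule antisym)
      show "ret n c t \<le> r" using same[of r] ret(1,2)[OF inf, of i] by (intro ret_least) (auto simp: r_def)
      show "r \<le> ret n c t"
      proof (rule ccontr)
        assume l: "\<not> ?thesis"
        then have "visit n c (i + ret n c t)" using same[of "ret n c t"] ret(2)[OF inf, of t] by auto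
        then show False using ret(3)[OF inf, of "ret n c t" i] ret(1)[OF inf, of t] l by (simp add: r_def)
      qed
    qed
    then show False using imin[OF that] vt i by (simp add: r_def)
  qed
  have 1: "len N J \<le> exp (2 * K) * P i x * len (N + i) J"
    by (rule first_entry_P) (use fst in \<open>auto simp: J_def\<close>)
  have 2: "len n J \<le> exp (2 * K) * P r ((F ^^ i) x) * len N J"
    unfolding N_def
  proof (rule first_entry_P)
    show "J = idx (n + r) ((F ^^ i) x)" by (simp add: J_def N_def idx_funpow)
    show "idx (n + s) ((F ^^ i) x) mod 2 ^ n \<noteq> idx (n + r) ((F ^^ i) x) mod 2 ^ n" if "0 < s" "s < r" for s
      using ret(2)[OF inf, of i] ret(3)[OF inf, of s i] that
      by (simp add: visit_def idx_funpow r_def ac_simps)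
  qed
  have "J mod 2 ^ n = c" using ret(2)[OF inf, of i] by (simp add: visit_def J_def N_def r_def ac_simps)
  then have c: "len n J = len n c" using len_mod by metis
  have "len n c \<le> exp (2 * K) * P r ((F ^^ i) x) * (exp (2 * K) * P i x * len (N + i) J)"
    using 2 mult_left_mono[OF 1, of "exp (2 * K) * P r ((F ^^ i) x)"] P_pos[of r "(F ^^ i) x"] unfolding c
    by (meson exp_ge_zero less_imp_le mult_nonneg_nonneg order_trans)
  also have "\<dots> = exp (4 * K) * P (i + r) x * len (N + i) J" by (simp add: P_add algebra_simps flip: exp_add)
  also have "\<dots> \<le> exp (4 * K) * 1 * len (N + i) J"
    using bad[of "i + r"] len_pos[of "N + i" J] by (intro mult_right_mono mult_left_mono) auto
  also have "\<dots> < exp (4 * K) * 1 * \<epsilon>" using R[of "N + i" J] i by (simp add: N_def r_def)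
  also have "\<dots> = len n c" by (simp add: \<epsilon>_def flip: exp_add mult.assoc)
  finally show False by simp
qed

text \<open>
  The branch of the first return map that contains the point of the orbit at time
  \<open>i\<close>, described by its return time and its cylinder modulo 1.
\<close>

definition tile :: "nat \<Rightarrow> int \<Rightarrow> nat \<Rightarrow> nat \<times> int"
  where "tile n c i = (ret n c i, idx (n + ret n c i + i) x mod 2 ^ (n + ret n c i))"

definition tile_len :: "nat \<Rightarrow> int \<Rightarrow> nat \<Rightarrow> real"
  where "tile_len n c i = len (n + ret n c i) (idx (n + ret n c i + i) x)"

lemma tile_len_eq: "tile_len n c i = len (n + fst (tile n c i)) (snd (tile n c i))"
  by (simp add: tile_len_def tile_def len_mod)

lemma finite_tiles:
  assumes inf: "infinite {i. visit n c i}"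
  shows "finite (tile n c ` {i. visit n c i})"
proof -
  obtain R where R: "\<And>i. visit n c i \<Longrightarrow> ret n c i \<le> R" using ret_bounded[OF inf] by blast
  have "tile n c ` {i. visit n c i} \<subseteq> {..R} \<times> {0..2 ^ (n + R)}"
  proof
    fix p assume "p \<in> tile n c ` {i. visit n c i}"
    then obtain i where i: "p = tile n c i" "visit n c i" by blast
    have "idx (n + ret n c i + i) x mod 2 ^ (n + ret n c i) < 2 ^ (n + ret n c i)" by simp
    also have "\<dots> \<le> (2::int) ^ (n + R)" using R[OF i(2)] by (intro power_increasing) auto
    finally show "p \<in> {..R} \<times> {0..2 ^ (n + R)}" using R[OF i(2)] by (auto simp: i tile_def)
  qed
  then show ?thesis by (rule finite_subset) auto
qed

text \<open>
  With a constant tile, the orbit of \<open>y\<close> and of its first return \<open>z\<close>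
  have the same digits for ever, so \<open>z\<close> and \<open>y\<close> are near each other up
  to an integer, hence equal up to an integer, and \<open>x\<close> is preperiodic.
\<close>

lemma tiles_not_eventually_constant:
  assumes inf: "infinite {i. visit n c i}"
    and const: "\<And>l. l0 \<le> l \<Longrightarrow> tile n c (vis n c (Suc l)) = tile n c (vis n c l)"
  shows False
proof -
  define t where "t = vis n c l0"
  define r where "r = ret n c t"
  define N where "N = n + r"
  have tl: "tile n c (vis n c (l0 + k)) = tile n c t" for k
  proof (induction k)
    case (Suc k) then show ?case using const[of "l0 + k"] by (simp del: vis.simps)
  qed (simp add: t_def)
  then have rk: "ret n c (vis n c (l0 + k)) = r" for k unfolding tile_def r_def by (metis fst_conv)
  have vk: "vis n c (l0 + k) = t + k * r" for k
  proof (induction k)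
    case (Suc k) then show ?case using rk[of k] by simp
  qed (simp add: t_def)
  have ik: "idx (N + (t + k * r)) x mod 2 ^ N = idx (N + t) x mod 2 ^ N" for k
  proof -
    have "snd (tile n c (t + k * r)) = idx (n + r + (t + k * r)) x mod 2 ^ (n + r)"
      using rk[of k] by (simp only: tile_def snd_conv vk)
    moreover have "snd (tile n c t) = idx (n + r + t) x mod 2 ^ (n + r)"
      by (simp only: tile_def snd_conv r_def)
    ultimately show ?thesis using tl[of k] unfolding vk N_def by simp
  qed
  define y where "y = (F ^^ t) x"
  define z where "z = (F ^^ r) y"
  have iy: "idx M y = idx (M + t) x" and iz: "idx M z = idx (M + r + t) x" for M
    by (simp_all add: y_def z_def idx_funpow)
  have "idx N z mod 2 ^ N = idx N y mod 2 ^ N"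
    using ik[of 1] by (simp add: iy iz ac_simps)
  then obtain a where a: "idx N z = idx N y + 2 ^ N * a"
    by (metis (no_types, lifting) diff_add_cancel dvdE mod_eq_dvd_iff add.commute)
  define w where "w = z + of_int (- a)"
  have eq: "idx (N + k * r) w = idx (N + k * r) y" for k
  proof (induction k)
    case 0 then show ?case unfolding w_def idx_add_int using a by simp
  next
    case (Suc k)
    define A B where "A = idx (N + Suc k * r) w" and "B = idx (N + Suc k * r) y"
    have e: "N + Suc k * r = N + k * r + r" by simp
    have div: "A div 2 ^ r = B div 2 ^ r"
      using Suc unfolding A_def B_def e idx_div .
    have "B mod 2 ^ N = idx (N + t) x mod 2 ^ N"
      using ik[of "Suc k"] unfolding B_def iy by (simp add: ac_simps)
    moreover have "idx (N + Suc k * r) z mod 2 ^ N = idx (N + t) x mod 2 ^ N"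
      using ik[of "Suc (Suc k)"] unfolding iz by (simp add: ac_simps)
    moreover have "A mod 2 ^ N = idx (N + Suc k * r) z mod 2 ^ N"
      unfolding A_def w_def idx_add_int by (simp add: power_add mod_eq_dvd_iff mult.assoc)
    ultimately have "A mod 2 ^ N = B mod 2 ^ N" by simp
    moreover have d: "(2::int) ^ r dvd 2 ^ N" by (rule le_imp_power_dvd) (simp add: N_def)
    ultimately have "A mod 2 ^ r = B mod 2 ^ r" using mod_mod_cancel[OF d] by metis
    then show ?case using div unfolding A_def[symmetric] B_def[symmetric] by (metis div_mult_mod_eq)
  qed
  have rpos: "0 < r" unfolding r_def by (rule ret(1)[OF inf])
  have "near w y"
  proof (rule near_if_le_2)
    fix k
    have close: "\<bar>(F ^^ (N + k * r)) w - (F ^^ (N + k * r)) y\<bar> < 1"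
      using eq[of k] unfolding idx_def by linarith
    have "k \<le> N + k * r" using rpos by (simp add: trans_le_add2)
    then have "\<not> 1 < (F ^^ k) w - (F ^^ k) y" "\<not> 1 < (F ^^ k) y - (F ^^ k) w"
      using close gap_grows[of k y w "N + k * r"] gap_grows[of k w y "N + k * r"] by linarith+
    then show "\<bar>(F ^^ k) w - (F ^^ k) y\<bar> \<le> 2" by linarith
  qed
  then have "w = y" by (rule no_homterval)
  then have "(F ^^ r) ((F ^^ t) x) = (F ^^ t) x + of_int a" by (simp add: w_def z_def y_def)
  then have "(F ^^ (r + t)) x = (F ^^ t) x + of_int a" by (simp add: funpow_add)
  then show False using not_preperiodic[of t "r + t" a] rpos by simp
qed

text \<open>
  There are only finitely many tiles. If from some time on every change of the tile increased its
  length, then the length would become constant, and with it the tile.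
\<close>

lemma descending_changes:
  assumes inf: "infinite {i. visit n c i}"
  shows "infinite {l. tile n c (vis n c (Suc l)) \<noteq> tile n c (vis n c l) \<and>
      tile_len n c (vis n c (Suc l)) \<le> tile_len n c (vis n c l)}" (is "infinite ?G")
proof
  assume "finite ?G"
  then obtain l0 where l0: "\<And>l. l \<in> ?G \<Longrightarrow> l < l0" using finite_nat_set_iff_bounded by meson
  define s where "s l = tile_len n c (vis n c l)" for l
  have step: "tile n c (vis n c (Suc l)) = tile n c (vis n c l) \<or> s l < s (Suc l)" if "l0 \<le> l" for l
  proof (rule ccontr)
    assume "\<not> ?thesis"
    then have "l \<in> ?G" by (auto simp: s_def simp del: vis.simps)
    then show False using l0[of l] that by simp
  qed
  then have mono: "s l \<le> s (Suc l)" if "l0 \<le> l" for l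
    using step[OF that] by (auto simp: s_def tile_len_eq simp del: vis.simps)
  have fin: "finite (s ` {l0..})"
  proof (rule finite_subset)
    show "s ` {l0..} \<subseteq> (\<lambda>p. len (n + fst p) (snd p)) ` (tile n c ` {i. visit n c i})"
      using visit_vis[OF inf] by (auto simp: s_def tile_len_eq)
  qed (use finite_tiles[OF inf] in blast)
  have "Max (s ` {l0..}) \<in> s ` {l0..}" using fin by (intro Max_in) auto
  then obtain l1 where l1: "l0 \<le> l1" "s l1 = Max (s ` {l0..})" by auto
  have le: "s l \<le> s l1" if "l0 \<le> l" for l using fin that unfolding l1(2) by (intro Max_ge) auto
  have const: "s (l1 + k) = s l1" for k
  proof (induction k)
    case (Suc k)
    then show ?case using mono[of "l1 + k"] le[of "l1 + Suc k"] l1 by simp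
  qed simp
  show False
  proof (rule tiles_not_eventually_constant[OF inf])
    fix l assume "l1 \<le> l"
    then have "s l = s (Suc l)" using const[of "l - l1"] const[of "Suc l - l1"] by (simp add: Suc_diff_le)
    then show "tile n c (vis n c (Suc l)) = tile n c (vis n c l)"
      using step[of l] \<open>l1 \<le> l\<close> l1 by (auto simp del: vis.simps)
  qed
qed

text \<open>
  By the pigeonhole principle, one pair of consecutive, different tiles of nonincreasing length
  recurs infinitely often. The class \<open>c'\<close> of level
  \<open>n' = n + r + r'\<close> describes the points that pass through this pair, and the
  collars are those of the lemma \<open>collar\<close>. A return to \<open>c'\<close> before the
  time \<open>r + r'\<close> could only happen at time \<open>r\<close>, when the orbit is in
  the second tile of the pair, which differs from the first.
\<close>

lemma collared_class:
  obtains n' c' where "n \<le> n'" and "infinite {i. visit n' c' i}"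
    and "\<And>i. visit n' c' i \<Longrightarrow> n' \<le> n + ret n' c' i"
    and "\<And>i. visit n' c' i \<Longrightarrow> len n' (idx (n' + i) x) \<le> exp (4 * K) * (lo n' (idx (n' + i) x) - lo n (idx (n + i) x))"
    and "\<And>i. visit n' c' i \<Longrightarrow> len n' (idx (n' + i) x) \<le> exp (4 * K) * (lo n (idx (n + i) x + 1) - lo n' (idx (n' + i) x + 1))"
proof -
  have "\<exists>c. infinite {i. visit n c i}"
  proof (rule ccontr)
    assume "\<not> ?thesis"
    then have "finite (\<Union>c\<in>{0..2 ^ n}. {i. visit n c i})" by auto
    moreover have "(\<Union>c\<in>{0..2 ^ n}. {i. visit n c i}) = UNIV"
      by (auto simp: visit_def less_imp_le)
    ultimately show False by simp
  qed
  then obtain c where inf: "infinite {i. visit n c i}" by blast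
  define G where "G = {l. tile n c (vis n c (Suc l)) \<noteq> tile n c (vis n c l) \<and>
      tile_len n c (vis n c (Suc l)) \<le> tile_len n c (vis n c l)}"
  have Ginf: "infinite G" using descending_changes[OF inf] by (simp add: G_def)
  define nn where "nn l = n + ret n c (vis n c l) + ret n c (vis n c (Suc l))" for l
  define info where "info l = (tile n c (vis n c l), tile n c (vis n c (Suc l)), idx (nn l + vis n c l) x mod 2 ^ nn l)" for l
  have "finite (info ` G)"
  proof -
    obtain R where R: "\<And>i. visit n c i \<Longrightarrow> ret n c i \<le> R" using ret_bounded[OF inf] by blast
    let ?T = "tile n c ` {i. visit n c i}"
    have "info ` G \<subseteq> ?T \<times> ?T \<times> {0..2 ^ (n + R + R)}"
    proof
      fix p assume "p \<in> info ` G"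
      then obtain l where l: "p = info l" by blast
      have "nn l \<le> n + R + R" using R[OF visit_vis[OF inf]] by (simp add: nn_def add_mono del: vis.simps)
      have "idx (nn l + vis n c l) x mod 2 ^ nn l < 2 ^ nn l" by simp
      also have "\<dots> \<le> (2::int) ^ (n + R + R)" using \<open>nn l \<le> n + R + R\<close> by (intro power_increasing) auto
      finally show "p \<in> ?T \<times> ?T \<times> {0..2 ^ (n + R + R)}"
        using visit_vis[OF inf] by (auto simp: l info_def simp del: vis.simps)
    qed
    then show ?thesis by (rule finite_subset) (intro finite_cartesian_product finite_tiles inf finite_atLeastAtMost_int)
  qed
  then obtain l where l: "l \<in> G" "infinite {k \<in> G. info k = info l}"
    using pigeonhole_infinite[OF Ginf] by blast
  define t where "t = vis n c l"
  define r where "r = ret n c t"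
  define r' where "r' = ret n c (t + r)"
  define n' where "n' = n + r + r'"
  define c' where "c' = idx (n' + t) x mod 2 ^ n'"
  have n'l: "n' = nn l" by (simp add: n'_def nn_def r'_def r_def t_def)
  have rpos: "0 < r" "0 < r'" using ret(1)[OF inf] by (auto simp: r_def r'_def)
  have vis_t: "visit n c t" using visit_vis[OF inf] by (simp add: t_def)
  have "vis n c ` {k \<in> G. info k = info l} \<subseteq> {i. visit n' c' i}"
  proof
    fix i assume "i \<in> vis n c ` {k \<in> G. info k = info l}"
    then obtain k where k: "i = vis n c k" "info k = info l" by blast
    have "fst (tile n c (vis n c k)) = fst (tile n c (vis n c l))"
      "fst (tile n c (vis n c (Suc k))) = fst (tile n c (vis n c (Suc l)))"
      using k(2) unfolding info_def by (simp_all del: vis.simps)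
    then have "nn k = nn l" unfolding nn_def by (simp add: tile_def del: vis.simps)
    then have "idx (nn l + vis n c k) x mod 2 ^ nn l = idx (nn l + vis n c l) x mod 2 ^ nn l"
      using k(2) unfolding info_def by simp
    then show "i \<in> {i. visit n' c' i}" by (simp add: visit_def k n'l c'_def t_def)
  qed
  moreover have "infinite (vis n c ` {k \<in> G. info k = info l})"
    using l(2) strict_mono_vis[OF inf] by (subst finite_image_iff) (auto intro: inj_on_subset strict_mono_imp_inj_on)
  ultimately have inf': "infinite {i. visit n' c' i}" using finite_subset by blast
  have word: "idx (k + s + i) x mod 2 ^ k = idx (k + s + t) x mod 2 ^ k" if "visit n' c' i" "k + s \<le> n'" for i k s
  proof -
    have "idx n' ((F ^^ i) x) mod 2 ^ n' = idx n' ((F ^^ t) x) mod 2 ^ n'"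
      using that(1) by (simp add: visit_def c'_def idx_funpow)
    from idx_word[OF this that(2)] show ?thesis by (simp add: idx_funpow)
  qed
  have same: "visit n c (i + s) \<longleftrightarrow> visit n c (t + s)" if "visit n' c' i" "s \<le> r + r'" for i s
    using word[OF that(1), of n s] that(2) by (simp add: visit_def n'_def ac_simps)
  have visit': "visit n c i" if "visit n' c' i" for i using same[OF that, of 0] vis_t by simp
  have ret_i: "ret n c i = r" if v: "visit n' c' i" for i
  proof (rule antisym)
    show "ret n c i \<le> r"
      using same[OF v, of r] ret(1,2)[OF inf, of t] by (intro ret_least) (auto simp: r_def)
    show "r \<le> ret n c i"
    proof (rule ccontr)
      assume l: "\<not> ?thesis"
      then have "visit n c (t + ret n c i)" using same[OF v, of "ret n c i"] ret(2)[OF inf, of i] by auto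
      then show False using ret(3)[OF inf, of "ret n c i" t] ret(1)[OF inf, of i] l by (simp add: r_def)
    qed
  qed
  have ret_i': "ret n c (i + r) = r'" if v: "visit n' c' i" for i
  proof (rule antisym)
    show "ret n c (i + r) \<le> r'"
      using same[OF v, of "r + r'"] ret(1,2)[OF inf, of "t + r"] by (intro ret_least) (auto simp: r'_def ac_simps)
    show "r' \<le> ret n c (i + r)"
    proof (rule ccontr)
      assume l: "\<not> ?thesis"
      then have "visit n c (t + r + ret n c (i + r))"
        using same[OF v, of "r + ret n c (i + r)"] ret(2)[OF inf, of "i + r"] by (auto simp: ac_simps)
      then show False using ret(3)[OF inf, of "ret n c (i + r)" "t + r"] ret(1)[OF inf, of "i + r"] l by (simp add: r'_def)
    qed
  qed
  have tile_i: "tile n c i = tile n c t" if v: "visit n' c' i" for i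
    using word[OF v, of "n + r" 0] by (simp add: tile_def ret_i[OF v] r_def[symmetric] n'_def)
  have tile_i': "tile n c (i + r) = tile n c (t + r)" if v: "visit n' c' i" for i
    using word[OF v, of "n + r'" r] unfolding tile_def ret_i'[OF v] r'_def[symmetric] n'_def
    by (simp add: ac_simps)
  have tt: "tile n c (t + r) \<noteq> tile n c t" "tile_len n c (t + r) \<le> tile_len n c t"
    using l(1) by (auto simp: G_def t_def r_def)
  show ?thesis
  proof
    show "n \<le> n'" by (simp add: n'_def)
    show "infinite {i. visit n' c' i}" by (rule inf')
    fix i assume v: "visit n' c' i"
    show "n' \<le> n + ret n' c' i"
    proof (rule ccontr)
      assume "\<not> ?thesis"
      then have lt: "ret n' c' i < r + r'" by (simp add: n'_def)
      define s where "s = ret n' c' i"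
      have s: "0 < s" "visit n' c' (i + s)" using ret(1,2)[OF inf', of i] by (auto simp: s_def)
      have vs: "visit n c (i + s)" using visit'[OF s(2)] .
      have "r \<le> s" using ret_least[OF s(1) vs] ret_i[OF v] by simp
      moreover have "\<not> r < s"
      proof
        assume "r < s"
        then have "visit n c (i + r + (s - r))" using vs by simp
        then have "ret n c (i + r) \<le> s - r" using \<open>r < s\<close> by (intro ret_least) auto
        then show False using ret_i'[OF v] lt \<open>r < s\<close> by (simp add: s_def)
      qed
      ultimately have "s = r" by simp
      then show False using tile_i[OF s(2)] tile_i'[OF v] tt(1) by simp
    qed
    define y where "y = (F ^^ i) x"
    have J: "idx (n' + i) x = idx (n + r + r') y" and D: "idx (n + i) x = idx n y"
      by (simp_all add: y_def n'_def idx_funpow)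
    have vy: "idx (n + s) y mod 2 ^ n = c \<longleftrightarrow> visit n c (i + s)"
      "idx (n + s) ((F ^^ r) y) mod 2 ^ n = c \<longleftrightarrow> visit n c (i + r + s)" for s
      by (simp_all add: y_def visit_def idx_funpow ac_simps)
    have ry: "visit n c (i + r)" "visit n c (i + r + r')"
      using ret(2)[OF inf, of i] ret(2)[OF inf, of "i + r"] by (simp_all add: ret_i[OF v] ret_i'[OF v])
    have nr: "\<not> visit n c (i + s)" if "0 < s" "s < r" for s using ret(3)[OF inf, of s i] that by (simp add: ret_i[OF v])
    have nr': "\<not> visit n c (i + r + s)" if "0 < s" "s < r'" for s using ret(3)[OF inf, of s "i + r"] that by (simp add: ret_i'[OF v])
    have c0: "idx n y mod 2 ^ n = c" using vy(1)[of 0] visit'[OF v] by simp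
    have ti: "idx (n + r) y mod 2 ^ (n + r) = snd (tile n c t)" "idx (n + r') ((F ^^ r) y) mod 2 ^ (n + r') = snd (tile n c (t + r))"
    proof -
      have "snd (tile n c i) = idx (n + r + i) x mod 2 ^ (n + r)"
        "snd (tile n c (i + r)) = idx (n + r' + (i + r)) x mod 2 ^ (n + r')"
        by (simp_all only: tile_def ret_i[OF v] ret_i'[OF v] snd_conv)
      then show "idx (n + r) y mod 2 ^ (n + r) = snd (tile n c t)"
        "idx (n + r') ((F ^^ r) y) mod 2 ^ (n + r') = snd (tile n c (t + r))"
        unfolding tile_i[OF v] tile_i'[OF v] by (simp_all add: y_def idx_funpow ac_simps)
    qed
    have df: "\<not> (r = r' \<and> idx (n + r) y mod 2 ^ (n + r) = idx (n + r') ((F ^^ r) y) mod 2 ^ (n + r'))"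
    proof
      assume "r = r' \<and> idx (n + r) y mod 2 ^ (n + r) = idx (n + r') ((F ^^ r) y) mod 2 ^ (n + r')"
      then have "r = r'" "snd (tile n c t) = snd (tile n c (t + r))" using ti by simp_all
      moreover have "fst (tile n c t) = r" "fst (tile n c (t + r)) = r'"
        by (simp_all only: tile_def fst_conv r_def[symmetric] r'_def[symmetric])
      ultimately show False using tt(1) by (simp add: prod_eq_iff)
    qed
    have sz: "len (n + r') (idx (n + r') ((F ^^ r) y)) \<le> len (n + r) (idx (n + r) y)"
    proof -
      have "tile_len n c (i + r) \<le> tile_len n c i" using tt(2) unfolding tile_len_eq tile_i[OF v] tile_i'[OF v] .
      then show ?thesis unfolding tile_len_def ret_i[OF v] ret_i'[OF v]
        by (simp add: y_def idx_funpow ac_simps)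
    qed
    note collar = collar[of n r y c r' "(F ^^ r) y", OF _ _ c0 rpos _ _ refl df sz refl refl]
    show "len n' (idx (n' + i) x) \<le> exp (4 * K) * (lo n' (idx (n' + i) x) - lo n (idx (n + i) x))"
      unfolding J D unfolding n'_def by (rule collar(1)) (use ry nr nr' vy in auto)
    show "len n' (idx (n' + i) x) \<le> exp (4 * K) * (lo n (idx (n + i) x + 1) - lo n' (idx (n' + i) x + 1))"
      unfolding J D unfolding n'_def by (rule collar(2)) (use ry nr nr' vy in auto)
  qed
qed

text \<open>
  Let \<open>H i\<close> be the density at the \<open>i\<close>-th point of the orbit of the
  Hilbert metric of its cylinder \<open>S\<close> of level \<open>n'\<close>. The return branch
  \<open>{l..h}\<close> is mapped onto a translate of \<open>S\<close>; its enlargement on both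
  sides by \<open>\<eta>\<close> times its length is still mapped into a cylinder of level
  \<open>n\<close>, thanks to the collars, and therefore lies in \<open>S\<close> since returns
  take at least the time \<open>n' - n\<close>. So the density of \<open>{l..h}\<close> exceeds
  \<open>H i\<close> by the factor \<open>1 + 2 * \<eta>\<close>, while the iteration loses
  at most the factor \<open>1 - \<eta> / 4\<close>. Thus \<open>P * H\<close> grows
  geometrically along the returns, although \<open>P \<le> 1\<close> and \<open>H\<close> is
  bounded.
\<close>

lemma no_bad_point: False
proof -
  define E where "E = exp (4 * K)"
  (* The Schwartz extension stretches the enlargement by at most exp (8 * K), the collars have
     relative size exp (- 4 * K), and the factor 1/2 keeps the images strictly inside. *)
  define \<eta> where "\<eta> = exp (- 12 * K) / 2"
  have \<eta>: "0 < \<eta>" "\<eta> \<le> 1 / 2" using K_nonneg by (auto simp: \<eta>_def)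
  (* Small enough that the errors of hilbert_density_step add up to at most \<eta> / 4 along a
     return. *)
  define \<epsilon> where "\<epsilon> = \<eta> / (8 * (C0 + 1))"
  have "0 < \<epsilon>" using \<eta> C0_nonneg by (simp add: \<epsilon>_def)
  then obtain n where n: "\<And>k j. n \<le> k \<Longrightarrow> len k j < \<epsilon>" using len_small by blast
  obtain n' c where nn': "n \<le> n'" and inf: "infinite {i. visit n' c i}"
    and rt: "\<And>i. visit n' c i \<Longrightarrow> n' \<le> n + ret n' c i"
    and left: "\<And>i. visit n' c i \<Longrightarrow> len n' (idx (n' + i) x) \<le> E * (lo n' (idx (n' + i) x) - lo n (idx (n + i) x))"
    and right: "\<And>i. visit n' c i \<Longrightarrow> len n' (idx (n' + i) x) \<le> E * (lo n (idx (n + i) x + 1) - lo n' (idx (n' + i) x + 1))"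
    unfolding E_def by (rule collared_class[of n]) blast
  obtain R where R: "\<And>i. visit n' c i \<Longrightarrow> ret n' c i \<le> R" using ret_bounded[OF inf] by blast
  define H where "H i = hilbert_density (lo n' (idx (n' + i) x)) (lo n' (idx (n' + i) x + 1)) ((F ^^ i) x)" for i
  define B where "B = 2 * (2 * exp K) ^ (n' + R) / \<eta>"
  (* An end of a cylinder is mapped to an integer translate of the fixed point q, so x, not being
     preperiodic, never meets one. *)
  have interior: "lo k (idx (k + i) x) < (F ^^ i) x \<and> (F ^^ i) x < lo k (idx (k + i) x + 1)" for k i
  proof -
    have "lo k (idx (k + i) x) \<le> (F ^^ i) x \<and> (F ^^ i) x < lo k (idx (k + i) x + 1)"
      using idx_eq_iff[of k "(F ^^ i) x" "idx (k + i) x"] by (simp add: idx_funpow)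
    moreover have "lo k (idx (k + i) x) \<noteq> (F ^^ i) x"
    proof
      assume "lo k (idx (k + i) x) = (F ^^ i) x"
      then have e: "(F ^^ (k + i)) x = q + of_int (idx (k + i) x)" using funpow_lo by (metis comp_apply funpow_add)
      have "(F ^^ Suc (k + i)) x = q + of_int (2 * idx (k + i) x)"
        using funpow_q[of 1 "idx (k + i) x"] e by simp
      then show False using not_preperiodic[of "k + i" "Suc (k + i)" "idx (k + i) x"] e by simp
    qed
    ultimately show ?thesis by linarith
  qed
  have Hpos: "0 < H i" for i unfolding H_def using interior by (intro hilbert_density_pos) blast+
  have step: "(1 + \<eta>) * H i \<le> P (ret n' c i) ((F ^^ i) x) * H (i + ret n' c i) \<and> H i \<le> B"
    if v: "visit n' c i" for i
  proof -
    define \<rho> where "\<rho> = ret n' c i"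
    define y where "y = (F ^^ i) x"
    define J where "J = idx (n' + i) x"
    define J1 where "J1 = idx (n' + \<rho> + i) x"
    define l h where "l = lo (n' + \<rho>) J1" and "h = lo (n' + \<rho>) (J1 + 1)"
    define e where "e = \<eta> * (h - l)"
    have v': "visit n' c (i + \<rho>)" unfolding \<rho>_def by (rule ret(2)[OF inf])
    have ly: "l < y" "y < h" using interior[of "n' + \<rho>" i] by (auto simp: l_def h_def J1_def y_def)
    have lh: "l < h" using ly by simp
    have e0: "0 < e" using \<eta> lh by (simp add: e_def)
    have fst: "idx (n' + s) y mod 2 ^ n' \<noteq> idx (n' + \<rho>) y mod 2 ^ n'" if "0 < s" "s < \<rho>" for s
      using ret(3)[OF inf, of s i] that v' by (simp add: visit_def \<rho>_def y_def idx_funpow ac_simps)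
    have J1y: "J1 = idx (n' + \<rho>) y" by (simp add: J1_def y_def idx_funpow)
    have sums: "(\<Sum>s<t. (F ^^ s) h - (F ^^ s) l) \<le> 2" if "t \<le> \<rho>" for t
      unfolding l_def h_def by (rule first_entry_sum[OF fst J1y that])
    have ex: "exp (8 * K) * \<eta> = exp (- 4 * K) / 2" by (simp add: \<eta>_def flip: exp_add)
    have small: "2 * e * exp (8 * K) \<le> h - l"
    proof -
      have "2 * e * exp (8 * K) = 2 * (exp (8 * K) * \<eta>) * (h - l)" by (simp add: e_def)
      also have "\<dots> = exp (- 4 * K) * (h - l)" unfolding ex by simp
      also have "\<dots> \<le> h - l" using K_nonneg lh by (intro mult_left_le_one_le) auto
      finally show ?thesis .
    qed
    have im: "(F ^^ \<rho>) l = lo n' J1" "(F ^^ \<rho>) h = lo n' (J1 + 1)" by (simp_all add: l_def h_def funpow_lo_add)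
    define D where "D = idx (n + (i + \<rho>)) x"
    have J1': "idx (n' + (i + \<rho>)) x = J1" by (simp add: J1_def ac_simps)
    have cl: "len n' J1 \<le> E * (lo n' J1 - lo n D)" and cr: "len n' J1 \<le> E * (lo n (D + 1) - lo n' (J1 + 1))"
      using left[OF v'] right[OF v'] unfolding J1' D_def by auto
    have Ee: "e * exp (8 * K) = (h - l) * (exp (- 4 * K) / 2)" using ex by (simp add: e_def mult_ac)
    have half: "exp (- 4 * K) / 2 * len n' J1 < a" if "len n' J1 \<le> E * a" for a
    proof -
      have "exp (- 4 * K) * len n' J1 \<le> exp (- 4 * K) * (E * a)" using that by (intro mult_left_mono) auto
      then have "exp (- 4 * K) * len n' J1 \<le> a" by (simp add: E_def flip: exp_add mult.assoc)
      moreover have "0 < exp (- 4 * K) * len n' J1" using len_pos by simp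
      ultimately show ?thesis by linarith
    qed
    have up: "(F ^^ \<rho>) (h + e) < lo n (D + 1)"
    proof -
      have "((F ^^ \<rho>) (h + e) - (F ^^ \<rho>) h) * (h - l) \<le> e * exp (8 * K) * ((F ^^ \<rho>) h - (F ^^ \<rho>) l)"
        using Schwartz_extension(1)[OF lh less_imp_le[OF e0] small sums order_refl] .
      then have "((F ^^ \<rho>) (h + e) - lo n' (J1 + 1)) * (h - l) \<le> (exp (- 4 * K) / 2 * len n' J1) * (h - l)"
        unfolding im Ee len_def by (simp add: mult_ac)
      then have "(F ^^ \<rho>) (h + e) - lo n' (J1 + 1) \<le> exp (- 4 * K) / 2 * len n' J1" using lh by simp
      then show ?thesis using half[OF cr] by linarith
    qed
    have down: "lo n D < (F ^^ \<rho>) (l - e)"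
    proof -
      have "((F ^^ \<rho>) l - (F ^^ \<rho>) (l - e)) * (h - l) \<le> e * exp (8 * K) * ((F ^^ \<rho>) h - (F ^^ \<rho>) l)"
        using Schwartz_extension(2)[OF lh less_imp_le[OF e0] small sums order_refl] .
      then have "(lo n' J1 - (F ^^ \<rho>) (l - e)) * (h - l) \<le> (exp (- 4 * K) / 2 * len n' J1) * (h - l)"
        unfolding im Ee len_def by (simp add: mult_ac)
      then have "lo n' J1 - (F ^^ \<rho>) (l - e) \<le> exp (- 4 * K) / 2 * len n' J1" using lh by simp
      then show ?thesis using half[OF cl] by linarith
    qed
    have inS: "idx n' z = J" if "l - e \<le> z" "z \<le> h + e" for z
    proof -
      have "lo n D \<le> (F ^^ \<rho>) z" "(F ^^ \<rho>) z < lo n (D + 1)"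
        using up down that funpow_le_iff[of \<rho> "l - e" z] funpow_le_iff[of \<rho> z "h + e"] by linarith+
      then have "idx (n + \<rho>) z = D" using idx_eq_iff[of n "(F ^^ \<rho>) z" D] by (simp add: idx_funpow)
      moreover have "idx (n + \<rho>) y = D" by (simp add: D_def y_def idx_funpow ac_simps)
      ultimately have "idx n' z = idx n' y" using idx_eq_mono[of n' "n + \<rho>" z y] rt[OF v] by (simp add: \<rho>_def)
      then show ?thesis by (simp add: J_def y_def idx_funpow)
    qed
    have lS: "lo n' J \<le> l - e" and hS: "h + e \<le> lo n' (J + 1)"
      using inS[of "l - e"] inS[of "h + e"] lh e0 by (auto simp: idx_eq_iff)
    have "(1 + 2 * \<eta>) * H i \<le> hilbert_density l h y"
      unfolding H_def J_def[symmetric] y_def[symmetric]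
      by (rule hilbert_density_enlarge) (use ly \<eta> lS hS in \<open>auto simp: e_def\<close>)
    moreover have "(1 - \<eta> / 4) * hilbert_density l h y \<le> P \<rho> y * H (i + \<rho>)"
    proof -
      have ls: "(F ^^ s) h - (F ^^ s) l = len (n' + \<rho> - s) J1" if "s < \<rho>" for s
        using funpow_lo_add[of s "n' + \<rho> - s"] that by (simp add: l_def h_def len_def)
      have "(\<Sum>s<\<rho>. C0 * ((F ^^ s) h - (F ^^ s) l)\<^sup>2) \<le> (\<Sum>s<\<rho>. C0 * \<epsilon> * ((F ^^ s) h - (F ^^ s) l))"
      proof (rule sum_mono)
        fix s assume "s \<in> {..<\<rho>}"
        then have "s < \<rho>" "n \<le> n' + \<rho> - s" using nn' by auto
        then have "0 \<le> (F ^^ s) h - (F ^^ s) l" "(F ^^ s) h - (F ^^ s) l \<le> \<epsilon>"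
          using ls[of s] len_pos[of "n' + \<rho> - s" J1] n[of "n' + \<rho> - s" J1] nn' by auto
        then have "((F ^^ s) h - (F ^^ s) l)\<^sup>2 \<le> \<epsilon> * ((F ^^ s) h - (F ^^ s) l)"
          unfolding power2_eq_square by (intro mult_right_mono)
        then show "C0 * ((F ^^ s) h - (F ^^ s) l)\<^sup>2 \<le> C0 * \<epsilon> * ((F ^^ s) h - (F ^^ s) l)"
          using C0_nonneg by (simp add: mult_left_mono mult.assoc)
      qed
      also have "\<dots> = C0 * \<epsilon> * (\<Sum>s<\<rho>. (F ^^ s) h - (F ^^ s) l)" by (simp add: sum_distrib_left)
      also have "\<dots> \<le> C0 * \<epsilon> * 2" using sums[of \<rho>] C0_nonneg \<open>0 < \<epsilon>\<close> by (intro mult_left_mono) auto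
      also have "\<dots> \<le> (C0 + 1) * \<epsilon> * 2" using \<open>0 < \<epsilon>\<close> by simp
      also have "\<dots> = \<eta> / 4" using C0_nonneg by (simp add: \<epsilon>_def field_simps)
      finally have S: "(\<Sum>s<\<rho>. C0 * ((F ^^ s) h - (F ^^ s) l)\<^sup>2) \<le> \<eta> / 4" .
      have "(1 - \<eta> / 4) * hilbert_density l h y \<le> (1 - (\<Sum>s<\<rho>. C0 * ((F ^^ s) h - (F ^^ s) l)\<^sup>2)) * hilbert_density l h y"
        using S hilbert_density_pos[OF ly] by (intro mult_right_mono) auto
      also have "\<dots> \<le> P \<rho> y * hilbert_density ((F ^^ \<rho>) l) ((F ^^ \<rho>) h) ((F ^^ \<rho>) y)"
        by (rule hilbert_density_iterate[OF ly]) (use ls len_le_1 in auto)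
      also have "hilbert_density ((F ^^ \<rho>) l) ((F ^^ \<rho>) h) ((F ^^ \<rho>) y) = H (i + \<rho>)"
      proof -
        have "(F ^^ \<rho>) y = (F ^^ (i + \<rho>)) x" by (simp add: y_def funpow_add add.commute[of i])
        then show ?thesis unfolding H_def J1' im by simp
      qed
      finally show ?thesis .
    qed
    moreover have "(1 + \<eta>) * H i \<le> (1 - \<eta> / 4) * ((1 + 2 * \<eta>) * H i)"
    proof -
      have "\<eta> * \<eta> \<le> 1 / 2 * \<eta>" using \<eta> by (intro mult_right_mono) auto
      then have "1 + \<eta> \<le> (1 - \<eta> / 4) * (1 + 2 * \<eta>)" using \<eta> by (simp add: algebra_simps)
      from mult_right_mono[OF this, of "H i"] show ?thesis using Hpos[of i] by (simp add: mult.assoc)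
    qed
    moreover have "(1 - \<eta> / 4) * ((1 + 2 * \<eta>) * H i) \<le> (1 - \<eta> / 4) * hilbert_density l h y"
      using calculation(1) \<eta> by (intro mult_left_mono) auto
    ultimately have A: "(1 + \<eta>) * H i \<le> P \<rho> y * H (i + \<rho>)" by linarith
    have "H i \<le> B"
    proof -
      define w where "w = 1 / (2 * exp K) ^ (n' + R)"
      have "0 < w" by (simp add: w_def)
      have "w \<le> h - l"
        using len_ge_uniform[of "n' + \<rho>" "n' + R" J1] R[OF v] by (simp add: w_def l_def h_def len_def \<rho>_def)
      then have "\<eta> * w \<le> e" using \<eta> by (simp add: e_def)
      then have "\<eta> * w \<le> y - lo n' J" "\<eta> * w \<le> lo n' (J + 1) - y" using ly lS hS by linarith+
      moreover have "0 < \<eta> * w" using \<eta> \<open>0 < w\<close> by simp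
      ultimately have "1 / (y - lo n' J) + 1 / (lo n' (J + 1) - y) \<le> 1 / (\<eta> * w) + 1 / (\<eta> * w)"
        by (intro add_mono divide_left_mono) auto
      also have "\<dots> = B" by (simp add: B_def w_def)
      finally show ?thesis by (simp add: H_def hilbert_density_def J_def y_def)
    qed
    with A show ?thesis by (simp add: \<rho>_def y_def)
  qed
  define t where "t = vis n' c"
  have vt: "visit n' c (t l)" for l unfolding t_def by (rule visit_vis[OF inf])
  have grow: "(1 + \<eta>) ^ l * (P (t 0) x * H (t 0)) \<le> P (t l) x * H (t l)" for l
  proof (induction l)
    case (Suc l)
    have "(1 + \<eta>) ^ Suc l * (P (t 0) x * H (t 0)) \<le> (1 + \<eta>) * (P (t l) x * H (t l))"
      using Suc \<eta> by (simp add: mult.assoc)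
    also have "\<dots> = P (t l) x * ((1 + \<eta>) * H (t l))" by simp
    also have "\<dots> \<le> P (t l) x * (P (ret n' c (t l)) ((F ^^ t l) x) * H (t l + ret n' c (t l)))"
      using step[OF vt[of l]] P_pos[of "t l" x] by (intro mult_left_mono) auto
    also have "\<dots> = P (t (Suc l)) x * H (t (Suc l))" by (simp add: t_def P_add)
    finally show ?case .
  qed simp
  have "P (t l) x * H (t l) \<le> B" for l
    using mult_mono[OF bad[of "t l"] conjunct2[OF step[OF vt[of l]]]] Hpos[of "t l"] by simp
  then have "(1 + \<eta>) ^ l * (P (t 0) x * H (t 0)) \<le> B" for l using grow order_trans by blast
  moreover have p: "0 < P (t 0) x * H (t 0)" using P_pos Hpos by simp
  ultimately have "(1 + \<eta>) ^ l \<le> B / (P (t 0) x * H (t 0))" for l by (simp add: pos_le_divide_eq)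
  moreover have "1 < 1 + \<eta>" using \<eta> by simp
  ultimately show False using real_arch_pow[of "1 + \<eta>" "B / (P (t 0) x * H (t 0))"] not_less by blast
qed

end

section \<open>Repelling cycles force expansion\<close>

context repelling_lift
begin

lemma eventually_expands: "\<exists>n. 1 < P n x"
proof (rule ccontr)
  assume "\<not> ?thesis"
  then interpret bad_point F F1 F2 F3 m M x by unfold_locales (meson not_le)
  show False by (rule no_bad_point)
qed

lemma isCont_P: "isCont (P n) x"
  unfolding P_def using DF1 DERIV_isCont isCont_funpow
  by (intro continuous_intros isCont_o2[OF isCont_funpow]) blast

text \<open>
  By compactness of a fundamental interval every point is expanded by at least
  \<open>\<Lambda> > 1\<close> within \<open>N\<close> steps; the bound follows by dividing an
  orbit into such pieces.
\<close>

theorem repelling_imp_expanding: "\<exists>C>0. \<exists>\<kappa>>0. \<forall>n x. C * exp (\<kappa> * real n) \<le> P n x"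
proof -
  define U where "U n \<Lambda> = {x. \<Lambda> < P n x}" for n and \<Lambda> :: real
  have opn: "open (U n \<Lambda>)" for n \<Lambda>
    unfolding U_def using isCont_P by (intro open_Collect_less continuous_intros continuous_at_imp_continuous_on) auto
  define \<C> where "\<C> = {U n (1 + 1 / real (Suc k)) |n k. True}"
  have "{0..1} \<subseteq> \<Union>\<C>"
  proof
    fix x :: real
    obtain n where "1 < P n x" using eventually_expands by blast
    then obtain k where "inverse (real (Suc k)) < P n x - 1" using reals_Archimedean[of "P n x - 1"] by auto
    then have "x \<in> U n (1 + 1 / real (Suc k))" by (simp add: U_def inverse_eq_divide algebra_simps)
    then show "x \<in> \<Union>\<C>" by (auto simp: \<C>_def)
  qed
  moreover have "\<And>V. V \<in> \<C> \<Longrightarrow> open V" using opn by (auto simp: \<C>_def)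
  ultimately obtain \<D> where D: "\<D> \<subseteq> \<C>" "finite \<D>" "{0..1} \<subseteq> \<Union>\<D>"
    using compactE[OF compact_Icc[of "0::real" 1]] by metis
  have "\<forall>V\<in>\<D>. \<exists>n k. V = U n (1 + 1 / real (Suc k))" using D(1) by (auto simp: \<C>_def)
  then obtain nf kf where nk: "\<And>V. V \<in> \<D> \<Longrightarrow> V = U (nf V) (1 + 1 / real (Suc (kf V)))" by metis
  define N where "N = Suc (\<Sum>V\<in>\<D>. nf V)"
  define k where "k = (\<Sum>V\<in>\<D>. kf V)"
  define \<Lambda> where "\<Lambda> = 1 + 1 / real (Suc k)"
  have \<Lambda>: "1 < \<Lambda>" by (simp add: \<Lambda>_def)
  have near01: "\<exists>n. 0 < n \<and> n \<le> N \<and> \<Lambda> \<le> P n x" for x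
  proof -
    define y where "y = x - of_int \<lfloor>x\<rfloor>"
    have "y \<in> {0..1}" unfolding y_def atLeastAtMost_iff by linarith
    then obtain V where V: "V \<in> \<D>" "y \<in> V" using D(3) by blast
    have n: "nf V \<le> N" "kf V \<le> k" unfolding N_def k_def using V(1) D(2) by (auto intro: member_le_sum le_SucI)
    have "1 + 1 / real (Suc (kf V)) < P (nf V) y" using V nk by (auto simp: U_def)
    moreover have "\<Lambda> \<le> 1 + 1 / real (Suc (kf V))" using n by (simp add: \<Lambda>_def frac_le)
    ultimately have "\<Lambda> \<le> P (nf V) y" by simp
    moreover from this have "nf V \<noteq> 0" using \<Lambda> by (intro notI) simp
    moreover have "P (nf V) y = P (nf V) x" using P_add_int[of "nf V" x "- \<lfloor>x\<rfloor>"] by (simp add: y_def)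
    ultimately show ?thesis using n by auto
  qed
  define \<kappa> where "\<kappa> = ln \<Lambda> / real N"
  have Npos: "0 < N" by (simp add: N_def)
  have "0 < \<kappa>" using \<Lambda> Npos by (simp add: \<kappa>_def)
  define c where "c = min 1 m ^ N / \<Lambda>"
  have mm: "0 < min 1 m" "min 1 m \<le> 1" using m_pos by auto
  have c: "0 < c" using mm \<Lambda> by (simp add: c_def)
  have "c * exp (\<kappa> * real n) \<le> P n x" for n x
  proof (induction n arbitrary: x rule: less_induct)
    case (less n)
    show ?case
    proof (cases "n < N")
      case True
      have "min 1 m ^ n \<le> P n x"
        using prod_mono[of "{..<n}" "\<lambda>i. min 1 m" "\<lambda>i. F1 ((F ^^ i) x)"] F1_ge mm by (simp add: P_def min.coboundedI2)
      moreover have "min 1 m ^ N \<le> min 1 m ^ n" using True mm by (intro power_decreasing) auto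
      moreover have "exp (\<kappa> * real n) \<le> \<Lambda>"
      proof -
        have "\<kappa> * real n \<le> \<kappa> * real N" using True \<open>0 < \<kappa>\<close> by (intro mult_left_mono) auto
        also have "\<dots> = ln \<Lambda>" using Npos by (simp add: \<kappa>_def)
        finally show ?thesis using \<Lambda> by (metis exp_le_cancel_iff exp_ln less_trans zero_less_one)
      qed
      moreover have "c * exp (\<kappa> * real n) \<le> c * \<Lambda>" using calculation(3) c by (intro mult_left_mono) auto
      moreover have "c * \<Lambda> = min 1 m ^ N" using \<Lambda> by (simp add: c_def)
      ultimately show ?thesis by linarith
    next
      case False
      obtain k where k: "0 < k" "k \<le> N" "\<Lambda> \<le> P k x" using near01 by blast
      define j where "j = n - k"
      have lt: "j < n" and nk: "n = k + j" using k False by (auto simp: j_def)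
      have "exp (\<kappa> * real k) \<le> \<Lambda>"
      proof -
        have "\<kappa> * real k \<le> \<kappa> * real N" using k \<open>0 < \<kappa>\<close> by (intro mult_left_mono) auto
        also have "\<dots> = ln \<Lambda>" using Npos by (simp add: \<kappa>_def)
        finally show ?thesis using \<Lambda> by (metis exp_le_cancel_iff exp_ln less_trans zero_less_one)
      qed
      then have "exp (\<kappa> * real k) * (c * exp (\<kappa> * real j)) \<le> P k x * P j ((F ^^ k) x)"
        using k less[OF lt, of "(F ^^ k) x"] c less_imp_le[OF P_pos[of k x]] by (intro mult_mono) auto
      also have "\<dots> = P n x" by (simp add: nk P_add)
      also have "exp (\<kappa> * real k) * (c * exp (\<kappa> * real j)) = c * exp (\<kappa> * real n)"
      proof -
        have "real n = real k + real j" by (simp add: nk)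
        then have "\<kappa> * real n = \<kappa> * real k + \<kappa> * real j" by (simp add: distrib_left)
        then show ?thesis by (simp add: exp_add)
      qed
      finally show ?thesis .
    qed
  qed
  then show ?thesis using c \<open>0 < \<kappa>\<close> by blast
qed

end

section \<open>The family and its complex extension\<close>

definition ds_lift :: "real \<Rightarrow> real \<Rightarrow> real \<Rightarrow> real"
  where "ds_lift b a x = 2 * x + a + b / pi * sin (2 * pi * x)"

definition ds_lift1 :: "real \<Rightarrow> real \<Rightarrow> real"
  where "ds_lift1 b x = 2 + 2 * b * cos (2 * pi * x)"

locale double_standard_family =
  fixes b :: real
  assumes b_pos: "0 < b" and b_less_1: "b < 1"
begin

abbreviation f :: "real \<Rightarrow> real \<Rightarrow> real" where "f \<equiv> ds_lift b"

lemma DERIV_f: "(f a has_real_derivative ds_lift1 b x) (at x)"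
  unfolding ds_lift_def[abs_def] ds_lift1_def
  by (auto intro!: derivative_eq_intros)

sublocale lift: degree_two_lift "f a" "ds_lift1 b" "\<lambda>x. - 4 * pi * b * sin (2 * pi * x)"
    "\<lambda>x. - 8 * pi\<^sup>2 * b * cos (2 * pi * x)" "2 - 2 * b" "8 * pi\<^sup>2 * b" for a
proof
  show "(f a has_real_derivative ds_lift1 b x) (at x)" for x by (rule DERIV_f)
  show "(ds_lift1 b has_real_derivative - 4 * pi * b * sin (2 * pi * x)) (at x)" for x
    unfolding ds_lift1_def[abs_def] by (auto intro!: derivative_eq_intros)
  show "((\<lambda>x. - 4 * pi * b * sin (2 * pi * x)) has_real_derivative - 8 * pi\<^sup>2 * b * cos (2 * pi * x)) (at x)" for x
    by (auto intro!: derivative_eq_intros simp: power2_eq_square)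
  show "f a (x + 1) = f a x + 2" for x
    using sin_periodic[of "2 * pi * x"] by (simp add: ds_lift_def algebra_simps)
  show "0 < 2 - 2 * b" using b_less_1 by simp
  show "2 - 2 * b \<le> ds_lift1 b x" for x
  proof -
    have "b * (-1) \<le> b * cos (2 * pi * x)" using b_pos by (intro mult_left_mono cos_ge_minus_one) auto
    then show ?thesis by (simp add: ds_lift1_def)
  qed
  have p: "1 \<le> 2 * pi" using pi_ge_two by simp
  show "\<bar>- 4 * pi * b * sin (2 * pi * x)\<bar> \<le> 8 * pi\<^sup>2 * b" for x
  proof -
    have "\<bar>- 4 * pi * b * sin (2 * pi * x)\<bar> = 4 * pi * b * \<bar>sin (2 * pi * x)\<bar>" using b_pos by (simp add: abs_mult)
    also have "\<dots> \<le> 4 * pi * b * (2 * pi)" using order_trans[OF abs_sin_le_one p, of "2 * pi * x"] b_pos by (intro mult_left_mono) auto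
    also have "\<dots> = 8 * pi\<^sup>2 * b" by (simp add: power2_eq_square)
    finally show ?thesis .
  qed
  show "\<bar>- 8 * pi\<^sup>2 * b * cos (2 * pi * x)\<bar> \<le> 8 * pi\<^sup>2 * b" for x
    using mult_left_mono[OF abs_cos_le_one[of "2 * pi * x"], of "8 * pi\<^sup>2 * b"] b_pos by (simp add: abs_mult)
qed

abbreviation P :: "real \<Rightarrow> nat \<Rightarrow> real \<Rightarrow> real" where "P \<equiv> lift.P"

lemma ds_lift1_le: "ds_lift1 b x \<le> 4"
proof -
  have "b * cos (2 * pi * x) \<le> 1 * 1" using b_pos b_less_1 cos_le_one[of "2 * pi * x"]
    by (metis less_imp_le mult_left_le mult_left_mono mult_1 order_trans)
  then show ?thesis by (simp add: ds_lift1_def)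
qed

lemma P_le: "P a n x \<le> 4 ^ n"
  using prod_mono[of "{..<n}" "\<lambda>i. ds_lift1 b ((f a ^^ i) x)" "\<lambda>i. 4"] ds_lift1_le lift.F1_pos
  by (simp add: lift.P_def less_imp_le)

text \<open>
  The derivative of \<open>(f a ^^ n) x\<close> with respect to the parameter is at least 1.
  In particular a point \<open>x\<close> is periodic with given \<open>n\<close> and
  \<open>k\<close> for at most one \<open>a\<close>.
\<close>

lemma f_mono_param:
  assumes "a \<le> a'" "x \<le> x'" "0 < n"
  shows "(f a ^^ n) x + (a' - a) \<le> (f a' ^^ n) x'"
  using \<open>0 < n\<close>
proof (induction n)
  case (Suc n)
  have "(f a ^^ n) x \<le> (f a' ^^ n) x'"
  proof (cases n)
    case 0 then show ?thesis using assms by simp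
  next
    case (Suc k) then show ?thesis using Suc.IH assms by simp
  qed
  then have "f a ((f a ^^ n) x) \<le> f a ((f a' ^^ n) x')"
    using lift.funpow_le_iff[of 1 a] by simp
  also have "\<dots> = f a' ((f a' ^^ n) x') - (a' - a)" by (simp add: ds_lift_def)
  finally show ?case by simp
qed simp

lemma f_diff_le: "\<bar>f a x - f a' x'\<bar> \<le> 4 * \<bar>x - x'\<bar> + \<bar>a - a'\<bar>"
proof -
  have "norm (f a x - f a x') \<le> 4 * norm (x - x')"
  proof (rule field_differentiable_bound[of UNIV "f a" "ds_lift1 b"])
    show "norm (ds_lift1 b z) \<le> 4" for z using ds_lift1_le[of z] lift.F1_pos[of z] by simp
  qed (use DERIV_f in auto)
  moreover have "f a x' - f a' x' = a - a'" by (simp add: ds_lift_def)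
  ultimately show ?thesis by simp
qed

lemma funpow_Lipschitz: "\<bar>(f a ^^ n) x - (f a' ^^ n) x'\<bar> \<le> 5 ^ n * (\<bar>x - x'\<bar> + \<bar>a - a'\<bar>)"
proof (induction n)
  case (Suc n)
  have "\<bar>(f a ^^ Suc n) x - (f a' ^^ Suc n) x'\<bar> \<le> 4 * \<bar>(f a ^^ n) x - (f a' ^^ n) x'\<bar> + \<bar>a - a'\<bar>"
    using f_diff_le[of a "(f a ^^ n) x" a' "(f a' ^^ n) x'"] by simp
  moreover have "\<bar>a - a'\<bar> \<le> 5 ^ n * (\<bar>x - x'\<bar> + \<bar>a - a'\<bar>)"
  proof -
    have "1 * \<bar>a - a'\<bar> \<le> 5 ^ n * (\<bar>x - x'\<bar> + \<bar>a - a'\<bar>)" by (intro mult_mono) auto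
    then show ?thesis by simp
  qed
  ultimately show ?case using Suc by simp
qed simp

lemma ds_lift1_Lipschitz: "\<bar>ds_lift1 b x - ds_lift1 b y\<bar> \<le> 4 * pi * \<bar>x - y\<bar>"
proof -
  have "norm (ds_lift1 b x - ds_lift1 b y) \<le> 4 * pi * norm (x - y)"
  proof (rule field_differentiable_bound[of UNIV "ds_lift1 b" "\<lambda>x. - 4 * pi * b * sin (2 * pi * x)"])
    show "norm (- 4 * pi * b * sin (2 * pi * z)) \<le> 4 * pi" for z
    proof -
      have "b * \<bar>sin (2 * pi * z)\<bar> \<le> 1" using b_pos b_less_1 abs_sin_le_one[of "2 * pi * z"]
        by (metis less_imp_le mult_le_one abs_ge_zero)
      then show ?thesis using b_pos mult_left_mono[of "b * \<bar>sin (2 * pi * z)\<bar>" 1 "4 * pi"]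
        by (simp add: abs_mult mult_ac)
    qed
    show "(ds_lift1 b has_field_derivative - 4 * pi * b * sin (2 * pi * z)) (at z within UNIV)" for z
      using lift.DF1[of z] by simp
  qed auto
  then show ?thesis by simp
qed

lemma P_Lipschitz: "\<exists>L\<ge>0. \<forall>a a' x x'. \<bar>P a n x - P a' n x'\<bar> \<le> L * (\<bar>x - x'\<bar> + \<bar>a - a'\<bar>)"
proof (induction n)
  case (Suc n)
  then obtain L where L: "0 \<le> L" "\<And>a a' x x'. \<bar>P a n x - P a' n x'\<bar> \<le> L * (\<bar>x - x'\<bar> + \<bar>a - a'\<bar>)" by blast
  have "\<bar>P a (Suc n) x - P a' (Suc n) x'\<bar> \<le> (4 * L + 4 ^ n * (4 * pi * 5 ^ n)) * (\<bar>x - x'\<bar> + \<bar>a - a'\<bar>)" for a a' x x'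
  proof -
    define d where "d = \<bar>x - x'\<bar> + \<bar>a - a'\<bar>"
    define u u' where "u = ds_lift1 b ((f a ^^ n) x)" and "u' = ds_lift1 b ((f a' ^^ n) x')"
    have e: "P a (Suc n) x - P a' (Suc n) x' = (P a n x - P a' n x') * u + P a' n x' * (u - u')"
      by (simp add: lift.P_Suc u_def u'_def algebra_simps)
    have "\<bar>u\<bar> \<le> 4" using ds_lift1_le lift.F1_pos[of "(f a ^^ n) x"] by (simp add: u_def)
    then have 1: "\<bar>(P a n x - P a' n x') * u\<bar> \<le> (L * d) * 4"
      using L(2)[of a x a' x'] L(1) unfolding abs_mult by (intro mult_mono) (auto simp: d_def)
    have "\<bar>u - u'\<bar> \<le> 4 * pi * \<bar>(f a ^^ n) x - (f a' ^^ n) x'\<bar>" unfolding u_def u'_def by (rule ds_lift1_Lipschitz)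
    also have "\<dots> \<le> 4 * pi * (5 ^ n * d)" unfolding d_def by (intro mult_left_mono funpow_Lipschitz) auto
    finally have "\<bar>u - u'\<bar> \<le> 4 * pi * (5 ^ n * d)" .
    moreover have "\<bar>P a' n x'\<bar> \<le> 4 ^ n" using P_le lift.P_pos[of a' n x'] by simp
    ultimately have 2: "\<bar>P a' n x' * (u - u')\<bar> \<le> 4 ^ n * (4 * pi * (5 ^ n * d))"
      unfolding abs_mult by (intro mult_mono) auto
    show ?thesis unfolding e d_def[symmetric] using 1 2 by (simp add: algebra_simps)
  qed
  then show ?case using L(1) by (intro exI[of _ "4 * L + 4 ^ n * (4 * pi * 5 ^ n)"]) auto
qed (auto intro: exI[of _ 0])

lemma tendsto_f: assumes "(u \<longlongrightarrow> a) A" "(v \<longlongrightarrow> x) A"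
  shows "((\<lambda>i. (f (u i) ^^ n) (v i)) \<longlongrightarrow> (f a ^^ n) x) A"
proof (rule LIM_zero_cancel, rule Lim_null_comparison)
  show "\<forall>\<^sub>F i in A. norm ((f (u i) ^^ n) (v i) - (f a ^^ n) x) \<le> 5 ^ n * (\<bar>v i - x\<bar> + \<bar>u i - a\<bar>)"
    using funpow_Lipschitz by (intro always_eventually) auto
  have "((\<lambda>i. 5 ^ n * (\<bar>v i - x\<bar> + \<bar>u i - a\<bar>)) \<longlongrightarrow> 5 ^ n * (\<bar>x - x\<bar> + \<bar>a - a\<bar>)) A"
    by (intro tendsto_intros assms)
  then show "((\<lambda>i. 5 ^ n * (\<bar>v i - x\<bar> + \<bar>u i - a\<bar>)) \<longlongrightarrow> 0) A" by simp
qed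

lemma tendsto_P: assumes "(u \<longlongrightarrow> a) A" "(v \<longlongrightarrow> x) A"
  shows "((\<lambda>i. P (u i) n (v i)) \<longlongrightarrow> P a n x) A"
proof -
  obtain L where L: "\<And>a a' x x'. \<bar>P a n x - P a' n x'\<bar> \<le> L * (\<bar>x - x'\<bar> + \<bar>a - a'\<bar>)"
    using P_Lipschitz[of n] by blast
  show ?thesis
  proof (rule LIM_zero_cancel, rule Lim_null_comparison)
    show "\<forall>\<^sub>F i in A. norm (P (u i) n (v i) - P a n x) \<le> L * (\<bar>v i - x\<bar> + \<bar>u i - a\<bar>)"
      using L by (intro always_eventually) auto
    have "((\<lambda>i. L * (\<bar>v i - x\<bar> + \<bar>u i - a\<bar>)) \<longlongrightarrow> L * (\<bar>x - x\<bar> + \<bar>a - a\<bar>)) A"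
      by (intro tendsto_intros assms)
    then show "((\<lambda>i. L * (\<bar>v i - x\<bar> + \<bar>u i - a\<bar>)) \<longlongrightarrow> 0) A" by simp
  qed
qed

lemma f_reflect: "f (- a) (- x) = - f a x"
  by (simp add: ds_lift_def)

lemma funpow_reflect: "(f (- a) ^^ n) (- x) = - (f a ^^ n) x"
  by (induction n) (simp_all add: f_reflect)

lemma P_reflect: "P (- a) n (- x) = P a n x"
  by (simp add: lift.P_def funpow_reflect ds_lift1_def)

definition fc :: "real \<Rightarrow> complex \<Rightarrow> complex"
  where "fc a z = 2 * z + of_real a + of_real (b / pi) * sin (2 * of_real pi * z)"

lemma fc_of_real: "fc a (of_real x) = of_real (f a x)"
proof -
  have "sin (2 * of_real pi * complex_of_real x) = of_real (sin (2 * pi * x))"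
    by (metis of_real_mult of_real_numeral sin_of_real)
  then show ?thesis by (simp add: fc_def ds_lift_def)
qed

lemma funpow_fc_of_real: "(fc a ^^ n) (of_real x) = of_real ((f a ^^ n) x)"
  by (induction n) (simp_all add: fc_of_real)

definition fc1 :: "complex \<Rightarrow> complex" where "fc1 z = 2 + 2 * of_real b * cos (2 * of_real pi * z)"

lemma DERIV_fc: "(fc a has_field_derivative fc1 z) (at z)"
  unfolding fc_def[abs_def] fc1_def by (auto intro!: derivative_eq_intros)

lemma holomorphic_funpow_fc: "(fc a ^^ n) holomorphic_on S"
proof (induction n)
  case 0 then show ?case by (simp add: id_def holomorphic_on_ident)
next
  case (Suc n)
  have "fc a holomorphic_on UNIV" using DERIV_fc by (auto simp: holomorphic_on_def field_differentiable_def)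
  then have "(fc a \<circ> (fc a ^^ n)) holomorphic_on S"
    by (intro holomorphic_on_compose_gen[OF Suc]) auto
  then show ?case by (simp add: o_def)
qed

lemma fc_cnj: "fc a (cnj z) = cnj (fc a z)"
proof -
  have "sin (2 * of_real pi * cnj z) = cnj (sin (2 * of_real pi * z))" by (simp add: cnj_sin)
  then show ?thesis by (simp add: fc_def)
qed

lemma funpow_fc_cnj: "(fc a ^^ n) (cnj z) = cnj ((fc a ^^ n) z)"
  by (induction n) (simp_all add: fc_cnj)

lemma fc_add_int: "fc a (z + of_int k) = fc a z + 2 * of_int k"
proof -
  have "sin (2 * of_real pi * (z + of_int k)) = sin (2 * of_real pi * z + of_real (2 * pi * of_int k))"
    by (simp add: algebra_simps)
  also have "\<dots> = sin (2 * of_real pi * z)"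
    unfolding sin_add sin_of_real cos_of_real by (simp only: sin_int_2pin cos_int_2pin) simp
  finally show ?thesis by (simp add: fc_def algebra_simps)
qed

lemma funpow_fc_add_int: "(fc a ^^ n) (z + of_int k) = (fc a ^^ n) z + of_int (2 ^ n * k)"
proof (induction n)
  case (Suc n)
  then show ?case using fc_add_int[of a "(fc a ^^ n) z" "2 ^ n * k"] by (simp add: mult.assoc)
qed simp

lemma deriv_funpow_fc_real: "((fc a ^^ n) has_field_derivative of_real (P a n x)) (at (of_real x))"
proof (induction n)
  case 0 then show ?case by (simp add: id_def)
next
  case (Suc n)
  have "((\<lambda>z. fc a ((fc a ^^ n) z)) has_field_derivative fc1 ((fc a ^^ n) (of_real x)) * of_real (P a n x)) (at (of_real x))"
    by (rule DERIV_chain2[OF DERIV_fc Suc])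
  moreover have "fc1 ((fc a ^^ n) (of_real x)) = of_real (ds_lift1 b ((f a ^^ n) x))"
  proof -
    have "cos (2 * of_real pi * complex_of_real y) = of_real (cos (2 * pi * y))" for y
      by (metis of_real_mult of_real_numeral cos_of_real)
    then show ?thesis unfolding funpow_fc_of_real by (simp add: fc1_def ds_lift1_def)
  qed
  ultimately show ?case by (simp add: lift.P_Suc o_def mult.commute)
qed

text \<open>
  The function is not constant, as the translation by 1 changes it by
  \<open>2 ^ n - 1\<close>, so its zero at \<open>p\<close> has finite order.
\<close>

lemma periodic_factor:
  assumes "0 < n" "(f a ^^ n) p = p + of_int k"
  obtains g r d where "0 < (d::nat)" "0 < r" "g holomorphic_on ball (of_real p) r"
    "\<And>z. z \<in> ball (of_real p) r \<Longrightarrow> (fc a ^^ n) z - z - of_int k = (z - of_real p) ^ d * g z"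
    "\<And>z. z \<in> ball (of_real p) r \<Longrightarrow> g z \<noteq> 0"
proof -
  define H where "H = (\<lambda>z. (fc a ^^ n) z - z - of_int k)"
  have h: "H holomorphic_on UNIV" unfolding H_def by (intro holomorphic_intros holomorphic_funpow_fc)
  have z: "H (of_real p) = 0" using assms by (simp add: H_def funpow_fc_of_real)
  have nc: "\<not> H constant_on UNIV"
  proof
    assume "H constant_on UNIV"
    then have "H (of_real p + of_int 1) = H (of_real p)" unfolding constant_on_def by (metis UNIV_I)
    then have "(2::complex) ^ n = 1" unfolding H_def funpow_fc_add_int by simp
    then have "norm ((2::complex) ^ n) = 1" by simp
    then have "(2::real) ^ n = 1" by (simp add: norm_power)
    moreover have "(1::real) < 2 ^ n" using \<open>0 < n\<close> by (intro one_less_power) auto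
    ultimately show False by simp
  qed
  show ?thesis
  proof (rule holomorphic_factor_zero_nonconstant[OF h open_UNIV connected_UNIV UNIV_I z nc])
    fix g r and d :: nat
    assume g: "0 < d" "0 < r" "ball (complex_of_real p) r \<subseteq> UNIV" "g holomorphic_on ball (of_real p) r"
      "\<And>z. z \<in> ball (of_real p) r \<Longrightarrow> H z = (z - of_real p) ^ d * g z"
      "\<And>z. z \<in> ball (of_real p) r \<Longrightarrow> g z \<noteq> 0"
    show ?thesis by (rule that[OF g(1,2,4) g(5)[unfolded H_def] g(6)])
  qed
qed

text \<open>
  Let \<open>G x = (f a ^^ n) x - x - k\<close>, with derivative
  \<open>P a n x - 1\<close>. A zero of order \<open>d\<close> at \<open>p\<close> means that
  \<open>(x - p) * (P a n x - 1) / G x\<close> is close to \<open>d \<ge> 1\<close>,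
  which gives the inequality with \<open>P a n x\<close> in place of
  \<open>P a' n x\<close>. If \<open>x\<close> is periodic for \<open>a'\<close>, then
  \<open>\<bar>a' - a\<bar> \<le> \<bar>G x\<bar>\<close> by \<open>f_mono_param\<close>, so
  that replacing \<open>a\<close> by \<open>a'\<close> changes \<open>P\<close> only by a multiple
  of \<open>G x\<close>; this is negligible because of the factor \<open>x - p\<close>.

  The lemma has two uses: with \<open>P a' n x = 1\<close> it isolates neutral points, and
  with \<open>P a' n x < 1\<close> it tells on which side of \<open>p\<close>, and for which
  sign of \<open>G\<close>, attracting points of nearby parameters can lie.
\<close>

lemma near_periodic_point:
  assumes n: "0 < n" and p: "(f a ^^ n) p = p + of_int k"
  shows "\<exists>\<delta>>0. \<forall>x. 0 < \<bar>x - p\<bar> \<and> \<bar>x - p\<bar> < \<delta> \<longrightarrow> (f a ^^ n) x - x - of_int k \<noteq> 0 \<and>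
    (\<forall>a'. (f a' ^^ n) x = x + of_int k \<longrightarrow>
       0 < (P a' n x - 1) * ((f a ^^ n) x - x - of_int k) * (x - p))"
proof -
  obtain g r d where g: "0 < (d::nat)" "0 < r" "g holomorphic_on ball (of_real p) r"
    "\<And>z. z \<in> ball (of_real p) r \<Longrightarrow> (fc a ^^ n) z - z - of_int k = (z - of_real p) ^ d * g z"
    "\<And>z. z \<in> ball (of_real p) r \<Longrightarrow> g z \<noteq> 0"
    using periodic_factor[OF n p] by metis
  define G where "G x = (f a ^^ n) x - x - of_int k" for x
  obtain L where L: "0 \<le> L" "\<And>a a' x x'. \<bar>P a n x - P a' n x'\<bar> \<le> L * (\<bar>x - x'\<bar> + \<bar>a - a'\<bar>)"
    using P_Lipschitz[of n] by blast
  (* The logarithmic derivative of the displacement times x - p, which tends to the order of the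
     zero. *)
  define Q where "Q x = (x - p) * (P a n x - 1) / G x" for x
  have inb: "of_real x \<in> ball (complex_of_real p) r \<longleftrightarrow> \<bar>x - p\<bar> < r" for x
    by (simp add: dist_norm abs_minus_commute flip: of_real_diff)
  have GH: "of_real (G x) = (of_real x - of_real p) ^ d * g (of_real x)" if "\<bar>x - p\<bar> < r" for x
    using g(4)[OF inb[THEN iffD2, OF that]] by (simp add: G_def funpow_fc_of_real)
  have G0: "G x \<noteq> 0" if "\<bar>x - p\<bar> < r" "x \<noteq> p" for x
    using GH[OF that(1)] g(5)[OF inb[THEN iffD2, OF that(1)]] that(2) by auto
  have dG: "of_real (P a n x - 1) = of_nat d * (of_real x - of_real p) ^ (d - 1) * g (of_real x) + (of_real x - of_real p) ^ d * deriv g (of_real x)"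
    if "\<bar>x - p\<bar> < r" for x
  proof (rule DERIV_unique)
    have "((\<lambda>z. (fc a ^^ n) z - z - of_int k) has_field_derivative of_real (P a n x) - 1 - 0) (at (of_real x))"
      by (intro DERIV_diff deriv_funpow_fc_real DERIV_ident DERIV_const)
    then show "((\<lambda>z. (fc a ^^ n) z - z - of_int k) has_field_derivative of_real (P a n x - 1)) (at (of_real x))" by simp
    have gd: "(g has_field_derivative deriv g (of_real x)) (at (of_real x))"
      by (rule holomorphic_derivI[OF g(3) open_ball inb[THEN iffD2, OF that]])
    have "((\<lambda>z. (z - of_real p) ^ d * g z) has_field_derivative of_nat d * (of_real x - of_real p) ^ (d - 1) * g (of_real x) + (of_real x - of_real p) ^ d * deriv g (of_real x)) (at (of_real x))"
      using gd by (auto intro!: derivative_eq_intros simp: algebra_simps)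
    then show "((\<lambda>z. (fc a ^^ n) z - z - of_int k) has_field_derivative of_nat d * (of_real x - of_real p) ^ (d - 1) * g (of_real x) + (of_real x - of_real p) ^ d * deriv g (of_real x)) (at (of_real x))"
      by (rule has_field_derivative_transform_within_open[OF _ open_ball inb[THEN iffD2, OF that]]) (simp add: g(4))
  qed
  have Qc: "of_real (Q x) = of_nat d + (of_real x - of_real p) * deriv g (of_real x) / g (of_real x)" if x: "\<bar>x - p\<bar> < r" "x \<noteq> p" for x
  proof -
    have nz: "complex_of_real x - of_real p \<noteq> 0" "g (of_real x) \<noteq> 0" using x g(5)[OF inb[THEN iffD2, OF x(1)]] by auto
    have pw: "(complex_of_real x - of_real p) ^ d = (of_real x - of_real p) * (of_real x - of_real p) ^ (d - 1)"
      using g(1) by (metis power_eq_if not_gr_zero)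
    have "of_real (Q x) = (of_real x - of_real p) * of_real (P a n x - 1) / complex_of_real (G x)" by (simp add: Q_def)
    moreover have "w * (D * W * g0 + (w * W) * g1) / (w * W * g0) = D + w * g1 / g0"
      if "w \<noteq> 0" "W \<noteq> 0" "g0 \<noteq> 0" for w D W g0 g1 :: complex
      using that by (simp add: field_simps)
    ultimately show ?thesis unfolding GH[OF x(1)] dG[OF x(1)] pw using nz by simp
  qed
  have "((\<lambda>z. (z - of_real p) * deriv g z / g z) \<longlongrightarrow> (of_real p - of_real p) * deriv g (of_real p) / g (of_real p)) (at (of_real p))"
  proof -
    have "g \<midarrow>of_real p\<rightarrow> g (of_real p)" "deriv g \<midarrow>of_real p\<rightarrow> deriv g (of_real p)"
      using g(2,3) by (auto intro!: isContD holomorphic_on_imp_continuous_on holomorphic_deriv continuous_on_interior[of "ball (of_real p) r"] simp: interior_open)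
    then show ?thesis using g(2) g(5)[of "of_real p"] by (intro tendsto_intros) auto
  qed
  then have "((\<lambda>z. (z - of_real p) * deriv g z / g z) \<longlongrightarrow> 0) (at (of_real p))" by simp
  from LIM_D[OF this, of "1/2"] obtain s where s: "0 < s"
    "\<And>z. z \<noteq> of_real p \<Longrightarrow> norm (z - of_real p) < s \<Longrightarrow> norm ((z - of_real p) * deriv g z / g z) < 1/2" by auto
  have Qhalf: "1/2 < Q x" if x: "\<bar>x - p\<bar> < r" "\<bar>x - p\<bar> < s" "x \<noteq> p" for x
  proof -
    have "complex_of_real x \<noteq> of_real p" "norm (complex_of_real x - of_real p) < s"
      using x by (simp_all flip: of_real_diff)
    from s(2)[OF this] have "norm (of_real (Q x - real d) :: complex) < 1/2"
      using Qc[OF x(1,3)] by simp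
    then have "\<bar>Q x - real d\<bar> < 1/2" by (simp only: norm_of_real)
    moreover have "1 \<le> real d" using g(1) by simp
    ultimately show ?thesis by linarith
  qed
  (* The last bound makes the effect of changing the parameter in P smaller than half of the square
     of G x. *)
  define \<delta> where "\<delta> = min (min r s) (1 / (2 * (L + 1)))"
  have "0 < \<delta>" using g(2) s(1) L(1) by (simp add: \<delta>_def)
  moreover have "G x \<noteq> 0 \<and> (\<forall>a'. (f a' ^^ n) x = x + of_int k \<longrightarrow> 0 < (P a' n x - 1) * G x * (x - p))"
    if x: "0 < \<bar>x - p\<bar>" "\<bar>x - p\<bar> < \<delta>" for x
  proof (intro conjI allI impI)
    have x': "\<bar>x - p\<bar> < r" "\<bar>x - p\<bar> < s" "x \<noteq> p" "\<bar>x - p\<bar> < 1 / (2 * (L + 1))" using x by (auto simp: \<delta>_def)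
    show nz: "G x \<noteq> 0" using G0 x' by blast
    fix a' assume a': "(f a' ^^ n) x = x + of_int k"
    have "\<bar>a' - a\<bar> \<le> \<bar>G x\<bar>"
    proof (cases "a \<le> a'")
      case True
      then show ?thesis using f_mono_param[OF True order_refl n, of x] a' by (simp add: G_def)
    next
      case False
      then have "a' \<le> a" by simp
      then show ?thesis using f_mono_param[OF _ order_refl n, of a' a x] a' by (simp add: G_def)
    qed
    then have e: "\<bar>P a' n x - P a n x\<bar> \<le> L * \<bar>G x\<bar>"
      using L(2)[of a' x a x] mult_left_mono[OF _ L(1), of "\<bar>a' - a\<bar>" "\<bar>G x\<bar>"] by simp
    have "L * \<bar>x - p\<bar> \<le> (L + 1) * \<bar>x - p\<bar>" by (simp add: mult_right_mono)
    also have "\<dots> < (L + 1) * (1 / (2 * (L + 1)))" using x'(4) L(1) by (intro mult_strict_left_mono) auto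
    also have "\<dots> = 1/2" using L(1) by simp
    finally have Lx: "L * \<bar>x - p\<bar> < 1/2" .
    have "(P a n x - 1) * (x - p) = Q x * G x" using nz by (simp add: Q_def)
    then have "((P a n x - 1) * (x - p)) * G x = Q x * (G x)\<^sup>2" by (simp add: power2_eq_square)
    moreover have "(P a' n x - 1) * G x * (x - p) = ((P a n x - 1) * (x - p)) * G x + (P a' n x - P a n x) * G x * (x - p)"
      by (simp add: algebra_simps)
    ultimately have "(P a' n x - 1) * G x * (x - p) = Q x * (G x)\<^sup>2 + (P a' n x - P a n x) * G x * (x - p)" by simp
    moreover have "\<bar>(P a' n x - P a n x) * G x * (x - p)\<bar> \<le> (L * \<bar>x - p\<bar>) * (G x)\<^sup>2"
    proof -
      have "\<bar>(P a' n x - P a n x) * G x * (x - p)\<bar> = \<bar>P a' n x - P a n x\<bar> * (\<bar>G x\<bar> * \<bar>x - p\<bar>)" by (simp add: abs_mult)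
      also have "\<dots> \<le> (L * \<bar>G x\<bar>) * (\<bar>G x\<bar> * \<bar>x - p\<bar>)" using e by (intro mult_right_mono) auto
      also have "\<dots> = (L * \<bar>x - p\<bar>) * (G x)\<^sup>2" by (simp add: power2_eq_square abs_mult_self_eq mult_ac)
      finally show ?thesis .
    qed
    moreover have "(L * \<bar>x - p\<bar>) * (G x)\<^sup>2 < 1/2 * (G x)\<^sup>2" using Lx nz by (intro mult_strict_right_mono) auto
    moreover have "1/2 * (G x)\<^sup>2 \<le> Q x * (G x)\<^sup>2" using Qhalf[OF x'(1,2,3)] by (intro mult_right_mono) auto
    ultimately show "0 < (P a' n x - 1) * G x * (x - p)" by linarith
  qed
  ultimately show ?thesis unfolding G_def by blast
qed

section \<open>Critical values and the covering they define\<close>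

text \<open>
  The critical points of \<open>fc a\<close> are the integer translates of \<open>crit\<close>
  and of its conjugate: they solve \<open>cos (2 * pi * z) = - 1 / b\<close>, and
  \<open>cosh (arcosh (1 / b)) = 1 / b\<close>. Accordingly \<open>V a\<close> contains
  all critical values.
\<close>

definition crit :: complex
  where "crit = Complex (1 / 2) (arcosh (1 / b) / (2 * pi))"

definition v :: "real \<Rightarrow> complex" where "v a = fc a crit"

definition V :: "real \<Rightarrow> complex set"
  where "V a = (\<lambda>k. v a + k) ` \<int> \<union> (\<lambda>k. cnj (v a) + k) ` \<int>"

lemma cnj_crit: "- crit = cnj crit - 1"
  by (simp add: crit_def complex_eq_iff)

lemma cos_crit: "cos (2 * of_real pi * crit) = - (1 / of_real b)"
proof -
  define t where "t = arcosh (1 / b)"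
  have "2 * of_real pi * crit = of_real pi + \<i> * of_real t"
    using pi_gt_zero by (simp add: crit_def t_def complex_eq_iff)
  then have "cos (2 * of_real pi * crit) = - cos (\<i> * of_real t)"
    by (simp add: cos_add)
  also have "cos (\<i> * of_real t) = of_real (cosh t)"
  proof -
    have "cos (\<i> * complex_of_real t) = (exp (- of_real t) + exp (of_real t)) / 2"
      unfolding cos_exp_eq by simp
    also have "\<dots> = of_real ((exp (- t) + exp t) / 2)"
      by (simp add: exp_of_real flip: of_real_minus)
    also have "(exp (- t) + exp t) / 2 = cosh t" by (simp add: cosh_def)
    finally show ?thesis .
  qed
  also have "cosh t = 1 / b" unfolding t_def using b_pos b_less_1 by (intro cosh_arcosh_real) simp
  finally show ?thesis by simp
qed

lemma critical_value: "fc1 z = 0 \<Longrightarrow> fc a z \<in> V a"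
proof -
  assume "fc1 z = 0"
  then have "cos (2 * of_real pi * z) = - (1 / of_real b)"
  proof -
    have "2 * (1 + of_real b * cos (2 * of_real pi * z)) = 0" using \<open>fc1 z = 0\<close> by (simp add: fc1_def mult.assoc)
    then have "of_real b * cos (2 * of_real pi * z) = - 1"
    proof -
      have "1 + of_real b * cos (2 * of_real pi * z) = 0"
        using \<open>2 * (1 + of_real b * cos (2 * of_real pi * z)) = 0\<close> unfolding mult_eq_0_iff by simp
      then show ?thesis by (rule add_eq_0_iff[THEN iffD1])
    qed
    moreover have "cos (2 * of_real pi * z) = (of_real b * cos (2 * of_real pi * z)) / of_real b"
      using b_pos by simp
    ultimately have "cos (2 * of_real pi * z) = - 1 / of_real b" by (simp only:)
    then show ?thesis by simp
  qed
  then have "cos (2 * of_real pi * z) = cos (2 * of_real pi * crit)" by (simp add: cos_crit)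
  then obtain n where n: "n \<in> \<int>" "2 * of_real pi * z = 2 * of_real pi * crit + of_real (2 * n * pi) \<or>
      2 * of_real pi * z = - (2 * of_real pi * crit) + of_real (2 * n * pi)"
    unfolding complex_cos_eq by blast
  obtain k where k: "n = of_int k" using n(1) by (auto elim: Ints_cases)
  have "2 * of_real pi * z = 2 * of_real pi * (crit + of_int k) \<or> 2 * of_real pi * z = 2 * of_real pi * (- crit + of_int k)"
    using n(2) by (auto simp: k algebra_simps)
  then have "z = crit + of_int k \<or> z = - crit + of_int k" by (simp only: mult_cancel_left) simp
  then have "z = crit + of_int k \<or> z = cnj crit + of_int (k - 1)"
    unfolding cnj_crit by (simp add: algebra_simps)
  then have "fc a z = v a + 2 * of_int k \<or> fc a z = cnj (v a) + 2 * of_int (k - 1)"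
    unfolding v_def fc_cnj[symmetric] using fc_add_int by metis
  moreover have "2 * of_int k \<in> (\<int> :: complex set)" "2 * of_int (k - 1) \<in> (\<int> :: complex set)" by auto
  ultimately show ?thesis unfolding V_def by blast
qed

lemma closed_V: "closed (V a)"
  unfolding V_def by (intro closed_Un closed_translation closed_Ints)

lemma V_nonempty: "V a \<noteq> {}" by (auto simp: V_def)

lemma V_add_int: "w + of_int k \<in> V a \<longleftrightarrow> w \<in> V a"
proof -
  have *: "w + of_int k \<in> V a" if w: "w \<in> V a" for w k
  proof -
    obtain m where "m \<in> \<int>" "w = v a + m \<or> w = cnj (v a) + m" using w by (auto simp: V_def)
    then have "m + of_int k \<in> \<int>" "w + of_int k = v a + (m + of_int k) \<or> w + of_int k = cnj (v a) + (m + of_int k)"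
      by auto
    then show ?thesis unfolding V_def by blast
  qed
  show ?thesis using *[of w k] *[of "w + of_int k" "-k"] by auto
qed

lemma countable_Ints_complex: "countable (\<int> :: complex set)"
  unfolding Ints_def by (intro countable_image) auto

lemma connected_Compl_V: "connected (- V a)"
proof -
  have "countable (V a)" unfolding V_def by (intro countable_Un countable_image countable_Ints_complex)
  from connected_open_diff_countable[OF _ open_UNIV connected_UNIV this] show ?thesis
    by (simp add: Compl_eq_Diff_UNIV)
qed

lemma infdist_V_add_int: "infdist (w + of_int k) (V a) = infdist w (V a)"
proof -
  have le: "infdist (w + of_int k) (V a) \<le> infdist w (V a)" for w k
  proof -
    obtain p where p: "p \<in> V a" "infdist w (V a) = dist w p"
      using infdist_attains_inf[OF closed_V V_nonempty] by blast
    have "infdist (w + of_int k) (V a) \<le> dist (w + of_int k) (p + of_int k)"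
      by (rule infdist_le) (simp add: V_add_int p)
    then show ?thesis using p by simp
  qed
  show ?thesis using le[of w k] le[of "w + of_int k" "-k"] by simp
qed

lemma norm_cos_ge: "\<bar>Im z\<bar> / 2 \<le> norm (cos z)"
proof -
  have 1: "\<bar>y\<bar> \<le> \<bar>exp y - inverse (exp y)\<bar>" for y :: real
  proof -
    have *: "t \<le> exp t - inverse (exp t)" if "0 \<le> t" for t :: real
    proof -
      have "inverse (exp t) \<le> 1" using that by (simp add: inverse_le_1_iff)
      moreover have "1 + t \<le> exp t" by (rule exp_ge_add_one_self)
      ultimately show ?thesis by linarith
    qed
    show ?thesis using *[of y] *[of "-y"] by (cases "0 \<le> y") (auto simp: exp_minus)
  qed
  have "(\<bar>Im z\<bar> / 2)\<^sup>2 \<le> (exp (Im z) - inverse (exp (Im z)))\<^sup>2 / 4"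
    using power_mono[OF 1[of "Im z"], of 2] by (simp add: power_divide)
  also have "\<dots> \<le> (norm (cos z))\<^sup>2" unfolding norm_cos_squared by simp
  finally show ?thesis by (rule power2_le_imp_le) simp
qed

lemma norm_sin_le: "norm (sin z) \<le> 1 + norm (cos (z::complex))"
proof -
  have "(norm (sin z))\<^sup>2 = norm (1 - (cos z)\<^sup>2)" by (simp add: sin_squared_eq flip: norm_power)
  also have "\<dots> \<le> 1 + (norm (cos z))\<^sup>2" using norm_triangle_ineq4[of 1 "(cos z)\<^sup>2"] by (simp add: norm_power)
  also have "\<dots> \<le> (1 + norm (cos z))\<^sup>2" by (simp add: power2_eq_square algebra_simps)
  finally show ?thesis by (rule power2_le_imp_le) simp
qed

text \<open>
  Where \<open>cos\<close> is large this is clear. Otherwise \<open>z\<close> lies, modulo 1, in a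
  compact set on which \<open>fc1\<close> does not vanish. The factor
  \<open>1 + norm (cos (2 * pi * z))\<close> also measures the variation of
  \<open>fc1\<close> near \<open>z\<close> (\<open>fc1_variation\<close>), so that the relative
  variation of the derivative is uniformly small on small discs.
\<close>

lemma fc1_lower_bound:
  assumes "0 < \<delta>"
  shows "\<exists>\<eta>>0. \<forall>z. \<delta> \<le> infdist (fc a z) (V a) \<longrightarrow> \<eta> * (1 + norm (cos (2 * of_real pi * z))) \<le> norm (fc1 z)"
proof -
  define R where "R = 4 / b"
  define X where "X = {z. 0 \<le> Re z} \<inter> {z. Re z \<le> 1} \<inter> {z. norm (cos (2 * of_real pi * z)) \<le> R} \<inter> {z. \<delta> \<le> infdist (fc a z) (V a)}"
  have ccos: "continuous_on UNIV (\<lambda>z::complex. cos (2 * of_real pi * z))" by (intro continuous_intros)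
  have cfc: "continuous_on UNIV (fc a)" using DERIV_fc by (meson DERIV_isCont continuous_at_imp_continuous_on)
  have "closed X" unfolding X_def
    by (intro closed_Int closed_Collect_le continuous_intros ccos cfc)
  moreover have "bounded X"
  proof (rule bounded_subset)
    show "bounded (cbox (Complex 0 (-R)) (Complex 1 R))" by (rule bounded_cbox)
    show "X \<subseteq> cbox (Complex 0 (-R)) (Complex 1 R)"
    proof
      fix z assume z: "z \<in> X"
      have "\<bar>Im (2 * of_real pi * z)\<bar> / 2 \<le> R" using z norm_cos_ge[of "2 * of_real pi * z"] by (auto simp: X_def)
      then have "pi * \<bar>Im z\<bar> \<le> R" by (simp add: abs_mult)
      moreover have "1 * \<bar>Im z\<bar> \<le> pi * \<bar>Im z\<bar>" using pi_ge_two by (intro mult_right_mono) auto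
      ultimately show "z \<in> cbox (Complex 0 (-R)) (Complex 1 R)" using z by (auto simp: in_cbox_complex_iff X_def)
    qed
  qed
  ultimately have X: "compact X" by (simp add: compact_eq_bounded_closed)
  have nz: "fc1 z \<noteq> 0" if "z \<in> X" for z
    using critical_value[of z a] that assms by (auto simp: X_def)
  have "\<exists>\<mu>>0. \<forall>z\<in>X. \<mu> \<le> norm (fc1 z)"
  proof (cases "X = {}")
    case False
    have "continuous_on X (\<lambda>z. norm (fc1 z))" unfolding fc1_def by (intro continuous_intros)
    then obtain z0 where "z0 \<in> X" "\<And>z. z \<in> X \<Longrightarrow> norm (fc1 z0) \<le> norm (fc1 z)"
      using continuous_attains_inf[OF X False] by blast
    then show ?thesis using nz by (intro exI[of _ "norm (fc1 z0)"]) auto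
  qed (auto intro: exI[of _ 1])
  then obtain \<mu> where \<mu>: "0 < \<mu>" "\<And>z. z \<in> X \<Longrightarrow> \<mu> \<le> norm (fc1 z)" by blast
  define \<eta> where "\<eta> = min (\<mu> / (1 + R)) (b / 2)"
  have Rpos: "0 < R" using b_pos by (simp add: R_def)
  have "0 < \<eta>" using \<mu> Rpos b_pos by (simp add: \<eta>_def)
  moreover have "\<eta> * (1 + norm (cos (2 * of_real pi * z))) \<le> norm (fc1 z)" if z: "\<delta> \<le> infdist (fc a z) (V a)" for z
  proof (cases "norm (cos (2 * of_real pi * z)) \<le> R")
    case True
    define k where "k = - \<lfloor>Re z\<rfloor>"
    define y where "y = z + of_int k"
    have cy: "cos (2 * of_real pi * y) = cos (2 * of_real pi * z)"
    proof -
      have e: "2 * of_real pi * y = 2 * of_real pi * z + of_real (2 * pi * of_int k)" by (simp add: y_def algebra_simps)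
      show ?thesis unfolding e cos_add sin_of_real cos_of_real by (simp only: sin_int_2pin cos_int_2pin) simp
    qed
    have "fc a y = fc a z + of_int (2 * k)" by (simp add: y_def fc_add_int)
    then have "\<delta> \<le> infdist (fc a y) (V a)" using z infdist_V_add_int[of "fc a z" "2 * k" a] by simp
    moreover have "0 \<le> Re y" "Re y \<le> 1" unfolding y_def k_def by simp_all linarith+
    ultimately have "y \<in> X" using True cy by (simp add: X_def)
    then have "\<mu> \<le> norm (fc1 z)" using \<mu>(2)[of y] cy by (simp add: fc1_def)
    moreover have "\<eta> * (1 + norm (cos (2 * of_real pi * z))) \<le> \<mu> / (1 + R) * (1 + R)"
      using True \<open>0 < \<eta>\<close> \<mu>(1) Rpos by (intro mult_mono) (auto simp: \<eta>_def)
    ultimately show ?thesis using Rpos by simp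
  next
    case False
    define C where "C = norm (cos (2 * of_real pi * z))"
    have bC: "4 < b * C" using False b_pos by (simp add: C_def R_def field_simps)
    have "2 * b * C - 2 \<le> norm (fc1 z)"
      using norm_diff_ineq[of "2 * of_real b * cos (2 * of_real pi * z)" 2] b_pos
      by (simp add: fc1_def C_def norm_mult add.commute)
    moreover have "\<eta> \<le> b / 2" unfolding \<eta>_def by (rule min.cobounded2)
    then have "\<eta> * (1 + C) \<le> b / 2 * (1 + C)" by (intro mult_right_mono) (auto simp: C_def)
    moreover have "b / 2 * (1 + C) \<le> 1 + b * C" using b_less_1 bC b_pos by (simp add: field_simps)
    ultimately show ?thesis using bC unfolding C_def[symmetric] by linarith
  qed
  ultimately show ?thesis by blast
qed

lemma fc1_variation:
  "norm (fc1 (z + h) - fc1 z) \<le> 2 * (1 + norm (cos (2 * of_real pi * z))) *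
    (norm (cos (2 * of_real pi * h) - 1) + norm (sin (2 * of_real pi * h)))"
proof -
  define Z H where "Z = 2 * of_real pi * z" and "H = 2 * of_real pi * h"
  have "cos (Z + H) - cos Z = cos Z * (cos H - 1) - sin Z * sin H" by (simp add: cos_add algebra_simps)
  then have "norm (cos (Z + H) - cos Z) \<le> norm (cos Z) * norm (cos H - 1) + norm (sin Z) * norm (sin H)"
    by (metis norm_mult norm_triangle_ineq4)
  also have "\<dots> \<le> (1 + norm (cos Z)) * norm (cos H - 1) + (1 + norm (cos Z)) * norm (sin H)"
    using norm_sin_le by (intro add_mono mult_right_mono) auto
  finally have 1: "norm (cos (Z + H) - cos Z) \<le> (1 + norm (cos Z)) * (norm (cos H - 1) + norm (sin H))"
    by (simp add: algebra_simps)
  have "fc1 (z + h) - fc1 z = 2 * of_real b * (cos (Z + H) - cos Z)"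
    by (simp add: fc1_def Z_def H_def algebra_simps)
  then have "norm (fc1 (z + h) - fc1 z) = 2 * b * norm (cos (Z + H) - cos Z)"
    using b_pos by (simp add: norm_mult)
  also have "\<dots> \<le> 2 * 1 * ((1 + norm (cos Z)) * (norm (cos H - 1) + norm (sin H)))"
    using 1 b_less_1 b_pos by (intro mult_mono) auto
  finally show ?thesis by (simp only: Z_def H_def mult_1_right mult.assoc)
qed

text \<open>
  On a disc of uniform radius the derivative differs from \<open>fc1 z\<close> by at most half
  its size, so that \<open>fc a\<close> expands distances by at least half of
  \<open>norm (fc1 z)\<close> there and its image contains a disc of uniform radius.
\<close>

lemma uniform_local_inverse:
  assumes "0 < \<delta>"
  shows "\<exists>r>0. \<exists>\<eta>>0. \<exists>\<rho>>0. \<forall>z. \<delta> \<le> infdist (fc a z) (V a) \<longrightarrow>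
    (\<forall>x\<in>ball z r. \<forall>y\<in>ball z r. \<eta> * norm (x - y) \<le> norm (fc a x - fc a y)) \<and>
    ball (fc a z) \<rho> \<subseteq> fc a ` ball z r"
proof -
  obtain \<eta> where \<eta>: "0 < \<eta>" "\<And>z. \<delta> \<le> infdist (fc a z) (V a) \<Longrightarrow> \<eta> * (1 + norm (cos (2 * of_real pi * z))) \<le> norm (fc1 z)"
    using fc1_lower_bound[OF assms] by blast
  have "((\<lambda>h::complex. norm (cos (2 * of_real pi * h) - 1) + norm (sin (2 * of_real pi * h))) \<longlongrightarrow>
      norm (cos (2 * of_real pi * 0 :: complex) - 1) + norm (sin (2 * of_real pi * 0 :: complex))) (at 0)"
    by (intro tendsto_intros)
  then have "((\<lambda>h::complex. norm (cos (2 * of_real pi * h) - 1) + norm (sin (2 * of_real pi * h))) \<longlongrightarrow> 0) (at 0)" by simp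
  from order_tendstoD(2)[OF this, of "\<eta> / 4"] \<eta>(1)
  have ev: "\<forall>\<^sub>F h in at (0::complex). norm (cos (2 * of_real pi * h) - 1) + norm (sin (2 * of_real pi * h)) < \<eta> / 4" by simp
  obtain r where "0 < r \<and> (\<forall>h\<in>(UNIV :: complex set). h \<noteq> 0 \<and> dist h 0 < r \<longrightarrow>
      norm (cos (2 * of_real pi * h) - 1) + norm (sin (2 * of_real pi * h)) < \<eta> / 4)"
    by (rule exE[OF ev[unfolded eventually_at]])
  note r0 = conjunct1[OF this] conjunct2[OF this, rule_format, OF UNIV_I]
  have r1: "norm (cos (2 * of_real pi * h) - 1) + norm (sin (2 * of_real pi * h)) < \<eta> / 4"
    if "h \<noteq> 0" "norm h < r" for h :: complex
    by (rule r0(2)) (use that in simp)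
  note r = r0(1) r1
  have main: "(\<forall>x\<in>ball z r. \<forall>y\<in>ball z r. \<eta> / 2 * norm (x - y) \<le> norm (fc a x - fc a y)) \<and>
    ball (fc a z) (\<eta> * r / 4) \<subseteq> fc a ` ball z r" if z: "\<delta> \<le> infdist (fc a z) (V a)" for z
  proof -
    define D where "D = norm (fc1 z)"
    have D: "\<eta> \<le> D" "\<eta> * (1 + norm (cos (2 * of_real pi * z))) \<le> D"
    proof -
      show 1: "\<eta> * (1 + norm (cos (2 * of_real pi * z))) \<le> D" using \<eta>(2)[OF z] by (simp add: D_def)
      have "\<eta> * 1 \<le> \<eta> * (1 + norm (cos (2 * of_real pi * z)))" using \<eta>(1) by (intro mult_left_mono) auto
      then show "\<eta> \<le> D" using 1 by simp
    qed
    have var: "norm (fc1 u - fc1 z) \<le> D / 2" if u: "u \<in> ball z r" for u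
    proof (cases "u = z")
      case False
      define C where "C = norm (cos (2 * of_real pi * z))"
      define e where "e = norm (cos (2 * of_real pi * (u - z)) - 1) + norm (sin (2 * of_real pi * (u - z)))"
      have "e < \<eta> / 4"
        unfolding e_def using r(2)[of "u - z"] u False by (simp add: dist_norm norm_minus_commute)
      have "norm (fc1 u - fc1 z) \<le> 2 * (1 + C) * e"
        using fc1_variation[of z "u - z"] by (simp add: C_def e_def)
      also have "\<dots> \<le> 2 * (1 + C) * (\<eta> / 4)" using \<open>e < \<eta> / 4\<close> by (intro mult_left_mono) (auto simp: C_def)
      also have "\<dots> = (\<eta> * (1 + C)) / 2" by (simp add: field_simps)
      also have "\<dots> \<le> D / 2" using D(2) by (simp add: C_def)
      finally show ?thesis .
    qed (simp add: D_def)
    have expd: "D / 2 * norm (x - y) \<le> norm (fc a x - fc a y)" if "x \<in> ball z r" "y \<in> ball z r" for x y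
    proof -
      have "norm ((fc a x - fc1 z * x) - (fc a y - fc1 z * y)) \<le> D / 2 * norm (x - y)"
        by (rule field_differentiable_bound[of "ball z r" "\<lambda>u. fc a u - fc1 z * u" "\<lambda>u. fc1 u - fc1 z"])
           (use var that in \<open>auto intro!: derivative_eq_intros DERIV_fc[THEN DERIV_subset]\<close>)
      then have "norm (fc1 z * (x - y) - (fc a x - fc a y)) \<le> D / 2 * norm (x - y)"
        by (simp add: algebra_simps norm_minus_commute)
      moreover have "norm (fc1 z * (x - y)) \<le> norm (fc1 z * (x - y) - (fc a x - fc a y)) + norm (fc a x - fc a y)"
        using norm_triangle_ineq[of "fc1 z * (x - y) - (fc a x - fc a y)" "fc a x - fc a y"] by simp
      ultimately show ?thesis by (simp add: norm_mult D_def)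
    qed
    have "\<eta> / 2 * norm (x - y) \<le> norm (fc a x - fc a y)" if "x \<in> ball z r" "y \<in> ball z r" for x y
      using expd[OF that] mult_right_mono[of "\<eta> / 2" "D / 2" "norm (x - y)"] D(1) by simp
    moreover have "ball (fc a z) (\<eta> * r / 4) \<subseteq> fc a ` ball z (r / 2)"
    proof (rule ball_subset_open_map_image)
      show "continuous_on (closure (ball z (r / 2))) (fc a)"
        using DERIV_fc by (meson DERIV_isCont continuous_at_imp_continuous_on)
      have inj: "inj_on (fc a) (ball z r)"
      proof (rule inj_onI)
        fix x y assume xy: "x \<in> ball z r" "y \<in> ball z r" "fc a x = fc a y"
        then have "D / 2 * norm (x - y) \<le> 0" using expd[OF xy(1,2)] by simp
        moreover have "0 < D" using D(1) \<eta>(1) by simp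
        ultimately show "x = y" by (simp add: mult_le_0_iff)
      qed
      show "open (fc a ` interior (ball z (r / 2)))"
      proof (rule open_mapping_thm3)
        show "fc a holomorphic_on interior (ball z (r / 2))" using holomorphic_funpow_fc[where n = 1] by simp
        show "inj_on (fc a) (interior (ball z (r / 2)))" by (rule inj_on_subset[OF inj]) (use r in auto)
      qed auto
      fix w assume "w \<in> frontier (ball z (r / 2))"
      then have nw: "norm (w - z) = r / 2" and wb: "w \<in> ball z r"
        using r(1) by (auto simp: frontier_ball dist_norm norm_minus_commute)
      have "D / 2 * (r / 2) \<le> norm (fc a w - fc a z)" using expd[OF wb, of z] r(1) unfolding nw by simp
      moreover have "\<eta> * r \<le> D * r" using D(1) r by (intro mult_right_mono) auto
      ultimately show "\<eta> * r / 4 \<le> norm (fc a w - fc a z)" by simp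
    qed (use r \<eta> in auto)
    moreover have "fc a ` ball z (r / 2) \<subseteq> fc a ` ball z r" using r by (intro image_mono) auto
    ultimately show ?thesis by blast
  qed
  show ?thesis
    by (intro exI[of _ r] exI[of _ "\<eta> / 2"] exI[of _ "\<eta> * r / 4"] conjI) (use main r \<eta> in auto)
qed

text \<open>
  The image is open and, by the uniform radius, relatively closed in the connected set
  \<open>- V a\<close>.
\<close>

lemma fc_surj: "fc a ` {z. fc a z \<notin> V a} = - V a" (is "?A = _")
proof -
  have openA: "open ?A"
  proof (subst open_contains_ball, intro ballI)
    fix w assume w: "w \<in> ?A"
    then obtain z where z: "w = fc a z" "fc a z \<notin> V a" by blast
    have "0 < infdist w (V a)" using z closed_V V_nonempty by (simp add: infdist_pos_not_in_closed)
    then obtain r \<rho> where \<rho>: "0 < \<rho>" "ball w \<rho> \<subseteq> fc a ` ball z r"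
      using uniform_local_inverse[of "infdist w (V a)" a] z by blast
    obtain e where e: "0 < e" "ball w e \<subseteq> - V a"
      using closed_V z open_contains_ball[of "- V a"] by (metis ComplI open_Compl)
    have "ball w (min \<rho> e) \<subseteq> ?A"
    proof
      fix u assume "u \<in> ball w (min \<rho> e)"
      then have "u \<in> fc a ` ball z r" "u \<notin> V a" using \<rho> e by auto
      then show "u \<in> ?A" by blast
    qed
    then show "\<exists>e>0. ball w e \<subseteq> ?A" using \<rho> e by (intro exI[of _ "min \<rho> e"]) auto
  qed
  have openB: "open (- V a - ?A)"
  proof (subst open_contains_ball, intro ballI)
    fix w assume w: "w \<in> - V a - ?A"
    define \<delta> where "\<delta> = infdist w (V a) / 2"
    have d: "0 < \<delta>" using w closed_V V_nonempty by (simp add: \<delta>_def infdist_pos_not_in_closed)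
    then obtain r \<rho> where \<rho>0: "0 < \<rho>" "\<And>z. \<delta> \<le> infdist (fc a z) (V a) \<Longrightarrow> ball (fc a z) \<rho> \<subseteq> fc a ` ball z r"
      using uniform_local_inverse[of \<delta> a] by blast
    have \<rho>: "0 < \<rho>" "\<And>z. \<delta> \<le> infdist (fc a z) (V a) \<Longrightarrow> ball (fc a z) \<rho> \<subseteq> range (fc a)"
      using \<rho>0 by blast+
    have "ball w (min \<rho> \<delta>) \<subseteq> - V a - ?A"
    proof
      fix u assume u: "u \<in> ball w (min \<rho> \<delta>)"
      have *: "infdist w (V a) \<le> infdist u (V a) + dist w u" by (rule infdist_triangle)
      then have iu: "\<delta> \<le> infdist u (V a)" using u by (simp add: \<delta>_def)
      then have "u \<notin> V a" using d by auto
      moreover have "u \<notin> ?A"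
      proof
        assume "u \<in> ?A"
        then obtain z where z: "u = fc a z" by blast
        then have "w \<in> range (fc a)" using \<rho>(2)[of z] iu u by (auto simp: dist_commute)
        then show False using w by blast
      qed
      ultimately show "u \<in> - V a - ?A" by blast
    qed
    then show "\<exists>e>0. ball w e \<subseteq> - V a - ?A" using \<rho> d by (intro exI[of _ "min \<rho> \<delta>"]) auto
  qed
  (* The image of fc a contains the uncountable real line, whereas V a is countable. *)
  have "?A \<noteq> {}"
  proof
    assume "?A = {}"
    then have "range (fc a) \<subseteq> V a" by auto
    moreover have "countable (V a)" unfolding V_def by (intro countable_Un countable_image countable_Ints_complex)
    ultimately have "countable (range (fc a))" by (meson countable_subset)
    moreover have "range (\<lambda>x. complex_of_real x) \<subseteq> range (fc a)"
      using lift.F_surj fc_of_real by (metis image_subsetI rangeI)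
    ultimately have "countable (range complex_of_real)" by (rule countable_subset[rotated])
    then have "countable (UNIV :: real set)" by (simp add: countable_image_inj_eq inj_of_real)
    then show False using uncountable_UNIV_real by blast
  qed
  moreover have "?A \<inter> (- V a - ?A) = {}" "- V a \<subseteq> ?A \<union> (- V a - ?A)" by blast+
  moreover have "?A \<subseteq> - V a" by blast
  ultimately have "(- V a - ?A) \<inter> - V a = {}"
    using connectedD[OF connected_Compl_V[of a] openA openB] by blast
  then show ?thesis by blast
qed

text \<open>
  A disc \<open>T\<close> around \<open>w\<close> whose radius \<open>\<tau>\<close> is small
  against the uniform constants is evenly covered: the sheets are the sets \<open>U z\<close> of
  preimages of \<open>T\<close> near a preimage \<open>z\<close>. Two sheets that meet coincide,
  since both lie within one disc of injectivity.
\<close>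

lemma covering_space_fc: "covering_space {z. fc a z \<notin> V a} (fc a) (- V a)"
proof
  show "continuous_on {z. fc a z \<notin> V a} (fc a)"
    using DERIV_fc by (meson DERIV_isCont continuous_at_imp_continuous_on)
  show "fc a ` {z. fc a z \<notin> V a} = - V a" by (rule fc_surj)
  fix w assume w: "w \<in> - V a"
  define \<delta> where "\<delta> = infdist w (V a) / 2"
  have d: "0 < \<delta>" using w closed_V V_nonempty by (simp add: \<delta>_def infdist_pos_not_in_closed)
  obtain r \<eta> \<rho> where r: "0 < r" "0 < \<eta>" "0 < \<rho>"
    and ex: "\<And>z x y. \<delta> \<le> infdist (fc a z) (V a) \<Longrightarrow> x \<in> ball z r \<Longrightarrow> y \<in> ball z r \<Longrightarrow> \<eta> * norm (x - y) \<le> norm (fc a x - fc a y)"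
    and im: "\<And>z. \<delta> \<le> infdist (fc a z) (V a) \<Longrightarrow> ball (fc a z) \<rho> \<subseteq> fc a ` ball z r"
    using uniform_local_inverse[OF d, of a] by meson
  (* The points of a sheet are closer than 2 * \<tau> / \<eta> to its centre, so two sheets that
     meet lie in one disc of injectivity. *)
  define \<tau> where "\<tau> = Min {\<rho> / 2, \<delta>, \<eta> * r / 8}"
  have \<tau>: "0 < \<tau>" "2 * \<tau> \<le> \<rho>" "\<tau> \<le> \<delta>" "8 * \<tau> \<le> \<eta> * r" using r d by (auto simp: \<tau>_def min_def)
  define T where "T = ball w \<tau>"
  have idT: "\<delta> \<le> infdist u (V a)" if "u \<in> T" for u
    using infdist_triangle[of w "V a" u] that \<tau>(3) by (simp add: T_def \<delta>_def)
  have TV: "T \<subseteq> - V a" using idT d by fastforce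
  define U where "U z = ball z r \<inter> fc a -` T" for z
  have cfc: "continuous_on S (fc a)" for S using DERIV_fc by (meson DERIV_isCont continuous_at_imp_continuous_on)
  have opU: "open (U z)" for z
    unfolding U_def T_def by (intro open_Int open_ball open_vimage cfc)
  have dU: "\<eta> * norm (y - z) < 2 * \<tau>" if "fc a z \<in> T" "y \<in> U z" for y z
  proof -
    have "\<eta> * norm (y - z) \<le> norm (fc a y - fc a z)" using ex[OF idT[OF that(1)], of y z] that r by (simp add: U_def)
    also have "\<dots> < 2 * \<tau>"
      using that dist_triangle[of "fc a y" "fc a z" w] by (simp add: U_def T_def dist_norm norm_minus_commute)
    finally show ?thesis .
  qed
  have surjU: "\<exists>x\<in>U z. fc a x = u" if zu: "fc a z \<in> T" "u \<in> T" for z u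
  proof -
    have "u \<in> ball (fc a z) \<rho>"
      using that \<tau>(2) dist_triangle[of "fc a z" u w] by (simp add: T_def dist_commute)
    then obtain x where "x \<in> ball z r" "fc a x = u" using im[OF idT[OF zu(1)]] by blast
    then show ?thesis using zu(2) by (auto simp: U_def)
  qed
  have sub: "U z \<subseteq> U z'" if z: "fc a z \<in> T" "fc a z' \<in> T" and y: "y \<in> U z" "y \<in> U z'" for z z' y
  proof
    fix x assume x: "x \<in> U z"
    then obtain x' where x': "x' \<in> U z'" "fc a x' = fc a x" using surjU[OF z(2), of "fc a x"] by (auto simp: U_def)
    have "norm (x' - z) \<le> norm (x' - z') + norm (y - z') + norm (y - z)"
      using norm_triangle_ineq[of "x' - z'" "z' - z"] norm_triangle_ineq4[of "y - z" "y - z'"] by simp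
    then have "\<eta> * norm (x' - z) \<le> \<eta> * (norm (x' - z') + norm (y - z') + norm (y - z))"
      using r(2) by (intro mult_left_mono) auto
    also have "\<dots> < 8 * \<tau>"
      using dU[OF z(2) x'(1)] dU[OF z(2) y(2)] dU[OF z(1) y(1)] \<tau>(1) by (simp add: distrib_left)
    also have "\<dots> \<le> \<eta> * r" by (rule \<tau>(4))
    finally have "x' \<in> ball z r" using r(2) by (simp add: dist_norm norm_minus_commute)
    then have "\<eta> * norm (x' - x) \<le> norm (fc a x' - fc a x)" using ex[OF idT[OF z(1)], of x' x] x by (simp add: U_def)
    then have "\<eta> * norm (x' - x) \<le> 0" using x'(2) by simp
    then have "x' = x" using r(2) by (simp add: mult_le_0_iff)
    then show "x \<in> U z'" using x' by simp
  qed
  define vv where "vv = U ` {z. fc a z \<in> T}"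
  show "\<exists>T. w \<in> T \<and> openin (top_of_set (- V a)) T \<and>
      (\<exists>v. \<Union>v = {z. fc a z \<notin> V a} \<inter> fc a -` T \<and>
        (\<forall>u\<in>v. openin (top_of_set {z. fc a z \<notin> V a}) u) \<and> pairwise disjnt v \<and>
        (\<forall>u\<in>v. \<exists>q. homeomorphism u T (fc a) q))"
  proof (intro exI[of _ T] exI[of _ vv] conjI ballI)
    show "w \<in> T" using \<tau>(1) by (simp add: T_def)
    show "openin (top_of_set (- V a)) T" using TV by (simp add: T_def open_openin_trans closed_V open_Compl)
    show "\<Union>vv = {z. fc a z \<notin> V a} \<inter> fc a -` T"
      using TV r(1) by (fastforce simp: vv_def U_def)
    show "pairwise disjnt vv"
    proof (rule pairwiseI)
      fix A B assume "A \<in> vv" "B \<in> vv" "A \<noteq> B"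
      then obtain z z' where z: "A = U z" "B = U z'" "fc a z \<in> T" "fc a z' \<in> T" by (auto simp: vv_def)
      show "disjnt A B"
      proof (rule ccontr)
        assume "\<not> disjnt A B"
        then obtain y where "y \<in> U z" "y \<in> U z'" by (auto simp: disjnt_def z)
        then have "A = B" using sub[of z z' y] sub[of z' z y] z by blast
        then show False using \<open>A \<noteq> B\<close> by blast
      qed
    qed
    fix u assume "u \<in> vv"
    then obtain z where z: "u = U z" "fc a z \<in> T" by (auto simp: vv_def)
    have uc: "u \<subseteq> {z. fc a z \<notin> V a}" using TV by (auto simp: z U_def)
    then show "openin (top_of_set {z. fc a z \<notin> V a}) u" using opU[of z] z by (simp add: open_subset)
    have inj: "inj_on (fc a) u"
    proof (rule inj_onI)
      fix x y assume "x \<in> u" "y \<in> u" "fc a x = fc a y"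
      then have "\<eta> * norm (x - y) \<le> 0" using ex[OF idT[OF z(2)], of x y] by (simp add: z U_def)
      then show "x = y" using r(2) by (simp add: mult_le_0_iff)
    qed
    have img: "fc a ` u = T" using surjU[OF z(2)] by (fastforce simp: z U_def)
    obtain g where g: "homeomorphism u (fc a ` u) (fc a) g"
    proof (rule invariance_of_domain_homeomorphism[of u "fc a"])
      show "open u" using opU z by simp
      show "continuous_on u (fc a)" by (rule cfc)
      show "inj_on (fc a) u" by (rule inj)
    qed auto
    then show "\<exists>q. homeomorphism u T (fc a) q" using img by auto
  qed
qed

end

section \<open>Inverse branches and the critical orbit\<close>

text \<open>
  A quantitative form of Montel's theorem: normalizing \<open>p\<close>, \<open>q\<close> to 0, 1
  and the disc to the unit disc, Schottky's theorem bounds the function and Cauchy's inequality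
  its derivative.
\<close>

lemma omitted_values_Lipschitz:
  fixes p q u :: complex
  assumes "p \<noteq> q"
  shows "\<exists>C. \<forall>\<psi> c R. 0 < R \<longrightarrow> \<psi> holomorphic_on ball c R \<longrightarrow> \<psi> c = u \<longrightarrow>
    (\<forall>z\<in>ball c R. \<psi> z \<noteq> p \<and> \<psi> z \<noteq> q) \<longrightarrow>
    (\<forall>z. norm (z - c) \<le> R / 8 \<longrightarrow> norm (\<psi> z - u) \<le> C * (norm (z - c) / R))"
proof -
  define r where "r = norm ((u - p) / (q - p))"
  define B where "B = exp (pi * exp (pi * (2 + 2 * r + 12 * (1/2) / (1 - 1/2))))"
  show ?thesis
  proof (intro exI[of _ "norm (q - p) * (4 * B) * 2"] allI impI)
    fix \<psi> :: "complex \<Rightarrow> complex" and c R z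
    assume R: "0 < R" and hol: "\<psi> holomorphic_on ball c R" and c: "\<psi> c = u"
      and om: "\<forall>z\<in>ball c R. \<psi> z \<noteq> p \<and> \<psi> z \<noteq> q" and z: "norm (z - c) \<le> R / 8"
    define \<phi> where "\<phi> w = (\<psi> (c + of_real (R / 2) * w) - p) / (q - p)" for w
    have inb: "c + of_real (R / 2) * w \<in> ball c R" if "norm w < 2" for w
    proof -
      have "norm (of_real (R / 2) * w) < R" using R that by (simp add: norm_mult)
      then show ?thesis by (simp add: dist_norm)
    qed
    have hol2: "\<phi> holomorphic_on ball 0 2"
    proof -
      have "(\<psi> \<circ> (\<lambda>w. c + of_real (R / 2) * w)) holomorphic_on ball 0 2"
        by (rule holomorphic_on_compose_gen[OF _ hol]) (use inb in \<open>auto intro!: holomorphic_intros\<close>)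
      then have "(\<lambda>w. \<psi> (c + of_real (R / 2) * w)) holomorphic_on ball 0 2" by (simp add: o_def)
      then show ?thesis unfolding \<phi>_def using assms by (intro holomorphic_intros) auto
    qed
    have B: "norm (\<phi> w) \<le> B" if "norm w \<le> 1 / 2" for w
      unfolding B_def
    proof (rule Schottky[of \<phi> r "1/2"])
      show "\<phi> holomorphic_on cball 0 1" by (rule holomorphic_on_subset[OF hol2]) auto
      show "norm (\<phi> 0) \<le> r" by (simp add: \<phi>_def r_def c)
      show "\<not> (\<phi> y = 0 \<or> \<phi> y = 1)" if "y \<in> cball 0 1" for y
        using om[rule_format, OF inb[of y]] that assms by (auto simp: \<phi>_def)
    qed (use that in auto)
    have der: "norm (deriv \<phi> w) \<le> 4 * B" if w: "norm w \<le> 1 / 4" for w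
    proof -
      have sub: "cball w (1/4) \<subseteq> cball 0 (1/2)"
      proof
        fix y assume "y \<in> cball w (1/4)"
        then have "norm (y - w) \<le> 1/4" by (simp add: dist_norm norm_minus_commute)
        then show "y \<in> cball 0 (1/2)" using norm_triangle_ineq[of w "y - w"] w by simp
      qed
      have sub2: "cball w (1/4) \<subseteq> ball 0 2" by (rule subset_trans[OF sub]) auto
      have "norm ((deriv ^^ 1) \<phi> w) \<le> fact 1 * B / (1/4) ^ 1"
      proof (rule Cauchy_inequality)
        show "\<phi> holomorphic_on ball w (1/4)" by (rule holomorphic_on_subset[OF hol2 subset_trans[OF ball_subset_cball sub2]])
        show "continuous_on (cball w (1/4)) \<phi>"
          by (rule continuous_on_subset[OF holomorphic_on_imp_continuous_on[OF hol2] sub2])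
        fix y assume "norm (w - y) = 1/4"
        then show "norm (\<phi> y) \<le> B" using sub by (intro B) (auto simp: dist_norm subset_iff)
      qed auto
      then show ?thesis by simp
    qed
    define w where "w = (z - c) / of_real (R / 2)"
    have w: "norm w = 2 * (norm (z - c) / R)" using R by (simp only: w_def norm_divide norm_of_real) simp
    have "norm (z - c) / R \<le> (R / 8) / R" using z R by (intro divide_right_mono) auto
    then have w4: "norm w \<le> 1 / 4" using w R by simp
    have "norm (\<phi> w - \<phi> 0) \<le> 4 * B * norm (w - 0)"
    proof (rule field_differentiable_bound[of "cball 0 (1/4)" \<phi> "deriv \<phi>"])
      fix y :: complex assume "y \<in> cball 0 (1/4)"
      then show "(\<phi> has_field_derivative deriv \<phi> y) (at y within cball 0 (1/4))"
        by (intro DERIV_subset[OF holomorphic_derivI[OF hol2 open_ball]]) auto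
    qed (use der w4 in auto)
    moreover have "\<phi> w - \<phi> 0 = (\<psi> z - u) / (q - p)"
    proof -
      have "complex_of_real (R / 2) \<noteq> 0" using R by simp
      then have e: "c + of_real (R / 2) * w = z" unfolding w_def by (simp only: times_divide_eq_right nonzero_mult_div_cancel_left) simp
      show ?thesis unfolding \<phi>_def e by (simp add: c flip: diff_divide_distrib)
    qed
    ultimately have "norm (\<psi> z - u) / norm (q - p) \<le> 4 * B * norm w" by (simp add: norm_divide)
    then have "norm (\<psi> z - u) \<le> norm (q - p) * (4 * B * norm w)"
      using assms by (simp add: divide_le_eq mult.commute)
    then show "norm (\<psi> z - u) \<le> norm (q - p) * (4 * B) * 2 * (norm (z - c) / R)"
      by (simp only: w mult_ac)
  qed
qed

context double_standard_family
begin

lemma fc1_nonzero: "fc a z \<notin> V a \<Longrightarrow> fc1 z \<noteq> 0"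
  using critical_value by blast

lemma lift_holomorphic:
  assumes "open U" "continuous_on U g" "\<psi> holomorphic_on U"
    and g: "\<And>z. z \<in> U \<Longrightarrow> fc a (g z) = \<psi> z" "\<And>z. z \<in> U \<Longrightarrow> fc1 (g z) \<noteq> 0"
  shows "g holomorphic_on U"
proof -
  have hfc: "fc a holomorphic_on S" for S using holomorphic_funpow_fc[where n = 1] by simp
  have "g field_differentiable (at z)" if z: "z \<in> U" for z
  proof -
    have "deriv (fc a) (g z) \<noteq> 0" using g(2)[OF z] DERIV_fc DERIV_imp_deriv by metis
    then obtain r where r: "0 < r" "inj_on (fc a) (ball (g z) r)"
      using has_complex_derivative_locally_injective[OF hfc[of UNIV] UNIV_I open_UNIV, of "g z"] by blast
    obtain h where h: "h holomorphic_on (fc a ` ball (g z) r)" "\<And>y. y \<in> ball (g z) r \<Longrightarrow> h (fc a y) = y"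
      using holomorphic_has_inverse[OF hfc open_ball r(2)] by metis
    have opn: "open (fc a ` ball (g z) r)" by (rule open_mapping_thm3[OF hfc open_ball r(2)])
    define W where "W = U \<inter> g -` ball (g z) r"
    have W: "open W" "z \<in> W" using continuous_open_preimage[OF assms(2,1) open_ball, of "g z" r] z r by (auto simp: W_def)
    have "(h \<circ> \<psi>) holomorphic_on W"
    proof (rule holomorphic_on_compose_gen[OF _ h(1)])
      show "\<psi> holomorphic_on W" by (rule holomorphic_on_subset[OF assms(3)]) (auto simp: W_def)
      show "\<psi> ` W \<subseteq> fc a ` ball (g z) r"
      proof
        fix y assume "y \<in> \<psi> ` W"
        then obtain x where "x \<in> W" "y = fc a (g x)" using g(1) by (auto simp: W_def)
        then show "y \<in> fc a ` ball (g z) r" by (auto simp: W_def)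
      qed
    qed
    then have "g holomorphic_on W"
      by (rule holomorphic_transform) (use g(1) h(2) in \<open>force simp: W_def\<close>)
    then show ?thesis using W holomorphic_on_imp_differentiable_at by blast
  qed
  then show ?thesis by (simp add: holomorphic_on_def field_differentiable_at_within)
qed

text \<open>
  A disc that the orbit of the critical value avoids modulo 1 contains, being symmetric, no
  conjugate of such a point either, so that each pullback avoids \<open>V a\<close> and the
  covering lifts it once more. The lift through a real point commutes with conjugation by
  uniqueness, and hence extends the real inverse.
\<close>

lemma inverse_branch:
  assumes "0 < R" and avoid: "\<And>i l. (fc a ^^ i) (v a) + of_int l \<notin> ball (of_real x) R"
  shows "\<exists>\<psi>. \<psi> holomorphic_on ball (of_real x) R \<and>
    (\<forall>z\<in>ball (of_real x) R. (fc a ^^ N) (\<psi> z) = z \<and> \<psi> (cnj z) = cnj (\<psi> z))"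
proof (induction N)
  case 0
  show ?case by (intro exI[of _ "\<lambda>z. z"]) auto
next
  case (Suc N)
  define D where "D = ball (complex_of_real x) R"
  obtain \<psi> where \<psi>: "\<psi> holomorphic_on D" "\<And>z. z \<in> D \<Longrightarrow> (fc a ^^ N) (\<psi> z) = z"
      "\<And>z. z \<in> D \<Longrightarrow> \<psi> (cnj z) = cnj (\<psi> z)"
    using Suc unfolding D_def by blast
  have cnjD: "cnj z \<in> D" if "z \<in> D" for z
  proof -
    have "norm (of_real x - cnj z) = norm (cnj (of_real x - z))" by simp
    then show ?thesis using that by (simp only: D_def mem_ball dist_norm complex_mod_cnj)
  qed
  have xD: "of_real x \<in> D" using \<open>0 < R\<close> by (simp add: D_def)
  have nV: "\<psi> z \<notin> V a" if z: "z \<in> D" for z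
  proof
    assume "\<psi> z \<in> V a"
    then obtain k where k: "\<psi> z = v a + of_int k \<or> \<psi> z = cnj (v a) + of_int k"
      unfolding V_def by (auto elim!: Ints_cases)
    then show False
    proof
      assume "\<psi> z = v a + of_int k"
      then have "z = (fc a ^^ N) (v a) + of_int (2 ^ N * k)" using \<psi>(2)[OF z] funpow_fc_add_int by metis
      then show False using avoid[of N "2 ^ N * k"] z by (simp add: D_def)
    next
      assume "\<psi> z = cnj (v a) + of_int k"
      then have "z = cnj ((fc a ^^ N) (v a)) + of_int (2 ^ N * k)"
        using \<psi>(2)[OF z] funpow_fc_add_int funpow_fc_cnj by metis
      then have "cnj z = (fc a ^^ N) (v a) + of_int (2 ^ N * k)" by simp
      then show False using avoid[of N "2 ^ N * k"] cnjD[OF z] by (simp add: D_def)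
    qed
  qed
  have "\<psi> (of_real x) \<in> \<real>" using \<psi>(3)[OF xD] by (simp add: Reals_cnj_iff)
  then obtain s where s: "\<psi> (of_real x) = of_real s" by (auto elim: Reals_cases)
  obtain t where t: "f a t = s" using lift.F_surj by blast
  have ft: "\<psi> (of_real x) = fc a (of_real t)" by (simp add: s t fc_of_real)
  have tc: "complex_of_real t \<in> {z. fc a z \<notin> V a}" using nV[OF xD] ft by simp
  have cont: "continuous_on D \<psi>" using \<psi>(1) by (rule holomorphic_on_imp_continuous_on)
  have im: "\<psi> \<in> D \<rightarrow> - V a" using nV by auto
  obtain g where g: "continuous_on D g" "g \<in> D \<rightarrow> {z. fc a z \<notin> V a}" "g (of_real x) = of_real t"
      "\<And>z. z \<in> D \<Longrightarrow> fc a (g z) = \<psi> z"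
  proof (rule covering_space_lift_strong[OF covering_space_fc tc xD _ _ cont im ft])
    show "simply_connected D" unfolding D_def by (intro convex_imp_simply_connected convex_ball)
    show "locally path_connected D" unfolding D_def by (intro convex_imp_locally_path_connected convex_ball)
  qed auto
  have gD: "fc a (g z) \<notin> V a" if "z \<in> D" for z using g(2) that by auto
  have "g holomorphic_on D"
  proof (rule lift_holomorphic[OF _ g(1) \<psi>(1)])
    show "open D" by (simp add: D_def)
    show "fc1 (g z) \<noteq> 0" if "z \<in> D" for z using fc1_nonzero[OF gD[OF that]] .
  qed (use g(4) in auto)
  moreover have "(fc a ^^ Suc N) (g z) = z" if "z \<in> D" for z
    using \<psi>(2)[OF that] g(4)[OF that] by (simp add: funpow_swap1)
  moreover have "g (cnj z) = cnj (g z)" if z: "z \<in> D" for z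
  proof -
    define g' where "g' z = cnj (g (cnj z))" for z
    have c': "continuous_on D g'"
      unfolding g'_def by (intro continuous_intros continuous_on_compose2[OF g(1)]) (use cnjD in auto)
    have e': "fc a (g' y) = \<psi> y" if "y \<in> D" for y
      using g(4)[OF cnjD[OF that]] \<psi>(3)[OF that] by (simp add: g'_def fc_cnj)
    have "g z = g' z"
    proof (rule covering_space_lift_unique[OF covering_space_fc, of g "of_real x" g' D \<psi>])
      show "g (of_real x) = g' (of_real x)" by (simp add: g'_def g(3))
      show "g' \<in> D \<rightarrow> {z. fc a z \<notin> V a}" using e' nV by auto
      show "connected D" by (simp add: D_def)
    qed (use cont im g c' e' xD z in auto)
    then show ?thesis by (simp add: g'_def)
  qed
  ultimately show ?case unfolding D_def by blast
qed

text \<open>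
  Let \<open>h = (f a ^^ n) - k\<close>, which fixes \<open>p\<close> and \<open>q\<close>.
  If the critical orbit avoided the disc of radius \<open>r j\<close> about \<open>c j\<close>
  modulo 1, then there would be an inverse branch of the \<open>j\<close>-th iterate of
  \<open>h\<close> on it, which omits \<open>p\<close> and \<open>q\<close> and takes
  \<open>c j\<close> back to \<open>u\<close> and \<open>c' j\<close> back to \<open>u'\<close>.
  Its derivative at \<open>c j\<close> is of the order \<open>1 / r j\<close>, so
  \<open>u\<close> and \<open>u'\<close> would be closer than they are.
\<close>

lemma critical_orbit_enters:
  assumes "0 < n" and p: "(f a ^^ n) p = p + of_int k" and q: "(f a ^^ n) q = q + of_int k" and "p \<noteq> q"
    and "u \<noteq> u'" and r: "\<And>j. 0 < r j"
    and c: "\<And>j. c j = ((\<lambda>x. (f a ^^ n) x - of_int k) ^^ j) u"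
    and c': "\<And>j. c' j = ((\<lambda>x. (f a ^^ n) x - of_int k) ^^ j) u'"
    and away: "\<And>j. r j \<le> \<bar>c j - p\<bar>" "\<And>j. r j \<le> \<bar>c j - q\<bar>"
    and lim: "(\<lambda>j. (c' j - c j) / r j) \<longlonglongrightarrow> 0"
  shows "\<forall>\<^sub>F j in sequentially. \<exists>i l. (fc a ^^ i) (v a) + of_int l \<in> ball (of_real (c j)) (r j)"
proof -
  define h where "h = (\<lambda>x. (f a ^^ n) x - of_int k)"
  have "\<exists>K. \<forall>x. (f a ^^ (n * j)) x = (h ^^ j) x + of_int K" for j
  proof (induction j)
    case (Suc j)
    then obtain K where K: "\<And>x. (f a ^^ (n * j)) x = (h ^^ j) x + of_int K" by blast
    have "(f a ^^ (n * Suc j)) x = (h ^^ Suc j) x + of_int (k + 2 ^ n * K)" for x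
    proof -
      have "(f a ^^ (n * Suc j)) x = (f a ^^ n) ((f a ^^ (n * j)) x)" by (simp add: funpow_add)
      also have "\<dots> = (f a ^^ n) ((h ^^ j) x) + 2 ^ n * of_int K" by (simp only: K lift.funpow_add_int)
      finally show ?thesis by (simp add: h_def)
    qed
    then show ?case by blast
  qed auto
  (* Subtracting k in each step only accumulates integers, to which the critical orbit is
     insensitive. *)
  then obtain K where K: "\<And>j x. (f a ^^ (n * j)) x = (h ^^ j) x + of_int (K j)" by metis
  have hp: "(h ^^ j) p = p" "(h ^^ j) q = q" for j by (induction j) (auto simp: h_def p q)
  obtain C where C: "\<And>\<psi> c R z. 0 < R \<Longrightarrow> \<psi> holomorphic_on ball c R \<Longrightarrow> \<psi> c = of_real u \<Longrightarrow>
    (\<And>z. z \<in> ball c R \<Longrightarrow> \<psi> z \<noteq> of_real p \<and> \<psi> z \<noteq> of_real q) \<Longrightarrow>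
    norm (z - c) \<le> R / 8 \<Longrightarrow> norm (\<psi> z - of_real u) \<le> C * (norm (z - c) / R)"
    using omitted_values_Lipschitz[of "of_real p" "of_real q" "of_real u"] \<open>p \<noteq> q\<close> by (metis of_real_eq_iff)
  define \<epsilon> where "\<epsilon> = min (1/8) (\<bar>u' - u\<bar> / (\<bar>C\<bar> + 1))"
  have "0 < \<epsilon>" using \<open>u \<noteq> u'\<close> by (simp add: \<epsilon>_def)
  from LIMSEQ_D[OF lim this] obtain j0 where j0: "\<And>j. j0 \<le> j \<Longrightarrow> \<bar>c' j - c j\<bar> / r j < \<epsilon>"
    using r by (fastforce simp: abs_div less_imp_le)
  have "\<exists>i l. (fc a ^^ i) (v a) + of_int l \<in> ball (of_real (c j)) (r j)" if j: "j0 \<le> j" for j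
  proof (rule ccontr)
    assume no: "\<not> ?thesis"
    define x where "x = (f a ^^ (n * j)) u"
    define x' where "x' = (f a ^^ (n * j)) u'"
    have x: "x = c j + of_int (K j)" "x' = c' j + of_int (K j)" by (simp_all add: x_def x'_def K c c' h_def)
    have "(fc a ^^ i) (v a) + of_int l \<notin> ball (of_real x) (r j)" for i l
    proof
      assume "(fc a ^^ i) (v a) + of_int l \<in> ball (of_real x) (r j)"
      then have "(fc a ^^ i) (v a) + of_int (l - K j) \<in> ball (of_real (c j)) (r j)"
        by (simp add: x dist_norm algebra_simps)
      then show False using no by blast
    qed
    from inverse_branch[OF r this, of "n * j"] obtain \<psi> where
      \<psi>: "\<psi> holomorphic_on ball (of_real x) (r j)" "\<And>z. z \<in> ball (of_real x) (r j) \<Longrightarrow> (fc a ^^ (n * j)) (\<psi> z) = z"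
        "\<And>z. z \<in> ball (of_real x) (r j) \<Longrightarrow> \<psi> (cnj z) = cnj (\<psi> z)" by blast
    have real: "\<psi> (of_real ((f a ^^ (n * j)) t)) = of_real t" if "\<bar>(f a ^^ (n * j)) t - x\<bar> < r j" for t
    proof -
      have b: "of_real ((f a ^^ (n * j)) t) \<in> ball (complex_of_real x) (r j)"
        using that by (simp add: dist_norm abs_minus_commute flip: of_real_diff)
      have "\<psi> (of_real ((f a ^^ (n * j)) t)) \<in> \<real>" using \<psi>(3)[OF b] by (simp add: Reals_cnj_iff)
      then obtain s where s: "\<psi> (of_real ((f a ^^ (n * j)) t)) = of_real s" by (auto elim: Reals_cases)
      then have "complex_of_real ((f a ^^ (n * j)) s) = of_real ((f a ^^ (n * j)) t)"
        using \<psi>(2)[OF b] by (simp add: funpow_fc_of_real)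
      then have "s = t" by (simp only: of_real_eq_iff lift.funpow_eq_iff)
      then show ?thesis using s by simp
    qed
    have small: "\<bar>x' - x\<bar> / r j < \<epsilon>" using j0[OF j] by (simp add: x)
    then have "\<bar>x' - x\<bar> < \<epsilon> * r j" using r[of j] by (simp add: divide_less_eq)
    moreover have "\<epsilon> \<le> 1/8" unfolding \<epsilon>_def by (rule min.cobounded1)
    then have "\<epsilon> * r j \<le> 1/8 * r j" using r[of j] by (intro mult_right_mono) auto
    ultimately have x8: "\<bar>x' - x\<bar> \<le> r j / 8" by simp
    have fixed: "\<psi> z \<noteq> of_real t" if z: "z \<in> ball (of_real x) (r j)" and t: "(h ^^ j) t = t" "r j \<le> \<bar>c j - t\<bar>" for z t
    proof
      assume "\<psi> z = of_real t"
      then have "z = of_real ((f a ^^ (n * j)) t)" using \<psi>(2)[OF z] by (simp add: funpow_fc_of_real)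
      then have "z = of_real (t + of_int (K j))" by (simp add: K t)
      then have "\<bar>x - (t + of_int (K j))\<bar> < r j" using z by (simp only: mem_ball dist_norm norm_of_real flip: of_real_diff)
      then show False using t(2) by (simp add: x)
    qed
    have "norm (\<psi> (of_real x') - of_real u) \<le> C * (norm (complex_of_real x' - of_real x) / r j)"
    proof (rule C[OF r \<psi>(1)])
      show "\<psi> (of_real x) = of_real u" using real[of u] r by (simp add: x_def)
      show "norm (complex_of_real x' - of_real x) \<le> r j / 8" using x8 by (simp flip: of_real_diff)
      show "\<psi> z \<noteq> of_real p \<and> \<psi> z \<noteq> of_real q" if "z \<in> ball (of_real x) (r j)" for z
        using fixed[OF that] hp away by blast
    qed
    moreover have "\<psi> (of_real x') = of_real u'" using real[of u'] x8 r[of j] by (simp add: x'_def)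
    ultimately have "\<bar>u' - u\<bar> \<le> C * (\<bar>x' - x\<bar> / r j)" by (simp flip: of_real_diff)
    also have "\<dots> \<le> \<bar>C\<bar> * (\<bar>x' - x\<bar> / r j)" using r[of j] by (intro mult_right_mono) auto
    also have "\<dots> \<le> \<bar>C\<bar> * \<epsilon>" using small by (intro mult_left_mono) auto
    also have "\<dots> < (\<bar>C\<bar> + 1) * \<epsilon>" using \<open>0 < \<epsilon>\<close> by simp
    also have "\<dots> \<le> (\<bar>C\<bar> + 1) * (\<bar>u' - u\<bar> / (\<bar>C\<bar> + 1))" by (intro mult_left_mono) (auto simp: \<epsilon>_def)
    also have "\<dots> = \<bar>u' - u\<bar>" by (simp add: add_nonneg_eq_0_iff)
    finally show False by simp
  qed
  then show ?thesis by (intro eventually_sequentiallyI)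
qed

end

section \<open>Periodic points capture the critical orbit\<close>

text \<open>
  The attracting petal of a parabolic germ, in the crude form of a narrow sector about the real
  axis. For \<open>u = x * (1 + \<i> * \<tau>)\<close> the leading term of
  \<open>u ^ Suc d * e u\<close> is
  \<open>c * x ^ Suc d * (1 + \<i> * D * \<tau>)\<close> with
  \<open>D = Suc d \<ge> 2\<close>: the slope \<open>\<tau>\<close> of the subtracted vector
  is multiplied by \<open>D\<close>, which turns \<open>u\<close> towards the axis, and the errors
  are smaller than this effect on the boundary of the sector.
\<close>

lemma parabolic_sector:
  fixes e :: "complex \<Rightarrow> complex"
  assumes "0 < d" "0 < c" and e: "isCont e 0" "e 0 = of_real c"
  obtains \<kappa> \<rho> :: real where "0 < \<kappa>" "\<kappa> \<le> 1" "0 < \<rho>"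
    "\<And>u u'. 0 < Re u \<Longrightarrow> Re u < \<rho> \<Longrightarrow> \<bar>Im u\<bar> \<le> \<kappa> * Re u \<Longrightarrow> u' = u - u ^ Suc d * e u \<Longrightarrow>
      0 < Re u' \<and> \<bar>Im u'\<bar> \<le> \<kappa> * Re u' \<and> Re u' \<le> Re u - c / 2 * Re u ^ Suc d"
proof -
  define D where "D = real (Suc d)"
  have D2: "2 \<le> D" using \<open>0 < d\<close> by (simp add: D_def)
  have "((\<lambda>z::complex. (1 + z) ^ Suc d) has_field_derivative of_nat (Suc d)) (at 0)"
    by (auto intro!: derivative_eq_intros)
  then have "((\<lambda>h::complex. ((1 + h) ^ Suc d - 1) / h) \<longlongrightarrow> of_nat (Suc d)) (at 0)"
    by (simp add: DERIV_def)
  from tendstoD[OF this, of "1/8"] obtain s where s: "0 < s"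
    "\<And>h::complex. h \<noteq> 0 \<Longrightarrow> norm h < s \<Longrightarrow> norm (((1 + h) ^ Suc d - 1) / h - of_nat (Suc d)) < 1/8"
    unfolding eventually_at dist_norm by auto
  define \<kappa> where "\<kappa> = min (s / 2) (1 / (2 * D))"
  have \<kappa>: "0 < \<kappa>" "\<kappa> \<le> 1/4" "\<kappa> < s" "D * \<kappa> \<le> 1/2"
  proof -
    show "0 < \<kappa>" "\<kappa> < s" using s(1) D2 by (auto simp: \<kappa>_def min_def)
    have le: "\<kappa> \<le> 1 / (2 * D)" unfolding \<kappa>_def by (rule min.cobounded2)
    have "1 / (2 * D) \<le> 1 / 4" using D2 by (intro divide_left_mono) auto
    then show "\<kappa> \<le> 1/4" using le by linarith
    show "D * \<kappa> \<le> 1/2" using mult_left_mono[OF le, of D] D2 by simp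
  qed
  have pw: "norm ((1 + h) ^ Suc d - 1 - of_nat (Suc d) * h) \<le> \<kappa> / 8" if "norm h \<le> \<kappa>" for h :: complex
  proof (cases "h = 0")
    case False
    have "(1 + h) ^ Suc d - 1 - of_nat (Suc d) * h = (((1 + h) ^ Suc d - 1) / h - of_nat (Suc d)) * h"
    proof -
      have "(A - 1) / h * h = A - 1" for A using False by simp
      then show ?thesis by (simp only: left_diff_distrib[of "_ / _"])
    qed
    then have "norm ((1 + h) ^ Suc d - 1 - of_nat (Suc d) * h) = norm (((1 + h) ^ Suc d - 1) / h - of_nat (Suc d)) * norm h"
      by (simp only: norm_mult)
    also have "\<dots> \<le> 1/8 * \<kappa>" using s(2)[of h] False that \<kappa> by (intro mult_mono) auto
    finally show ?thesis by simp
  qed (use \<kappa> in simp)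
  have "((\<lambda>u. e u / of_real c) \<longlongrightarrow> e 0 / of_real c) (at 0)"
    using e(1) \<open>0 < c\<close> by (intro tendsto_divide tendsto_const) (auto simp: isCont_def)
  then have "((\<lambda>u. e u / of_real c) \<longlongrightarrow> 1) (at 0)" using e(2) \<open>0 < c\<close> by simp
  from tendstoD[OF this, of "\<kappa> / 16"] \<kappa>(1) obtain t where t: "0 < t"
    "\<And>u. u \<noteq> 0 \<Longrightarrow> norm u < t \<Longrightarrow> norm (e u / of_real c - 1) < \<kappa> / 16"
    unfolding eventually_at dist_norm by auto
  define \<rho> where "\<rho> = Min {t / 2, 1, 1 / (D * c)}"
  have \<rho>: "0 < \<rho>" "2 * \<rho> \<le> t" "\<rho> \<le> 1" "D * c * \<rho> \<le> 1"
  proof -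
    show "0 < \<rho>" using t(1) D2 \<open>0 < c\<close> by (auto simp: \<rho>_def)
    have "\<rho> \<le> t / 2" "\<rho> \<le> 1" and 3: "\<rho> \<le> 1 / (D * c)" unfolding \<rho>_def by (auto intro: Min_le)
    then show "2 * \<rho> \<le> t" "\<rho> \<le> 1" by auto
    show "D * c * \<rho> \<le> 1" using mult_left_mono[OF 3, of "D * c"] D2 \<open>0 < c\<close> by simp
  qed
  show ?thesis
  proof
    fix u u' assume u: "0 < Re u" "Re u < \<rho>" "\<bar>Im u\<bar> \<le> \<kappa> * Re u" "u' = u - u ^ Suc d * e u"
    define x where "x = Re u"
    define \<tau> where "\<tau> = Im u / x"
    have x: "0 < x" "x < \<rho>" using u by (auto simp: x_def)
    have \<tau>: "\<bar>\<tau>\<bar> \<le> \<kappa>" using u x by (simp add: \<tau>_def x_def abs_div divide_le_eq)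
    have ux: "u = of_real x * (1 + \<i> * of_real \<tau>)" using x by (simp add: complex_eq_iff x_def \<tau>_def)
    define q where "q = (1 + \<i> * of_real \<tau>) ^ Suc d"
    define \<epsilon> where "\<epsilon> = e u / of_real c - 1"
    define E where "E = q * (1 + \<epsilon>) - 1 - \<i> * of_real (D * \<tau>)"
    have q1: "norm (q - 1 - of_nat (Suc d) * (\<i> * of_real \<tau>)) \<le> \<kappa> / 8"
      unfolding q_def by (rule pw) (use \<tau> in \<open>simp add: norm_mult\<close>)
    have nq: "norm q \<le> 2"
    proof -
      have "norm (of_nat (Suc d) * (\<i> * complex_of_real \<tau>)) = D * \<bar>\<tau>\<bar>" by (simp add: norm_mult D_def del: of_nat_Suc)
      also have "\<dots> \<le> D * \<kappa>" using \<tau> D2 by (intro mult_left_mono) auto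
      finally have "norm (of_nat (Suc d) * (\<i> * complex_of_real \<tau>)) \<le> 1/2" using \<kappa>(4) by simp
      moreover have "norm q \<le> norm (q - 1 - of_nat (Suc d) * (\<i> * of_real \<tau>)) + norm (1 + of_nat (Suc d) * (\<i> * complex_of_real \<tau>))"
        using norm_triangle_ineq[of "q - 1 - of_nat (Suc d) * (\<i> * of_real \<tau>)" "1 + of_nat (Suc d) * (\<i> * complex_of_real \<tau>)"] by (simp only: diff_diff_eq diff_add_cancel)
      moreover have "norm (1 + of_nat (Suc d) * (\<i> * complex_of_real \<tau>)) \<le> 1 + norm (of_nat (Suc d) * (\<i> * complex_of_real \<tau>))"
        using norm_triangle_ineq[of 1] by (metis norm_one)
      ultimately show ?thesis using q1 \<kappa>(2) by linarith
    qed
    have "u \<noteq> 0" "norm u < t"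
    proof -
      show "u \<noteq> 0" using u(1) by auto
      have "\<bar>Im u\<bar> \<le> 1 * Re u" using u(1,3) \<kappa>(2) mult_right_mono[of \<kappa> 1 "Re u"] by linarith
      then show "norm u < t" using cmod_le[of u] u(1,2) \<rho>(2) by linarith
    qed
    then have n\<epsilon>: "norm \<epsilon> \<le> \<kappa> / 16" using t(2)[of u] by (simp add: \<epsilon>_def)
    have nE: "norm E \<le> \<kappa> / 4"
    proof -
      have "E = (q - 1 - of_nat (Suc d) * (\<i> * of_real \<tau>)) + q * \<epsilon>" by (simp add: E_def D_def algebra_simps)
      then have "norm E \<le> norm (q - 1 - of_nat (Suc d) * (\<i> * of_real \<tau>)) + norm q * norm \<epsilon>"
        by (metis norm_mult norm_triangle_ineq)
      moreover have "norm q * norm \<epsilon> \<le> 2 * (\<kappa> / 16)" using nq n\<epsilon> by (intro mult_mono) auto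
      ultimately show ?thesis using q1 by linarith
    qed
    define R I where "R = Re E" and "I = Im E"
    have RI: "\<bar>R\<bar> \<le> \<kappa> / 4" "\<bar>I\<bar> \<le> \<kappa> / 4"
      using abs_Re_le_cmod[of E] abs_Im_le_cmod[of E] nE by (auto simp: R_def I_def)
    define X where "X = c * x ^ Suc d"
    have Xpos: "0 < X" using x \<open>0 < c\<close> by (simp add: X_def)
    have DX: "D * X \<le> x"
    proof -
      have "x ^ d \<le> x ^ 1" using x \<rho>(3) \<open>0 < d\<close> by (intro power_decreasing) auto
      then have "D * c * x ^ d \<le> D * c * \<rho>" using x D2 \<open>0 < c\<close> by (intro mult_left_mono) auto
      then have "D * c * x ^ d \<le> 1" using \<rho>(4) by simp
      from mult_right_mono[OF this, of x] show ?thesis using x by (simp add: X_def mult_ac)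
    qed
    have "u ^ Suc d * e u = of_real X * (q * (1 + \<epsilon>))"
    proof -
      have "e u = of_real c * (1 + \<epsilon>)" using \<open>0 < c\<close> by (simp add: \<epsilon>_def)
      moreover have "u ^ Suc d = of_real (x ^ Suc d) * q" unfolding ux q_def power_mult_distrib by simp
      ultimately show ?thesis by (simp add: X_def mult_ac)
    qed
    also have "q * (1 + \<epsilon>) = 1 + \<i> * of_real (D * \<tau>) + E" by (simp add: E_def)
    finally have u': "u' = of_real x * (1 + \<i> * of_real \<tau>) - of_real X * (1 + \<i> * of_real (D * \<tau>) + E)"
      using u(4) ux by simp
    have Re': "Re u' = x - X * (1 + R)" and Im': "Im u' = x * \<tau> - X * (D * \<tau> + I)"
      unfolding u' by (simp_all add: R_def I_def)
    have XR: "X * (1 + R) \<le> X * (5/4)" "X * (1/2) \<le> X * (1 + R)"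
      using RI(1) \<kappa>(2) Xpos by (intro mult_left_mono; linarith)+
    have XD: "2 * X \<le> D * X" using D2 Xpos by (intro mult_right_mono) auto
    have r1: "0 < Re u'" unfolding Re' using XR(1) XD DX Xpos by linarith
    have r2: "Re u' \<le> x - X / 2" unfolding Re' using XR(2) by linarith
    have key: "0 \<le> (x - D * X) * \<delta> + X * ((D - 1) * \<kappa> - \<kappa> * R + j)" if "0 \<le> \<delta>" "\<bar>j\<bar> \<le> \<kappa> / 4" for \<delta> j
    proof -
      have "\<kappa> * R \<le> \<kappa> * \<bar>R\<bar>" using \<kappa>(1) by (intro mult_left_mono) auto
      also have "\<dots> \<le> 1 * (\<kappa> / 4)" using RI(1) \<kappa>(1,2) by (intro mult_mono) auto
      finally have "\<kappa> * R \<le> \<kappa> / 4" by simp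
      moreover have "1 * \<kappa> \<le> (D - 1) * \<kappa>" using D2 \<kappa> by (intro mult_right_mono) auto
      ultimately have "0 \<le> (D - 1) * \<kappa> - \<kappa> * R + j" using that(2) \<kappa>(1) by linarith
      then show ?thesis using DX Xpos that(1)
        mult_nonneg_nonneg[of "x - D * X" \<delta>] mult_nonneg_nonneg[of X "(D - 1) * \<kappa> - \<kappa> * R + j"] by linarith
    qed
    have "\<kappa> * Re u' - Im u' = (x - D * X) * (\<kappa> - \<tau>) + X * ((D - 1) * \<kappa> - \<kappa> * R + I)"
      unfolding Re' Im' by (simp add: algebra_simps)
    moreover have "\<kappa> * Re u' + Im u' = (x - D * X) * (\<kappa> + \<tau>) + X * ((D - 1) * \<kappa> - \<kappa> * R + - I)"
      unfolding Re' Im' by (simp add: algebra_simps)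
    moreover have "0 \<le> (x - D * X) * (\<kappa> - \<tau>) + X * ((D - 1) * \<kappa> - \<kappa> * R + I)"
      using \<tau> RI by (intro key) auto
    moreover have "0 \<le> (x - D * X) * (\<kappa> + \<tau>) + X * ((D - 1) * \<kappa> - \<kappa> * R + - I)"
      using \<tau> RI by (intro key) auto
    ultimately have "\<bar>Im u'\<bar> \<le> \<kappa> * Re u'" by linarith
    then show "0 < Re u' \<and> \<bar>Im u'\<bar> \<le> \<kappa> * Re u' \<and> Re u' \<le> Re u - c / 2 * Re u ^ Suc d"
      using r1 r2 by (simp add: X_def x_def)
  qed (use \<kappa> \<rho> in auto)
qed

lemma decreasing_to_0:
  fixes x :: "nat \<Rightarrow> real"
  assumes pos: "\<And>j. 0 < x j" and dec: "\<And>j. x (Suc j) \<le> x j - g (x j)"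
    and g: "\<And>y z. 0 < y \<Longrightarrow> y \<le> z \<Longrightarrow> z \<le> x 0 \<Longrightarrow> g y \<le> g z" "\<And>y. 0 < y \<Longrightarrow> y \<le> x 0 \<Longrightarrow> 0 < g y"
  shows "x \<longlonglongrightarrow> 0"
proof -
  have le0: "x j \<le> x 0" for j
  proof (induction j)
    case (Suc j) then show ?case using dec[of j] g(2)[OF pos[of j] Suc] by linarith
  qed simp
  have decs: "decseq x"
    by (rule decseq_SucI) (metis dec g(2) le0 pos less_imp_le order_trans diff_le_self le_diff_eq add_increasing2 diff_ge_0_iff_ge le_add_same_cancel1)
  obtain L where L: "x \<longlonglongrightarrow> L" "\<And>j. L \<le> x j" using decseq_convergent[OF decs, of 0] pos less_imp_le by metis
  have "0 \<le> L" by (rule LIMSEQ_le_const[OF L(1)]) (use pos less_imp_le in blast)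
  have "L = 0"
  proof (rule ccontr)
    assume "L \<noteq> 0"
    then have Lpos: "0 < L" using \<open>0 \<le> L\<close> by simp
    have "x (Suc j) \<le> x j - g L" for j using dec[of j] g(1)[OF Lpos L(2) le0, of j] by linarith
    then have "L \<le> L - g L"
      by (intro LIMSEQ_le[OF LIMSEQ_Suc[OF L(1)] tendsto_diff[OF L(1) tendsto_const]]) blast
    moreover have "0 < g L" using Lpos L(2) by (intro g(2)) auto
    ultimately show False by simp
  qed
  then show ?thesis using L(1) by simp
qed

lemma integer_translates_isolated:
  fixes z p :: complex
  shows "\<exists>\<eta>>0. \<forall>l::int. norm (z + of_int l - p) < \<eta> \<longrightarrow> z + of_int l = p"
proof -
  have "\<not> p islimpt (\<lambda>m. z + m) ` \<int>"
  proof
    assume "p islimpt (\<lambda>m. z + m) ` \<int>"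
    then obtain y where y: "y \<in> (\<lambda>m. z + m) ` \<int>" "y \<noteq> p" "dist y p < 1/2" unfolding islimpt_approachable by (metis half_gt_zero zero_less_one)
    then have "0 < dist y p" by simp
    with \<open>p islimpt _\<close> obtain y' where y': "y' \<in> (\<lambda>m. z + m) ` \<int>" "y' \<noteq> p" "dist y' p < dist y p" unfolding islimpt_approachable by metis
    obtain m m' where m: "y = z + of_int m" "y' = z + of_int m'" using y(1) y'(1) by (auto elim!: Ints_cases)
    have "dist y y' < 1" using dist_triangle[of y y' p] y(3) y'(3) by (simp add: dist_commute)
    then have "norm (complex_of_real (of_int (m - m'))) < 1" by (simp add: m dist_norm)
    then have "\<bar>real_of_int (m - m')\<bar> < 1" by (simp only: norm_of_real)
    then have "m = m'" by linarith
    then show False using y'(3) by (simp add: m)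
  qed
  then obtain \<eta> where "0 < \<eta>" "\<And>y. y \<in> (\<lambda>m. z + m) ` \<int> \<Longrightarrow> y \<noteq> p \<Longrightarrow> \<not> dist y p < \<eta>"
    unfolding islimpt_approachable by blast
  then have \<eta>: "0 < \<eta>" "\<And>m. m \<in> \<int> \<Longrightarrow> norm (z + m - p) < \<eta> \<Longrightarrow> z + m = p" by (auto simp: dist_norm)
  show ?thesis using \<eta>(1) by (intro exI[of _ \<eta>] conjI allI impI \<eta>(2)) auto
qed

context double_standard_family
begin

text \<open>
  The neutral periodic point \<open>p\<close> attracts from the right if
  \<open>\<sigma> = 1\<close> and from the left if \<open>\<sigma> = - 1\<close>;
  \<open>x\<close> is the distance from \<open>p\<close> on that side.
\<close>

definition side_attracting :: "real \<Rightarrow> real \<Rightarrow> nat \<Rightarrow> int \<Rightarrow> real \<Rightarrow> bool"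
  where "side_attracting \<sigma> a n k p \<longleftrightarrow> 0 < n \<and> (f a ^^ n) p = p + of_int k \<and> P a n p = 1 \<and>
    (\<exists>\<delta>>0. \<forall>x. 0 < x \<and> x < \<delta> \<longrightarrow> \<sigma> * ((f a ^^ n) (p + \<sigma> * x) - of_int k - p) < x)"

text \<open>
  Far away the degree makes \<open>F ^^ n\<close> exceed the diagonal. The second fixed point is
  an omitted value for \<open>critical_orbit_enters\<close>.
\<close>

lemma fixed_point_beyond:
  assumes n: "0 < n" and \<sigma>: "\<sigma> = 1 \<or> \<sigma> = - 1" and x0: "\<sigma> * ((f a ^^ n) (p + \<sigma> * x0) - of_int k - p) < x0"
  shows "\<exists>y>x0. (f a ^^ n) (p + \<sigma> * y) = p + \<sigma> * y + of_int k"
proof -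
  have ss: "\<sigma> * \<sigma> = 1" "\<sigma> * (\<sigma> * x) = x" for x using \<sigma> by auto
  define H where "H x = \<sigma> * ((f a ^^ n) (p + \<sigma> * x) - of_int k - p)" for x
  define m where "m = nat \<lceil>x0 - H x0\<rceil> + 1"
  have m: "x0 - H x0 \<le> real m" unfolding m_def by linarith
  have "\<exists>i::int. \<sigma> * real m = of_int i \<and> \<sigma> * of_int i = real m"
    using \<sigma> by (auto intro: exI[of _ "int m"] exI[of _ "- int m"])
  then obtain i :: int where i: "\<sigma> * real m = of_int i" "\<sigma> * of_int i = real m" by blast
  have "H (x0 + real m) = \<sigma> * ((f a ^^ n) (p + \<sigma> * x0 + of_int i) - of_int k - p)"
    by (simp add: H_def distrib_left i add.assoc)
  also have "\<dots> = H x0 + 2 ^ n * real m"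
    unfolding lift.funpow_add_int by (simp add: H_def algebra_simps flip: i(2))
  finally have "H (x0 + real m) = H x0 + 2 ^ n * real m" .
  moreover have "2 * real m \<le> 2 ^ n * real m"
    using n power_increasing[of 1 n "2::real"] by (intro mult_right_mono) auto
  ultimately have "0 \<le> H (x0 + real m) - (x0 + real m)" using m by linarith
  moreover have "H x0 - x0 \<le> 0" using x0 by (simp add: H_def)
  moreover have "continuous_on S H" for S
    unfolding H_def by (intro continuous_intros continuous_on_compose2[OF lift.continuous_on_funpow[of UNIV]]) auto
  ultimately have "\<exists>y\<ge>x0. y \<le> x0 + real m \<and> H y - y = 0"
    by (intro IVT' continuous_intros) auto
  then obtain y where y: "x0 \<le> y" "H y = y" by auto
  moreover have "y \<noteq> x0" using x0 y by (auto simp: H_def)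
  moreover have "\<sigma> * H y = (f a ^^ n) (p + \<sigma> * y) - of_int k - p" by (simp add: H_def ss)
  ultimately show ?thesis by (intro exI[of _ y]) auto
qed

text \<open>
  Apply \<open>critical_orbit_enters\<close> to the orbit \<open>p + \<sigma> * x j\<close>
  that tends to \<open>p\<close> and to its shift by one step. Since the multiplier is 1,
  \<open>x (Suc j) - x j\<close> is small against \<open>x j\<close>, so that discs of
  radius \<open>\<epsilon> * x j\<close> are large enough to be entered and small enough to lie
  in the sector.
\<close>

lemma enters_side:
  assumes sa: "side_attracting \<sigma> a n k p" and \<sigma>: "\<sigma> = 1 \<or> \<sigma> = - 1" and "0 < \<rho>" "0 < \<kappa>" "\<kappa> \<le> 1"
  shows "\<exists>i l. norm ((fc a ^^ i) (v a) + of_int l - of_real p) < \<rho> \<and>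
      0 < \<sigma> * Re ((fc a ^^ i) (v a) + of_int l - of_real p) \<and>
      \<bar>Im ((fc a ^^ i) (v a) + of_int l - of_real p)\<bar> \<le> \<kappa> * (\<sigma> * Re ((fc a ^^ i) (v a) + of_int l - of_real p))"
proof -
  have n: "0 < n" and p: "(f a ^^ n) p = p + of_int k" and P1: "P a n p = 1" using sa by (auto simp: side_attracting_def)
  obtain \<delta> where \<delta>: "0 < \<delta>" "\<And>x. 0 < x \<Longrightarrow> x < \<delta> \<Longrightarrow> \<sigma> * ((f a ^^ n) (p + \<sigma> * x) - of_int k - p) < x"
    using sa by (auto simp: side_attracting_def)
  have ss: "\<sigma> * \<sigma> = 1" "\<sigma> * (\<sigma> * x) = x" "\<bar>\<sigma>\<bar> = 1" for x using \<sigma> by auto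
  define h where "h = (\<lambda>x. (f a ^^ n) x - of_int k)"
  define H where "H x = \<sigma> * (h (p + \<sigma> * x) - p)" for x
  have hH: "h (p + \<sigma> * x) = p + \<sigma> * H x" for x by (simp add: H_def ss)
  have H0: "H 0 = 0" by (simp add: H_def h_def p)
  have Hmono: "H x < H y" if "x < y" for x y
    using \<sigma> that lift.funpow_less_iff[of n a "p + x" "p + y"] lift.funpow_less_iff[of n a "p - y" "p - x"]
    by (auto simp: H_def h_def)
  have Hlt: "H x < x" if "0 < x" "x < \<delta>" for x using \<delta>(2)[OF that] by (simp add: H_def h_def)
  define x0 where "x0 = min (\<delta> / 2) (\<rho> / 2)"
  have x0: "0 < x0" "x0 < \<delta>" "2 * x0 \<le> \<rho>" using \<delta>(1) \<open>0 < \<rho>\<close> by (auto simp: x0_def)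
  define x where "x j = (H ^^ j) x0" for j
  have xS: "x (Suc j) = H (x j)" for j by (simp add: x_def)
  have x: "0 < x j \<and> x j \<le> x0" for j
  proof (induction j)
    case (Suc j)
    then show ?case using Hlt[of "x j"] Hmono[of 0 "x j"] x0 H0 by (simp add: xS)
  qed (use x0 in \<open>simp add: x_def\<close>)
  have contH: "continuous_on S H" for S
    unfolding H_def h_def by (intro continuous_intros continuous_on_compose2[OF lift.continuous_on_funpow[of UNIV]]) auto
  have "x \<longlonglongrightarrow> 0"
  proof -
    have dec: "x (Suc j) \<le> x j" for j using Hlt[of "x j"] x[of j] x0 by (simp add: xS)
    then have "decseq x" by (rule decseq_SucI)
    then obtain L where L: "x \<longlonglongrightarrow> L" "\<And>j. L \<le> x j"
      using decseq_convergent[of x 0] x less_imp_le by metis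
    have "0 \<le> L" by (rule LIMSEQ_le_const[OF L(1)]) (use x less_imp_le in blast)
    have "L \<le> x0" using L(2)[of 0] x[of 0] by linarith
    have "(\<lambda>j. H (x j)) \<longlonglongrightarrow> H L"
      using contH[of UNIV] L(1) by (auto simp: continuous_on_eq_continuous_at intro: isCont_tendsto_compose)
    moreover have "(\<lambda>j. H (x j)) \<longlonglongrightarrow> L" using LIMSEQ_Suc[OF L(1)] by (simp add: xS)
    ultimately have "H L = L" by (rule LIMSEQ_unique)
    then have "L = 0" using Hlt[of L] \<open>0 \<le> L\<close> \<open>L \<le> x0\<close> x0 by (cases "L = 0") auto
    then show ?thesis using L(1) by simp
  qed
  have "\<sigma> * ((f a ^^ n) (p + \<sigma> * x0) - of_int k - p) < x0" using \<delta>(2) x0 by blast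
  from fixed_point_beyond[OF n \<sigma> this] obtain y where y: "x0 < y" "(f a ^^ n) (p + \<sigma> * y) = p + \<sigma> * y + of_int k" by blast
  (* The first two bounds put the discs into the sector, the third keeps them away from the fixed
     point beyond x0. *)
  define \<epsilon> where "\<epsilon> = Min {\<kappa> / 4, 1/4, (y - x0) / x0}"
  have \<epsilon>: "0 < \<epsilon>" "\<epsilon> \<le> \<kappa> / 4" "\<epsilon> \<le> 1/4" "\<epsilon> * x0 \<le> y - x0"
  proof -
    show "0 < \<epsilon>" using \<open>0 < \<kappa>\<close> y x0 by (auto simp: \<epsilon>_def)
    have "\<epsilon> \<le> (y - x0) / x0" unfolding \<epsilon>_def by (auto intro: Min_le)
    then show "\<epsilon> * x0 \<le> y - x0" using x0 by (simp add: pos_le_divide_eq)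
    show "\<epsilon> \<le> \<kappa> / 4" unfolding \<epsilon>_def by (rule Min_le) auto
    show "\<epsilon> \<le> 1/4" unfolding \<epsilon>_def by (rule Min_le) auto
  qed
  have hj: "(h ^^ j) (p + \<sigma> * t) = p + \<sigma> * (H ^^ j) t" for j t
    by (induction j) (simp_all add: hH)
  have slope: "(\<lambda>j. (x (Suc j) - x j) / x j) \<longlonglongrightarrow> 0"
  proof -
    have "(H has_real_derivative 1) (at 0)"
    proof -
      have "(H has_real_derivative \<sigma> * (P a n (p + \<sigma> * 0) * \<sigma> - 0 - 0)) (at 0)"
        unfolding H_def h_def
        by (intro DERIV_cmult DERIV_diff DERIV_const DERIV_chain2[OF lift.DERIV_funpow]) (auto intro!: derivative_eq_intros)
      then show ?thesis using ss P1 by simp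
    qed
    then have "((\<lambda>t. H t / t) \<longlongrightarrow> 1) (at 0)" by (simp add: DERIV_def H0)
    moreover have "filterlim x (at 0) sequentially"
      using \<open>x \<longlonglongrightarrow> 0\<close> x by (auto simp: filterlim_at less_imp_neq[symmetric])
    ultimately have "(\<lambda>j. H (x j) / x j) \<longlonglongrightarrow> 1" by (rule filterlim_compose)
    then have "(\<lambda>j. H (x j) / x j - 1) \<longlonglongrightarrow> 1 - 1" by (intro tendsto_diff tendsto_const)
    moreover have "H (x j) / x j - 1 = (x (Suc j) - x j) / x j" for j using x[of j] by (simp add: xS field_simps)
    ultimately show ?thesis by simp
  qed
  have "\<forall>\<^sub>F j in sequentially. \<exists>i l. (fc a ^^ i) (v a) + of_int l \<in> ball (of_real (p + \<sigma> * x j)) (\<epsilon> * x j)"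
  proof (rule critical_orbit_enters[OF n p, of "p + \<sigma> * y" "p + \<sigma> * x0" "p + \<sigma> * H x0" _ _ "\<lambda>j. p + \<sigma> * x (Suc j)"])
    show "(f a ^^ n) (p + \<sigma> * y) = p + \<sigma> * y + of_int k" by (rule y)
    show "p \<noteq> p + \<sigma> * y" using y x0 \<sigma> by auto
    show "p + \<sigma> * x0 \<noteq> p + \<sigma> * H x0" using Hlt[of x0] x0 \<sigma> by auto
    show "0 < \<epsilon> * x j" for j using \<epsilon> x by simp
    show "p + \<sigma> * x j = ((\<lambda>x. (f a ^^ n) x - of_int k) ^^ j) (p + \<sigma> * x0)" for j
      using hj[of j x0] by (simp add: h_def x_def)
    show "p + \<sigma> * x (Suc j) = ((\<lambda>x. (f a ^^ n) x - of_int k) ^^ j) (p + \<sigma> * H x0)" for j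
      using hj[of j "H x0"] by (simp add: h_def x_def funpow_swap1)
    show "\<epsilon> * x j \<le> \<bar>p + \<sigma> * x j - p\<bar>" for j
      using x[of j] \<epsilon>(3) ss(3) mult_right_mono[of \<epsilon> 1 "x j"] by (simp add: abs_mult)
    show "\<epsilon> * x j \<le> \<bar>p + \<sigma> * x j - (p + \<sigma> * y)\<bar>" for j
    proof -
      have "p + \<sigma> * x j - (p + \<sigma> * y) = \<sigma> * (x j - y)" by (simp add: algebra_simps)
      then have "\<bar>p + \<sigma> * x j - (p + \<sigma> * y)\<bar> = y - x j" using ss(3) x[of j] y by (simp add: abs_mult)
      moreover have "\<epsilon> * x j \<le> \<epsilon> * x0" using x[of j] \<epsilon>(1) by simp
      ultimately show ?thesis using \<epsilon>(4) x[of j] by linarith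
    qed
    have "(\<lambda>j. \<sigma> / \<epsilon> * ((x (Suc j) - x j) / x j)) \<longlonglongrightarrow> \<sigma> / \<epsilon> * 0" by (intro tendsto_mult tendsto_const slope)
    moreover have "\<sigma> / \<epsilon> * ((x (Suc j) - x j) / x j) = (p + \<sigma> * x (Suc j) - (p + \<sigma> * x j)) / (\<epsilon> * x j)" for j
      by (simp add: algebra_simps diff_divide_distrib)
    ultimately show "(\<lambda>j. (p + \<sigma> * x (Suc j) - (p + \<sigma> * x j)) / (\<epsilon> * x j)) \<longlonglongrightarrow> 0" by (simp only: mult_zero_right)
  qed
  then obtain j i l where il: "(fc a ^^ i) (v a) + of_int l \<in> ball (of_real (p + \<sigma> * x j)) (\<epsilon> * x j)"
    unfolding eventually_sequentially by blast
  define w where "w = (fc a ^^ i) (v a) + of_int l - complex_of_real p"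
  have wd: "norm (w - of_real (\<sigma> * x j)) < \<epsilon> * x j"
    using il by (simp add: w_def dist_norm norm_minus_commute algebra_simps)
  have ex: "\<epsilon> * x j \<le> x j / 4" using \<epsilon>(3) x[of j] mult_right_mono[of \<epsilon> "1/4" "x j"] by simp
  have Re: "\<bar>Re w - \<sigma> * x j\<bar> < \<epsilon> * x j" and Im: "\<bar>Im w\<bar> < \<epsilon> * x j"
    using abs_Re_le_cmod[of "w - of_real (\<sigma> * x j)"] abs_Im_le_cmod[of "w - of_real (\<sigma> * x j)"] wd by auto
  have "\<sigma> * Re w = x j + \<sigma> * (Re w - \<sigma> * x j)" using ss by (simp add: right_diff_distrib)
  moreover have "\<bar>\<sigma> * (Re w - \<sigma> * x j)\<bar> < x j / 4" using Re ex ss(3) by (simp add: abs_mult)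
  ultimately have sRe: "x j / 2 < \<sigma> * Re w" using x[of j] by linarith
  have "norm w \<le> norm (w - of_real (\<sigma> * x j)) + norm (complex_of_real (\<sigma> * x j))"
    using norm_triangle_ineq[of "w - of_real (\<sigma> * x j)" "of_real (\<sigma> * x j)"] by simp
  moreover have "norm (complex_of_real (\<sigma> * x j)) = x j" using ss(3) x[of j] by (simp add: norm_mult)
  ultimately have "norm w < \<rho>" using wd ex x[of j] x0 by linarith
  moreover have "\<bar>Im w\<bar> \<le> \<kappa> * (\<sigma> * Re w)"
  proof -
    have "\<epsilon> * x j \<le> \<kappa> / 4 * x j" using \<epsilon>(2) x[of j] by (intro mult_right_mono) auto
    moreover have "\<kappa> * (x j / 2) \<le> \<kappa> * (\<sigma> * Re w)" using sRe \<open>0 < \<kappa>\<close> by (intro mult_left_mono) auto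
    moreover have "0 < \<kappa> * x j" using x[of j] \<open>0 < \<kappa>\<close> by simp
    ultimately show ?thesis using Im by linarith
  qed
  moreover have "0 < \<sigma> * Re w" using sRe x[of j] by linarith
  ultimately show ?thesis unfolding w_def by blast
qed

text \<open>
  The same argument with discs of fixed radius about \<open>p\<close>; the omitted values are
  fixed points on both sides of it.
\<close>

lemma enters_attracting:
  assumes n: "0 < n" and p: "(f a ^^ n) p = p + of_int k" and P1: "P a n p < 1" and "0 < \<rho>"
  shows "\<exists>i l. norm ((fc a ^^ i) (v a) + of_int l - of_real p) < \<rho>"
proof -
  define h where "h = (\<lambda>x. (f a ^^ n) x - of_int k)"
  have hp: "h p = p" by (simp add: h_def p)
  have dh: "(h has_real_derivative P a n x) (at x)" for x
    unfolding h_def by (auto intro!: derivative_eq_intros lift.DERIV_funpow)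
  have hmono: "x < y \<Longrightarrow> h x < h y" for x y by (simp add: h_def lift.funpow_less_iff)
  have "((\<lambda>x. (h (p + x) - h p) / x) \<longlongrightarrow> P a n p) (at 0)" using dh[of p] by (simp add: DERIV_def)
  from order_tendstoD(2)[OF this P1] obtain \<delta> where \<delta>: "0 < \<delta>"
    "\<And>x. x \<noteq> 0 \<Longrightarrow> \<bar>x\<bar> < \<delta> \<Longrightarrow> (h (p + x) - h p) / x < 1" unfolding eventually_at by auto
  have hlt: "h (p + x) < p + x" if "0 < x" "x < \<delta>" for x
    using \<delta>(2)[of x] that hp by (simp add: divide_less_eq)
  define x0 where "x0 = \<delta> / 2"
  have x0: "0 < x0" "x0 < \<delta>" using \<delta>(1) by (auto simp: x0_def)
  define x where "x j = (h ^^ j) (p + x0) - p" for j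
  have xS: "p + x (Suc j) = h (p + x j)" for j by (simp add: x_def)
  have x: "0 < x j \<and> x j \<le> x0" for j
  proof (induction j)
    case (Suc j)
    then have "h p < h (p + x j)" "h (p + x j) < p + x j" using hmono[of p "p + x j"] hlt[of "x j"] x0 by auto
    then show ?case using Suc xS[of j] hp by linarith
  qed (use x0 in \<open>simp add: x_def\<close>)
  have lim: "x \<longlonglongrightarrow> 0"
  proof -
    have dec: "x (Suc j) \<le> x j" for j using hlt[of "x j"] x[of j] x0 xS[of j] by linarith
    then have "decseq x" by (rule decseq_SucI)
    then obtain L where L: "x \<longlonglongrightarrow> L" "\<And>j. L \<le> x j"
      using decseq_convergent[of x 0] x less_imp_le by metis
    have "0 \<le> L" by (rule LIMSEQ_le_const[OF L(1)]) (use x less_imp_le in blast)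
    have "L \<le> x0" using L(2)[of 0] x[of 0] by linarith
    have "(\<lambda>j. h (p + x j)) \<longlonglongrightarrow> h (p + L)"
      by (intro isCont_tendsto_compose[OF DERIV_isCont[OF dh]] tendsto_intros L)
    moreover have "(\<lambda>j. h (p + x j)) \<longlonglongrightarrow> p + L"
      using LIMSEQ_Suc[OF L(1)] unfolding xS[symmetric] by (intro tendsto_intros)
    ultimately have "h (p + L) = p + L" by (rule LIMSEQ_unique)
    then have "L = 0" using hlt[of L] \<open>0 \<le> L\<close> \<open>L \<le> x0\<close> x0 by (cases "L = 0") auto
    then show ?thesis using L(1) by simp
  qed
  have side: "\<sigma> * ((f a ^^ n) (p + \<sigma> * x0) - of_int k - p) < x0" if \<sigma>: "\<sigma> = 1 \<or> \<sigma> = - 1" for \<sigma>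
  proof -
    have "(h (p + x0) - h p) / x0 < 1" "(h (p + - x0) - h p) / (- x0) < 1" using x0 by (intro \<delta>(2); simp)+
    then have "h (p + x0) - h p < x0" "- x0 < h (p + - x0) - h p" using x0 by (simp_all add: divide_less_eq less_divide_eq)
    then show ?thesis using \<sigma> hp by (auto simp: h_def)
  qed
  obtain y where y: "x0 < y" "(f a ^^ n) (p + 1 * y) = p + 1 * y + of_int k"
    using fixed_point_beyond[OF n _ side[of 1]] by auto
  obtain z where z: "x0 < z" "(f a ^^ n) (p + - 1 * z) = p + - 1 * z + of_int k"
    using fixed_point_beyond[OF n _ side[of "- 1"]] by auto
  define r where "r = min x0 \<rho>"
  have r: "0 < r" "r \<le> x0" "r \<le> \<rho>" using x0 \<open>0 < \<rho>\<close> by (auto simp: r_def)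
  have "\<forall>\<^sub>F j in sequentially. \<exists>i l. (fc a ^^ i) (v a) + of_int l \<in> ball (of_real p) r"
  proof (rule critical_orbit_enters[OF n y(2) z(2), of p "p + x0" "\<lambda>j. r" "\<lambda>j. p" "\<lambda>j. p + x j"])
    show "p = ((\<lambda>x. (f a ^^ n) x - of_int k) ^^ j) p" for j
      using hp by (induction j) (auto simp: h_def)
    show "p + x j = ((\<lambda>x. (f a ^^ n) x - of_int k) ^^ j) (p + x0)" for j by (simp add: x_def h_def)
    show "(\<lambda>j. (p + x j - p) / r) \<longlonglongrightarrow> 0" using tendsto_divide[OF lim tendsto_const[of r]] r by simp
  qed (use x0 y z r in auto)
  then obtain i l where "(fc a ^^ i) (v a) + of_int l \<in> ball (of_real p) r"
    unfolding eventually_sequentially by blast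
  then have "norm ((fc a ^^ i) (v a) + of_int l - of_real p) < \<rho>"
    using r by (auto simp: dist_norm norm_minus_commute)
  then show ?thesis by blast
qed

text \<open>
  Once the critical orbit has entered the sector it stays in it modulo 1 and converges to
  \<open>p\<close>. The germ has the form required by \<open>parabolic_sector\<close>, in the
  coordinate \<open>\<sigma> * (z - p)\<close>, because the fixed point is at least double and
  \<open>e 0\<close> is a limit of positive real numbers.
\<close>

lemma trapped_side:
  assumes sa: "side_attracting \<sigma> a n k p" and \<sigma>: "\<sigma> = 1 \<or> \<sigma> = - 1"
  shows "\<exists>w i0. (\<forall>j. \<exists>l. (fc a ^^ (i0 + n * j)) (v a) = w j + of_int l) \<and> w \<longlonglongrightarrow> of_real p \<and>
    (\<forall>j. 0 < \<sigma> * Re (w j - of_real p) \<and> norm (w j - of_real p) \<le> 2 * (\<sigma> * Re (w j - of_real p)))"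
proof -
  have n: "0 < n" and p: "(f a ^^ n) p = p + of_int k" and P1: "P a n p = 1" using sa by (auto simp: side_attracting_def)
  obtain \<delta> where \<delta>: "0 < \<delta>" "\<And>x. 0 < x \<Longrightarrow> x < \<delta> \<Longrightarrow> \<sigma> * ((f a ^^ n) (p + \<sigma> * x) - of_int k - p) < x"
    using sa by (auto simp: side_attracting_def)
  have ss: "\<sigma> * \<sigma> = 1" "\<bar>\<sigma>\<bar> = 1" "\<sigma> \<noteq> 0" using \<sigma> by auto
  define s where "s = complex_of_real \<sigma>"
  have s: "s * s = 1" "norm s = 1" using ss by (simp_all add: s_def flip: of_real_mult)
  have s2: "s * (s * z) = z" for z using s(1) by (simp add: mult.assoc[symmetric])
  obtain g r D where g: "0 < (D::nat)" "0 < r" "g holomorphic_on ball (of_real p) r"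
    "\<And>z. z \<in> ball (of_real p) r \<Longrightarrow> (fc a ^^ n) z - z - of_int k = (z - of_real p) ^ D * g z"
    "\<And>z. z \<in> ball (of_real p) r \<Longrightarrow> g z \<noteq> 0"
    using periodic_factor[OF n p] by metis
  have pb: "of_real p \<in> ball (complex_of_real p) r" using g(2) by simp
  have gd: "(g has_field_derivative deriv g (of_real p)) (at (of_real p))"
    by (rule holomorphic_derivI[OF g(3) open_ball pb])
  (* The multiplier is 1, so the fixed point is not simple. *)
  have "D \<noteq> 1"
  proof
    assume D: "D = 1"
    have "((\<lambda>z. (fc a ^^ n) z - z - of_int k) has_field_derivative of_real (P a n p) - 1 - 0) (at (of_real p))"
      by (intro DERIV_diff deriv_funpow_fc_real DERIV_ident DERIV_const)
    moreover have "((\<lambda>z. (fc a ^^ n) z - z - of_int k) has_field_derivative g (of_real p)) (at (of_real p))"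
    proof (rule has_field_derivative_transform_within_open[OF _ open_ball pb])
      show "((\<lambda>z. (z - of_real p) * g z) has_field_derivative g (of_real p)) (at (of_real p))"
        using gd by (auto intro!: derivative_eq_intros)
    qed (simp add: g(4) D)
    ultimately have "g (of_real p) = of_real (P a n p) - 1 - 0" by (rule DERIV_unique[symmetric])
    then show False using g(5)[OF pb] P1 by simp
  qed
  then obtain d where d: "D = Suc d" "0 < d" using g(1) by (metis One_nat_def gr0_conv_Suc neq0_conv)
  define hc where "hc = (\<lambda>z. (fc a ^^ n) z - of_int k)"
  define G where "G u = s * (hc (of_real p + s * u) - of_real p)" for u
  define e where "e u = - (s ^ Suc D) * g (of_real p + s * u)" for u
  have inb: "of_real p + s * u \<in> ball (complex_of_real p) r" if "norm u < r" for u
    using that s(2) by (simp add: dist_norm norm_mult)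
  have Ge: "G u = u - u ^ Suc d * e u" if "norm u < r" for u
  proof -
    have "hc (of_real p + s * u) - of_real p = s * u + (s * u) ^ D * g (of_real p + s * u)"
      using g(4)[OF inb[OF that]] by (simp add: hc_def algebra_simps)
    then have "G u = s * (s * u) + s * ((s * u) ^ D * g (of_real p + s * u))" by (simp add: G_def distrib_left)
    then show ?thesis by (simp only: s2 e_def power_mult_distrib power_Suc d(1)[symmetric]) (simp add: d(1) mult_ac)
  qed
  have contg: "isCont e 0"
  proof -
    have "isCont g (of_real p + s * 0)" using DERIV_isCont[OF gd] by simp
    moreover have "isCont (\<lambda>u. of_real p + s * u) 0" by (intro continuous_intros)
    ultimately have "isCont (\<lambda>u. g (of_real p + s * u)) 0" by (intro isCont_o2[of 0 "\<lambda>u. of_real p + s * u" g])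
    then show ?thesis unfolding e_def by (intro isCont_mult continuous_const)
  qed
  have e0: "e 0 \<noteq> 0" using g(5)[OF pb] s(2) by (auto simp: e_def)
  define \<eta> where "\<eta> = min \<delta> r"
  have \<eta>: "0 < \<eta>" "\<eta> \<le> \<delta>" "\<eta> \<le> r" using \<delta>(1) g(2) by (auto simp: \<eta>_def)
  define y where "y j = \<eta> / (real j + 2)" for j
  have y: "0 < y j" "y j < \<delta>" "y j < r" for j
  proof -
    show "0 < y j" unfolding y_def using \<eta> by (intro divide_pos_pos) auto
    have "\<eta> * 1 < \<eta> * (real j + 2)" using \<eta> by (intro mult_strict_left_mono) auto
    then have "y j < \<eta>" unfolding y_def by (simp add: divide_less_eq)
    then show "y j < \<delta>" "y j < r" using \<eta> by auto
  qed
  have ylim: "(\<lambda>j. y j) \<longlonglongrightarrow> 0"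
    unfolding y_def using LIMSEQ_ignore_initial_segment[OF lim_const_over_n[of \<eta>], of 2] by (simp add: add.commute)
  define \<phi> where "\<phi> j = (y j - \<sigma> * ((f a ^^ n) (p + \<sigma> * y j) - of_int k - p)) / y j ^ Suc d" for j
  have \<phi>pos: "0 < \<phi> j" for j unfolding \<phi>_def using y[of j] \<delta>(2)[of "y j"] by (intro divide_pos_pos) auto
  have e\<phi>: "e (of_real (y j)) = of_real (\<phi> j)" for j
  proof -
    have "G (of_real (y j)) = of_real (\<sigma> * ((f a ^^ n) (p + \<sigma> * y j) - of_int k - p))"
      unfolding G_def hc_def s_def of_real_mult[symmetric] of_real_add[symmetric] funpow_fc_of_real by simp
    moreover have "of_real (y j) ^ Suc d * e (of_real (y j)) = of_real (y j) - G (of_real (y j))"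
      using Ge[of "of_real (y j)"] y[of j] by simp
    ultimately have "of_real (y j ^ Suc d) * e (of_real (y j)) = of_real (\<phi> j * y j ^ Suc d)"
      using y(1)[of j] by (simp add: \<phi>_def del: power_Suc)
    then show ?thesis using y(1)[of j] by (simp add: mult.commute del: power_Suc)
  qed
  have elim: "(\<lambda>j. complex_of_real (\<phi> j)) \<longlonglongrightarrow> e 0"
    unfolding e\<phi>[symmetric] using tendsto_of_real[OF ylim, where ?'a = complex] by (intro isCont_tendsto_compose[OF contg]) simp
  have "0 \<le> Re (e 0)"
    by (rule LIMSEQ_le_const[OF tendsto_Re[OF elim]]) (use \<phi>pos less_imp_le in auto)
  moreover have "Im (e 0) = 0" using LIMSEQ_unique[OF tendsto_Im[OF elim]] by simp
  ultimately obtain c where c: "0 < c" "e 0 = of_real c"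
    using e0 by (metis complex_eq_iff Re_complex_of_real Im_complex_of_real less_eq_real_def zero_complex.sel)
  obtain \<kappa> \<rho> where \<kappa>: "0 < \<kappa>" "\<kappa> \<le> 1" "0 < \<rho>" and sector:
    "\<And>u u'. 0 < Re u \<Longrightarrow> Re u < \<rho> \<Longrightarrow> \<bar>Im u\<bar> \<le> \<kappa> * Re u \<Longrightarrow> u' = u - u ^ Suc d * e u \<Longrightarrow>
      0 < Re u' \<and> \<bar>Im u'\<bar> \<le> \<kappa> * Re u' \<and> Re u' \<le> Re u - c / 2 * Re u ^ Suc d"
    using parabolic_sector[OF d(2) c(1) contg c(2)] by metis
  define \<rho>' where "\<rho>' = min \<rho> (r / 2)"
  have \<rho>': "0 < \<rho>'" "\<rho>' \<le> \<rho>" "2 * \<rho>' \<le> r" using \<kappa>(3) g(2) by (auto simp: \<rho>'_def)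
  have norm2: "norm u \<le> 2 * Re u" if "0 < Re u" "\<bar>Im u\<bar> \<le> \<kappa> * Re u" for u
    using cmod_le[of u] that mult_right_mono[OF \<kappa>(2), of "Re u"] by linarith
  obtain i l where z0: "norm ((fc a ^^ i) (v a) + of_int l - of_real p) < \<rho>'"
      "0 < \<sigma> * Re ((fc a ^^ i) (v a) + of_int l - of_real p)"
      "\<bar>Im ((fc a ^^ i) (v a) + of_int l - of_real p)\<bar> \<le> \<kappa> * (\<sigma> * Re ((fc a ^^ i) (v a) + of_int l - of_real p))"
    using enters_side[OF sa \<sigma> \<rho>'(1) \<kappa>(1,2)] by blast
  define u0 where "u0 = s * ((fc a ^^ i) (v a) + of_int l - of_real p)"
  define u where "u j = (G ^^ j) u0" for j
  have uS: "u (Suc j) = G (u j)" for j by (simp add: u_def)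
  have inv: "0 < Re (u j) \<and> Re (u j) < \<rho>' \<and> \<bar>Im (u j)\<bar> \<le> \<kappa> * Re (u j) \<and> Re (u (Suc j)) \<le> Re (u j) - c / 2 * Re (u j) ^ Suc d" for j
  proof (induction j)
    case 0
    have re: "Re u0 = \<sigma> * Re ((fc a ^^ i) (v a) + of_int l - of_real p)"
      and im: "Im u0 = \<sigma> * Im ((fc a ^^ i) (v a) + of_int l - of_real p)" by (simp_all add: u0_def s_def)
    have a: "0 < Re u0" "\<bar>Im u0\<bar> \<le> \<kappa> * Re u0" using z0(2,3) unfolding re im abs_mult ss(2) by simp_all
    have "norm u0 < \<rho>'" unfolding u0_def norm_mult s(2) using z0(1) by simp
    then have b: "Re u0 < \<rho>'" using complex_Re_le_cmod[of u0] by linarith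
    have "G u0 = u0 - u0 ^ Suc d * e u0" using norm2[OF a] b \<rho>'(3) by (intro Ge) linarith
    from sector[OF a(1) _ a(2) this] b \<rho>'(2) show ?case using a by (simp add: u_def del: power_Suc)
  next
    case (Suc j)
    have a: "0 < Re (u (Suc j))" "\<bar>Im (u (Suc j))\<bar> \<le> \<kappa> * Re (u (Suc j))"
    proof -
      have "G (u j) = u j - u j ^ Suc d * e (u j)" using norm2[of "u j"] Suc \<rho>'(3) by (intro Ge) linarith
      from sector[OF _ _ _ this] Suc \<rho>'(2) show "0 < Re (u (Suc j))" "\<bar>Im (u (Suc j))\<bar> \<le> \<kappa> * Re (u (Suc j))"
        by (auto simp: uS simp del: power_Suc)
    qed
    have "0 < c / 2 * Re (u j) ^ Suc d" using Suc c(1) by (intro mult_pos_pos zero_less_power) auto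
    then have b: "Re (u (Suc j)) < \<rho>'" using Suc by linarith
    have "G (u (Suc j)) = u (Suc j) - u (Suc j) ^ Suc d * e (u (Suc j))" using norm2[OF a] b \<rho>'(3) by (intro Ge) linarith
    from sector[OF a(1) _ a(2) this] b \<rho>'(2) show ?case using a by (simp add: uS[of "Suc j"] del: power_Suc)
  qed
  have "(\<lambda>j. Re (u j)) \<longlonglongrightarrow> 0"
  proof (rule decreasing_to_0[where g = "\<lambda>t. c / 2 * t ^ Suc d"])
    show "c / 2 * y ^ Suc d \<le> c / 2 * z ^ Suc d" if "0 < y" "y \<le> z" for y z
      using that c(1) by (intro mult_left_mono power_mono) auto
    show "0 < c / 2 * y ^ Suc d" if "0 < y" for y using that c(1) by (intro mult_pos_pos zero_less_power) auto
  qed (use inv in \<open>blast+\<close>)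
  then have "(\<lambda>j. 2 * Re (u j)) \<longlonglongrightarrow> 0" by (intro tendsto_mult_right_zero)
  then have ulim: "u \<longlonglongrightarrow> 0"
    by (rule Lim_null_comparison[rotated]) (use norm2 inv in \<open>auto intro!: always_eventually\<close>)
  define w where "w j = of_real p + s * u j" for j
  have wS: "w (Suc j) = hc (w j)" for j by (simp add: w_def uS G_def s2)
  have orbit: "\<exists>l. (fc a ^^ (i + n * j)) (v a) = w j + of_int l" for j
  proof (induction j)
    case 0
    have "(fc a ^^ i) (v a) = w 0 + of_int (- l)" by (simp add: w_def u_def u0_def s2)
    then show ?case by (metis mult_0_right add_0_right)
  next
    case (Suc j)
    then obtain m where m: "(fc a ^^ (i + n * j)) (v a) = w j + of_int m" by blast
    have "i + n * Suc j = n + (i + n * j)" by simp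
    then have "(fc a ^^ (i + n * Suc j)) (v a) = (fc a ^^ n) (w j + of_int m)" by (simp only: funpow_add[where m = n and n = "i + n * j"] comp_apply m)
    also have "\<dots> = w (Suc j) + of_int (k + 2 ^ n * m)" by (simp add: funpow_fc_add_int wS hc_def)
    finally show ?case by blast
  qed
  have "w \<longlonglongrightarrow> of_real p + s * 0" unfolding w_def by (intro tendsto_intros ulim)
  moreover have "0 < \<sigma> * Re (w j - of_real p) \<and> norm (w j - of_real p) \<le> 2 * (\<sigma> * Re (w j - of_real p))" for j
  proof -
    have "\<sigma> * Re (w j - of_real p) = Re (u j)" using ss(1) by (simp add: w_def s_def mult.assoc[symmetric])
    moreover have "norm (w j - of_real p) = norm (u j)" by (simp add: w_def norm_mult s(2))
    ultimately show ?thesis using inv[of j] norm2[of "u j"] by simp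
  qed
  ultimately show ?thesis using orbit by (intro exI[of _ w] exI[of _ i]) auto
qed

lemma trapped_attracting:
  assumes n: "0 < n" and p: "(f a ^^ n) p = p + of_int k" and P1: "P a n p < 1"
  shows "\<exists>w i0. (\<forall>j. \<exists>l. (fc a ^^ (i0 + n * j)) (v a) = w j + of_int l) \<and> w \<longlonglongrightarrow> of_real p"
proof -
  define hc where "hc = (\<lambda>z. (fc a ^^ n) z - of_int k)"
  have hp: "hc (of_real p) = of_real p" by (simp add: hc_def funpow_fc_of_real p)
  have "(hc has_field_derivative of_real (P a n p) - 0) (at (of_real p))"
    unfolding hc_def by (intro DERIV_diff deriv_funpow_fc_real DERIV_const)
  then have "((\<lambda>h. norm ((hc (of_real p + h) - hc (of_real p)) / h)) \<longlongrightarrow> norm (complex_of_real (P a n p) - 0)) (at 0)"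
    unfolding DERIV_def by (rule tendsto_norm)
  moreover define \<mu> where "\<mu> = (P a n p + 1) / 2"
  have \<mu>: "P a n p < \<mu>" "\<mu> < 1" "0 < \<mu>" using P1 lift.P_pos[of a n p] by (auto simp: \<mu>_def)
  ultimately have "\<forall>\<^sub>F h in at 0. norm ((hc (of_real p + h) - hc (of_real p)) / h) < \<mu>"
    using lift.P_pos[of a n p] by (intro order_tendstoD(2)) auto
  then obtain r where r: "0 < r" "\<And>h::complex. h \<noteq> 0 \<Longrightarrow> norm h < r \<Longrightarrow> norm ((hc (of_real p + h) - hc (of_real p)) / h) < \<mu>"
    unfolding eventually_at dist_norm by auto
  have contr: "norm (hc z - of_real p) \<le> \<mu> * norm (z - of_real p)" if "norm (z - of_real p) < r" for z
  proof (cases "z = of_real p")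
    case False
    then have "norm ((hc z - of_real p) / (z - of_real p)) < \<mu>" using r(2)[of "z - of_real p"] that hp by simp
    then show ?thesis using False by (simp add: norm_divide divide_less_eq)
  qed (simp add: hp)
  obtain i l where il: "norm ((fc a ^^ i) (v a) + of_int l - of_real p) < r" using enters_attracting[OF n p P1 r(1)] by blast
  define w where "w j = (hc ^^ j) ((fc a ^^ i) (v a) + of_int l)" for j
  have wS: "w (Suc j) = hc (w j)" for j by (simp add: w_def)
  have wn: "norm (w j - of_real p) \<le> \<mu> ^ j * r" for j
  proof (induction j)
    case (Suc j)
    have "\<mu> ^ j * r \<le> 1 * r" using \<mu> r(1) by (intro mult_right_mono power_le_one) auto
    have "norm (w j - of_real p) < r"
    proof (cases j)
      case 0 then show ?thesis using il by (simp add: w_def)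
    next
      case (Suc m)
      have "\<mu> ^ j < 1" unfolding Suc using \<mu> by (intro power_Suc_less_one) auto
      then have "\<mu> ^ j * r < 1 * r" using r(1) by (intro mult_strict_right_mono)
      then show ?thesis using \<open>norm (w j - of_real p) \<le> \<mu> ^ j * r\<close> by simp
    qed
    then have "norm (w (Suc j) - of_real p) \<le> \<mu> * norm (w j - of_real p)" unfolding wS by (rule contr)
    also have "\<dots> \<le> \<mu> * (\<mu> ^ j * r)" using Suc \<mu> by (intro mult_left_mono) auto
    finally show ?case by simp
  qed (use il in \<open>simp add: w_def\<close>)
  have "(\<lambda>j. w j - of_real p) \<longlonglongrightarrow> 0"
  proof (rule Lim_null_comparison)
    show "\<forall>\<^sub>F j in sequentially. norm (w j - of_real p) \<le> \<mu> ^ j * r" using wn by (intro always_eventually) auto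
    show "(\<lambda>j. \<mu> ^ j * r) \<longlonglongrightarrow> 0" using \<mu> by (intro tendsto_mult_left_zero LIMSEQ_power_zero) auto
  qed
  then have "w \<longlonglongrightarrow> of_real p" by (rule LIM_zero_cancel)
  moreover have "\<exists>l. (fc a ^^ (i + n * j)) (v a) = w j + of_int l" for j
  proof (induction j)
    case 0
    have "(fc a ^^ i) (v a) = w 0 + of_int (- l)" by (simp add: w_def)
    then show ?case by (metis mult_0_right add_0_right)
  next
    case (Suc j)
    then obtain m where m: "(fc a ^^ (i + n * j)) (v a) = w j + of_int m" by blast
    have "i + n * Suc j = n + (i + n * j)" by simp
    then have "(fc a ^^ (i + n * Suc j)) (v a) = (fc a ^^ n) (w j + of_int m)" by (simp only: funpow_add[where m = n and n = "i + n * j"] comp_apply m)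
    also have "\<dots> = w (Suc j) + of_int (k + 2 ^ n * m)" by (simp add: funpow_fc_add_int wS hc_def)
    finally show ?case by blast
  qed
  ultimately show ?thesis by blast
qed

text \<open>
  By \<open>enters_side\<close> the critical orbit comes to the side \<open>\<sigma>\<close> of
  \<open>p\<close> at arbitrarily small distances. This fails if it converges to another cycle:
  the finitely many points before the capture have a minimal distance, and the later ones are
  close to the cycle of \<open>y\<close>, which either keeps away from \<open>p\<close> modulo 1
  or is approached on the wrong side.
\<close>

lemma captured_elsewhere:
  assumes n: "0 < n" and w: "\<And>j. \<exists>l. (fc a ^^ (i0 + n * j)) (v a) = w j + of_int l" "w \<longlonglongrightarrow> of_real y"
    and sa: "side_attracting \<sigma> a n' k' p" and \<sigma>: "\<sigma> = 1 \<or> \<sigma> = - 1"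
    and away: "\<And>s l. s < n \<Longrightarrow> (f a ^^ s) y + of_int l = p \<Longrightarrow>
      \<forall>\<^sub>F j in sequentially. \<sigma> * Re ((fc a ^^ s) (w j) + of_int l - of_real p) \<le> 0"
  shows False
proof -
  define bad where "bad z \<rho> \<longleftrightarrow> (\<exists>l::int. norm (z + of_int l - of_real p) < \<rho> \<and> 0 < \<sigma> * Re (z + of_int l - of_real p))" for z and \<rho> :: real
  have badmono: "bad z \<rho> \<Longrightarrow> \<rho> \<le> \<rho>' \<Longrightarrow> bad z \<rho>'" for z \<rho> \<rho>' unfolding bad_def using less_le_trans by blast
  have one: "\<exists>\<rho>>0. \<not> bad z \<rho>" for z
  proof -
    obtain \<eta> where \<eta>: "0 < \<eta>" "\<And>l::int. norm (z + of_int l - of_real p) < \<eta> \<Longrightarrow> z + of_int l = of_real p"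
      using integer_translates_isolated[of z "of_real p"] by blast
    have "\<not> bad z \<eta>"
    proof
      assume "bad z \<eta>"
      then obtain l :: int where "norm (z + of_int l - of_real p) < \<eta>" "0 < \<sigma> * Re (z + of_int l - of_real p)"
        unfolding bad_def by blast
      then have "z + of_int l - of_real p = 0" using \<eta>(2)[of l] by simp
      then show False using \<open>0 < \<sigma> * Re (z + of_int l - of_real p)\<close> by (simp only: zero_complex.sel mult_zero_right less_irrefl)
    qed
    then show ?thesis using \<eta>(1) by blast
  qed
  have tail: "\<exists>\<rho>>0. \<exists>J. \<forall>j\<ge>J. \<not> bad ((fc a ^^ s) (w j)) \<rho>" if s: "s < n" for s
  proof -
    define z where "z = complex_of_real ((f a ^^ s) y)"
    obtain \<eta> where \<eta>: "0 < \<eta>" "\<And>l::int. norm (z + of_int l - of_real p) < \<eta> \<Longrightarrow> z + of_int l = of_real p"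
      using integer_translates_isolated[of z "of_real p"] by blast
    have "isCont (fc a ^^ s) (of_real y)" using deriv_funpow_fc_real DERIV_isCont by blast
    from isCont_tendsto_compose[OF this w(2)] have lim: "(\<lambda>j. (fc a ^^ s) (w j)) \<longlonglongrightarrow> z"
      by (simp add: z_def funpow_fc_of_real)
    have ev1: "\<forall>\<^sub>F j in sequentially. norm ((fc a ^^ s) (w j) - z) < \<eta> / 2"
      using tendstoD[OF lim, of "\<eta> / 2"] \<eta>(1) by (simp add: dist_norm)
    have ev2: "\<forall>\<^sub>F j in sequentially. \<forall>l::int. z + of_int l = of_real p \<longrightarrow> \<sigma> * Re ((fc a ^^ s) (w j) + of_int l - of_real p) \<le> 0"
    proof (cases "\<exists>l::int. z + of_int l = of_real p")
      case True
      then obtain l :: int where l: "z + of_int l = of_real p" by blast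
      have "complex_of_real ((f a ^^ s) y + of_int l) = of_real p" using l by (simp add: z_def)
      then have "(f a ^^ s) y + of_int l = p" by (simp only: of_real_eq_iff)
      from away[OF s this] show ?thesis
      proof eventually_elim
        case (elim j)
        show ?case
        proof (intro allI impI)
          fix l' :: int assume "z + of_int l' = of_real p"
          then have "l' = l" using l by (metis add_left_cancel of_int_eq_iff)
          then show "\<sigma> * Re ((fc a ^^ s) (w j) + of_int l' - of_real p) \<le> 0" using elim by simp
        qed
      qed
    qed auto
    from eventually_conj[OF ev1 ev2] obtain J where J: "\<And>j. J \<le> j \<Longrightarrow> norm ((fc a ^^ s) (w j) - z) < \<eta> / 2 \<and>
        (\<forall>l::int. z + of_int l = of_real p \<longrightarrow> \<sigma> * Re ((fc a ^^ s) (w j) + of_int l - of_real p) \<le> 0)"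
      unfolding eventually_sequentially by blast
    have "\<not> bad ((fc a ^^ s) (w j)) (\<eta> / 2)" if "J \<le> j" for j
    proof
      assume "bad ((fc a ^^ s) (w j)) (\<eta> / 2)"
      then obtain l :: int where l: "norm ((fc a ^^ s) (w j) + of_int l - of_real p) < \<eta> / 2"
        "0 < \<sigma> * Re ((fc a ^^ s) (w j) + of_int l - of_real p)" unfolding bad_def by blast
      have "norm (z + of_int l - of_real p) \<le> norm ((fc a ^^ s) (w j) + of_int l - of_real p) + norm ((fc a ^^ s) (w j) - z)"
        using norm_triangle_ineq4[of "(fc a ^^ s) (w j) + of_int l - of_real p" "(fc a ^^ s) (w j) - z"] by (simp add: algebra_simps)
      then have "z + of_int l = of_real p" using l(1) J[OF that] by (intro \<eta>(2)) linarith
      then show False using J[OF that] l(2) by fastforce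
    qed
    then show ?thesis using \<eta>(1) by (intro exI[of _ "\<eta> / 2"]) auto
  qed
  obtain \<rho>1 J where \<rho>1: "\<And>s. s < n \<Longrightarrow> 0 < \<rho>1 s \<and> (\<forall>j\<ge>J s. \<not> bad ((fc a ^^ s) (w j)) (\<rho>1 s))"
    using tail by metis
  obtain \<rho>2 where \<rho>2: "\<And>z. 0 < \<rho>2 z \<and> \<not> bad z (\<rho>2 z)" using one by metis
  define JJ where "JJ = (\<Sum>s<n. J s)"
  (* The radii \<rho>1 belong to the points of the orbit after the capture, in their n residue
     classes, the radii \<rho>2 to those before. *)
  define \<rho> where "\<rho> = Min (\<rho>1 ` {..<n} \<union> (\<lambda>i. \<rho>2 ((fc a ^^ i) (v a))) ` {..<i0 + n * JJ} \<union> {1})"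
  have fin: "finite (\<rho>1 ` {..<n} \<union> (\<lambda>i. \<rho>2 ((fc a ^^ i) (v a))) ` {..<i0 + n * JJ} \<union> {1})" by simp
  have "0 < \<rho>" unfolding \<rho>_def using \<rho>1 \<rho>2 fin by (subst Min_gr_iff) auto
  from enters_side[OF sa \<sigma> this zero_less_one order_refl] obtain i where b: "bad ((fc a ^^ i) (v a)) \<rho>"
    unfolding bad_def by blast
  show False
  proof (cases "i < i0 + n * JJ")
    case True
    then have "\<rho> \<le> \<rho>2 ((fc a ^^ i) (v a))" unfolding \<rho>_def using fin by (intro Min_le) auto
    then show False using badmono[OF b] \<rho>2 by blast
  next
    case False
    define s where "s = (i - i0) mod n"
    define j where "j = (i - i0) div n"
    have s: "s < n" using n by (simp add: s_def)
    have i: "i = s + (i0 + n * j)" using False by (simp add: s_def j_def)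
    have "n * JJ \<le> i - i0" using False by simp
    then have "JJ \<le> j" using n by (simp add: j_def less_eq_div_iff_mult_less_eq mult.commute)
    moreover have "J s \<le> JJ" unfolding JJ_def using s by (intro member_le_sum) auto
    ultimately have "J s \<le> j" by simp
    have "\<rho> \<le> \<rho>1 s" unfolding \<rho>_def using fin s by (intro Min_le) auto
    obtain l where l: "(fc a ^^ (i0 + n * j)) (v a) = w j + of_int l" using w(1) by blast
    have "(fc a ^^ i) (v a) = (fc a ^^ s) (w j) + of_int (2 ^ s * l)"
      unfolding i funpow_add[where m = s and n = "i0 + n * j"] comp_apply l funpow_fc_add_int ..
    then obtain l' :: int where "norm ((fc a ^^ s) (w j) + of_int (2 ^ s * l) + of_int l' - of_real p) < \<rho>"
      "0 < \<sigma> * Re ((fc a ^^ s) (w j) + of_int (2 ^ s * l) + of_int l' - of_real p)" using b unfolding bad_def by auto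
    then have "bad ((fc a ^^ s) (w j)) \<rho>" unfolding bad_def
      by (intro exI[of _ "2 ^ s * l + l'"]) (simp add: add.assoc)
    then show False using badmono[OF _ \<open>\<rho> \<le> \<rho>1 s\<close>] \<rho>1[OF s] \<open>J s \<le> j\<close> by blast
  qed
qed

text \<open>
  The critical orbit converges to the cycle of \<open>y\<close>, which does not contain
  \<open>p\<close> since the multipliers differ.
\<close>

theorem attracting_excludes_neutral_side:
  assumes n: "0 < n" and y: "(f a ^^ n) y = y + of_int k" "P a n y < 1"
    and sa: "side_attracting \<sigma> a n' k' p" and \<sigma>: "\<sigma> = 1 \<or> \<sigma> = - 1"
  shows False
proof -
  obtain w i0 where w: "\<And>j. \<exists>l. (fc a ^^ (i0 + n * j)) (v a) = w j + of_int l" "w \<longlonglongrightarrow> of_real y"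
    using trapped_attracting[OF n y] by blast
  show False
  proof (rule captured_elsewhere[OF n w sa \<sigma>])
    fix s l assume "(f a ^^ s) y + of_int l = p"
    then have p: "p = (f a ^^ s) y + of_int l" by simp
    have n': "0 < n'" and pp: "(f a ^^ n') p = p + of_int k'" and P1: "P a n' p = 1" using sa by (auto simp: side_attracting_def)
    have fp: "(f a ^^ n) p = p + of_int (2 ^ s * k + 2 ^ n * l - l)"
    proof -
      have "(f a ^^ n) ((f a ^^ s) y) = (f a ^^ s) ((f a ^^ n) y)"
        by (metis add.commute comp_apply funpow_add)
      then show ?thesis by (simp add: p lift.funpow_add_int y(1))
    qed
    have "P a n p = P a n y" using lift.P_periodic_orbit[OF y(1), of s] by (simp add: p lift.P_add_int)
    moreover have "P a (n' * n) p = P a n p ^ n'" by (rule lift.P_periodic_power[OF fp])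
    moreover have "P a (n * n') p = P a n' p ^ n" by (rule lift.P_periodic_power[OF pp])
    ultimately have "P a n y ^ n' = 1" using P1 by (simp add: mult.commute)
    moreover have "P a n y ^ n' < 1" using y(2) n' lift.P_pos[of a n y] by (simp add: power_less_one_iff)
    ultimately show "\<forall>\<^sub>F j in sequentially. \<sigma> * Re ((fc a ^^ s) (w j) + of_int l - of_real p) \<le> 0" by simp
  qed
qed

text \<open>
  The critical orbit converges to the cycle of \<open>y\<close> in a sector on the right side. The
  iterates of \<open>f a\<close> have positive derivative, so that the orbit stays on the right
  of every point of this cycle; if \<open>p\<close> is one of them, it is not approached from the
  left.
\<close>

theorem opposite_neutral_sides:
  assumes sa: "side_attracting 1 a n k y" and sa': "side_attracting (- 1) a n' k' p"
  shows False
proof -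
  have n: "0 < n" using sa by (auto simp: side_attracting_def)
  obtain w i0 where w: "\<And>j. \<exists>l. (fc a ^^ (i0 + n * j)) (v a) = w j + of_int l" "w \<longlonglongrightarrow> of_real y"
    and side: "\<And>j. 0 < Re (w j - of_real y)" "\<And>j. norm (w j - of_real y) \<le> 2 * Re (w j - of_real y)"
    using trapped_side[OF sa] by (auto simp del: complex_Re_of_int)
  show False
  proof (rule captured_elsewhere[OF n w sa'])
    fix s l assume p: "(f a ^^ s) y + of_int l = p"
    define \<mu> where "\<mu> = P a s y"
    have \<mu>: "0 < \<mu>" unfolding \<mu>_def by (rule lift.P_pos)
    have "((\<lambda>h. ((fc a ^^ s) (of_real y + h) - (fc a ^^ s) (of_real y)) / h) \<longlongrightarrow> of_real \<mu>) (at 0)"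
      using deriv_funpow_fc_real[where n = s and x = y] unfolding DERIV_def \<mu>_def .
    moreover have "filterlim (\<lambda>j. w j - of_real y) (at 0) sequentially"
    proof -
      have "w j \<noteq> of_real y" for j using side(1)[of j] by auto
      then show ?thesis using w(2) by (simp add: filterlim_at LIM_zero_iff)
    qed
    ultimately have "(\<lambda>j. ((fc a ^^ s) (of_real y + (w j - of_real y)) - (fc a ^^ s) (of_real y)) / (w j - of_real y)) \<longlonglongrightarrow> of_real \<mu>"
      by (rule filterlim_compose)
    then have "(\<lambda>j. ((fc a ^^ s) (w j) - (fc a ^^ s) (of_real y)) / (w j - of_real y)) \<longlonglongrightarrow> of_real \<mu>" by simp
    from tendstoD[OF this, of "\<mu> / 4"] \<mu>
    have "\<forall>\<^sub>F j in sequentially. norm (((fc a ^^ s) (w j) - (fc a ^^ s) (of_real y)) / (w j - of_real y) - of_real \<mu>) < \<mu> / 4"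
      by (simp add: dist_norm)
    then show "\<forall>\<^sub>F j in sequentially. - 1 * Re ((fc a ^^ s) (w j) + of_int l - of_real p) \<le> 0"
    proof eventually_elim
      case (elim j)
      define h where "h = w j - of_real y"
      define e where "e = ((fc a ^^ s) (w j) - (fc a ^^ s) (of_real y)) / h - of_real \<mu>"
      have h: "0 < Re h" "norm h \<le> 2 * Re h" "h \<noteq> 0" using side[of j] by (auto simp: h_def)
      have e: "norm e < \<mu> / 4" using elim by (simp add: e_def h_def)
      have "(fc a ^^ s) (w j) - (fc a ^^ s) (of_real y) = of_real \<mu> * h + e * h" using h(3) by (simp add: e_def field_simps)
      moreover have "(fc a ^^ s) (of_real y) = of_real p - of_int l" using p by (simp add: funpow_fc_of_real flip: p)
      ultimately have "(fc a ^^ s) (w j) + of_int l - of_real p = of_real \<mu> * h + e * h" by (simp add: algebra_simps)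
      then have "Re ((fc a ^^ s) (w j) + of_int l - of_real p) = \<mu> * Re h + Re (e * h)" by simp
      moreover have "\<bar>Re (e * h)\<bar> \<le> \<mu> / 4 * (2 * Re h)"
      proof -
        have "\<bar>Re (e * h)\<bar> \<le> norm e * norm h" using abs_Re_le_cmod[of "e * h"] by (simp add: norm_mult)
        also have "\<dots> \<le> \<mu> / 4 * (2 * Re h)" using e h \<mu> by (intro mult_mono) auto
        finally show ?thesis .
      qed
      moreover have "0 < \<mu> * Re h" using \<mu> h(1) by simp
      ultimately show ?case by linarith
    qed
  qed simp
qed

end

section \<open>Attracting and neutral parameters\<close>

lemma countable_if_isolated:
  fixes S :: "real set"
  assumes "\<And>x. x \<in> S \<Longrightarrow> \<exists>\<delta>>0. \<forall>y\<in>S. \<bar>y - x\<bar> < \<delta> \<longrightarrow> y = x"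
  shows "countable S"
proof -
  obtain \<delta> where \<delta>: "\<And>x. x \<in> S \<Longrightarrow> 0 < \<delta> x" "\<And>x y. x \<in> S \<Longrightarrow> y \<in> S \<Longrightarrow> \<bar>y - x\<bar> < \<delta> x \<Longrightarrow> y = x"
    using assms by metis
  obtain \<C> where \<C>: "\<C> \<subseteq> (\<lambda>x. ball x (\<delta> x)) ` S" "countable \<C>" "\<Union>\<C> = \<Union>((\<lambda>x. ball x (\<delta> x)) ` S)"
    using Lindelof[of "(\<lambda>x. ball x (\<delta> x)) ` S"] by auto
  have "countable (\<Union>B\<in>\<C>. B \<inter> S)"
  proof (rule countable_UN[OF \<C>(2)])
    fix B assume "B \<in> \<C>"
    then obtain x where x: "x \<in> S" "B = ball x (\<delta> x)" using \<C>(1) by blast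
    have "B \<inter> S \<subseteq> {x}" using \<delta>(2)[OF x(1)] by (auto simp: x(2) dist_real_def abs_minus_commute)
    then show "countable (B \<inter> S)" by (meson countable_empty countable_insert countable_subset)
  qed
  moreover have "S \<subseteq> (\<Union>B\<in>\<C>. B \<inter> S)"
  proof
    fix x assume x: "x \<in> S"
    then have "x \<in> \<Union>\<C>" unfolding \<C>(3) using \<delta>(1)[OF x] by (intro UN_I[of x]) auto
    then show "x \<in> (\<Union>B\<in>\<C>. B \<inter> S)" using x by blast
  qed
  ultimately show ?thesis by (rule countable_subset[rotated])
qed

text \<open>
  Otherwise the complements of the points of \<open>S\<close> would be countably many dense open
  subsets of \<open>S\<close> with empty intersection.
\<close>

lemma countable_closed_isolated_point:
  fixes S :: "real set"
  assumes "closed S" "countable S" "S \<noteq> {}"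
  shows "\<exists>x\<in>S. \<exists>\<delta>>0. \<forall>y\<in>S. \<bar>y - x\<bar> < \<delta> \<longrightarrow> y = x"
proof -
  have "\<exists>x\<in>S. x \<notin> closure (S - {x})"
  proof (rule ccontr)
    assume dense: "\<not> ?thesis"
    have "S \<subseteq> closure (\<Inter>((\<lambda>x. S - {x}) ` S))"
    proof (rule Baire[OF assms(1)])
      show "countable ((\<lambda>x. S - {x}) ` S)" using assms(2) by (rule countable_image)
      fix T assume "T \<in> (\<lambda>x. S - {x}) ` S"
      then obtain x where x: "x \<in> S" "T = S - {x}" by blast
      have "openin (top_of_set S) (S \<inter> - {x})" by (intro openin_open_Int open_Compl closed_singleton)
      moreover have "S \<inter> - {x} = T" by (auto simp: x(2))
      moreover have "S \<subseteq> closure T"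
      proof
        fix y assume "y \<in> S"
        then show "y \<in> closure T" using dense x closure_subset[of T] by (cases "y = x") auto
      qed
      ultimately show "openin (top_of_set S) T \<and> S \<subseteq> closure T" by simp
    qed
    moreover have "\<Inter>((\<lambda>x. S - {x}) ` S) = {}" using assms(3) by blast
    ultimately show False using assms(3) by simp
  qed
  then obtain x where x: "x \<in> S" "x \<notin> closure (S - {x})" by blast
  then obtain \<delta> where "0 < \<delta>" "\<forall>y\<in>S - {x}. \<not> dist y x < \<delta>" unfolding closure_approachable by blast
  then show ?thesis using x(1) by (intro bexI[of _ x] exI[of _ \<delta>]) (auto simp: dist_real_def)
qed

context double_standard_family
begin

definition attracting_point :: "real \<Rightarrow> nat \<Rightarrow> int \<Rightarrow> real \<Rightarrow> bool"
  where "attracting_point a n k x \<longleftrightarrow> 0 < n \<and> (f a ^^ n) x = x + of_int k \<and> P a n x < 1"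

definition attracting_parameter :: "real \<Rightarrow> bool"
  where "attracting_parameter a \<longleftrightarrow> (\<exists>n k x. attracting_point a n k x)"

definition expanding_parameter :: "real \<Rightarrow> bool"
  where "expanding_parameter a \<longleftrightarrow> (\<exists>C>0. \<exists>\<kappa>>0. \<forall>n x. C * exp (\<kappa> * real n) \<le> P a n x)"

lemma parameter_unique:
  assumes "0 < n" "(f a ^^ n) x = y" "(f a' ^^ n) x = y"
  shows "a = a'"
  using f_mono_param[of a a' x x n] f_mono_param[of a' a x x n] assms by (cases "a \<le> a'") auto

lemma expanding_not_attracting:
  assumes "expanding_parameter a"
  shows "\<not> attracting_parameter a"
proof
  assume "attracting_parameter a"
  then obtain n k p where p: "0 < n" "(f a ^^ n) p = p + of_int k" "P a n p < 1"
    unfolding attracting_parameter_def attracting_point_def by blast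
  obtain C \<kappa> where C: "0 < C" "0 < \<kappa>" "\<And>n x. C * exp (\<kappa> * real n) \<le> P a n x"
    using assms unfolding expanding_parameter_def by blast
  have "C \<le> P a n p ^ t" for t
  proof -
    have "C * 1 \<le> C * exp (\<kappa> * real (t * n))" using C by (intro mult_left_mono) auto
    also have "\<dots> \<le> P a n p ^ t" using C(3)[of "t * n" p] by (simp only: lift.P_periodic_power[OF p(2)])
    finally show ?thesis by simp
  qed
  moreover have "(\<lambda>t. P a n p ^ t) \<longlonglongrightarrow> 0" using p(3) lift.P_pos[of a n p] by (intro LIMSEQ_power_zero) auto
  ultimately have "C \<le> 0" by (intro LIMSEQ_le_const) auto
  then show False using C(1) by simp
qed

lemma expanding_or_nonrepelling:
  assumes "\<not> expanding_parameter a"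
  shows "attracting_parameter a \<or> (\<exists>n k x. 0 < n \<and> (f a ^^ n) x = x + of_int k \<and> P a n x = 1)"
proof (rule ccontr)
  assume neg: "\<not> ?thesis"
  interpret rep: repelling_lift "f a" "ds_lift1 b" "\<lambda>x. - 4 * pi * b * sin (2 * pi * x)"
    "\<lambda>x. - 8 * pi\<^sup>2 * b * cos (2 * pi * x)" "2 - 2 * b" "8 * pi\<^sup>2 * b"
  proof
    fix n x k assume nx: "0 < n" "(f a ^^ n) x = x + of_int k"
    then have "\<not> P a n x < 1" "P a n x \<noteq> 1"
      using neg unfolding attracting_parameter_def attracting_point_def by blast+
    then show "1 < P a n x" by linarith
  qed
  show False using rep.repelling_imp_expanding assms unfolding expanding_parameter_def by blast
qed

lemma attracting_point_persists:
  assumes "attracting_point a n k p"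
  shows "\<forall>\<^sub>F a' in nhds a. \<exists>x. attracting_point a' n k x"
proof -
  have n: "0 < n" and p: "(f a ^^ n) p = p + of_int k" "P a n p < 1" using assms by (auto simp: attracting_point_def)
  obtain L where L: "0 \<le> L" "\<And>a' x. \<bar>P a n p - P a' n x\<bar> \<le> L * (\<bar>p - x\<bar> + \<bar>a - a'\<bar>)"
    using P_Lipschitz[of n] by blast
  (* Within the distance h of p, and for parameters within h of a, the derivative stays below 1. *)
  define h where "h = (1 - P a n p) / (2 * (L + 1))"
  have h: "0 < h" using L(1) p(2) by (simp add: h_def)
  have small: "P a' n x < 1" if "\<bar>x - p\<bar> \<le> h" "\<bar>a' - a\<bar> < h" for a' x
  proof -
    have "\<bar>P a n p - P a' n x\<bar> \<le> L * (2 * h)"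
      using L(2)[of a' x] that mult_left_mono[OF _ L(1), of "\<bar>p - x\<bar> + \<bar>a - a'\<bar>" "2 * h"] by linarith
    moreover have "2 * (L + 1) * h = 1 - P a n p"
      unfolding h_def times_divide_eq_right using L(1) by (intro nonzero_mult_div_cancel_left) simp
    ultimately show ?thesis using h by (simp add: algebra_simps)
  qed
  define G where "G a' x = (f a' ^^ n) x - x - of_int k" for a' x
  have dG: "(G a has_real_derivative P a n x - 1) (at x)" for x
    unfolding G_def by (auto intro!: derivative_eq_intros lift.DERIV_funpow)
  have dec: "G a y < G a x" if "x < y" "p - h \<le> x" "y \<le> p + h" for x y
  proof (rule DERIV_neg_imp_decreasing[OF that(1)])
    fix t assume "x \<le> t" "t \<le> y"
    then have "P a n t < 1" using that h by (intro small) auto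
    then show "\<exists>D. (G a has_real_derivative D) (at t) \<and> D < 0" using dG[of t] by (intro exI[of _ "P a n t - 1"]) simp
  qed
  have "G a p = 0" by (simp add: G_def p)
  then have ends: "0 < G a (p - h)" "G a (p + h) < 0" using dec[of "p - h" p] dec[of p "p + h"] h by auto
  have lim: "((\<lambda>a'. G a' x) \<longlongrightarrow> G a x) (nhds a)" for x
    unfolding G_def by (intro tendsto_diff tendsto_f tendsto_const filterlim_ident)
  have "\<forall>\<^sub>F a' in nhds a. 0 < G a' (p - h)" "\<forall>\<^sub>F a' in nhds a. G a' (p + h) < 0"
    using order_tendstoD[OF lim] ends by blast+
  moreover have "\<forall>\<^sub>F a' in nhds a. \<bar>a' - a\<bar> < h"
    using tendstoD[OF filterlim_ident h, of a] by (simp add: dist_real_def)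
  ultimately show ?thesis
  proof eventually_elim
    case (elim a')
    have "\<exists>x. p - h \<le> x \<and> x \<le> p + h \<and> G a' x = 0"
      using elim h unfolding G_def
      by (intro IVT2' continuous_intros lift.continuous_on_funpow) auto
    then obtain x where x: "p - h \<le> x" "x \<le> p + h" "G a' x = 0" by blast
    then show ?case using n small[of x a'] elim by (intro exI[of _ x]) (auto simp: attracting_point_def G_def)
  qed
qed

lemma open_attracting_parameters: "open {a. attracting_parameter a}"
proof (rule openI)
  fix a assume "a \<in> {a. attracting_parameter a}"
  then obtain n k p where "attracting_point a n k p" by (auto simp: attracting_parameter_def)
  from attracting_point_persists[OF this] obtain T where T: "open T" "a \<in> T" "\<And>a'. a' \<in> T \<Longrightarrow> \<exists>x. attracting_point a' n k x"
    unfolding eventually_nhds by blast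
  then obtain e where "0 < e" "ball a e \<subseteq> T" by (meson openE)
  then show "\<exists>e>0. ball a e \<subseteq> {a. attracting_parameter a}"
    using T(3) unfolding attracting_parameter_def by blast
qed

lemma countable_neutral_parameters:
  "countable {a. \<exists>n k x. 0 < n \<and> (f a ^^ n) x = x + of_int k \<and> P a n x = 1}" (is "countable ?N")
proof -
  define S where "S n k = {x. \<exists>a. (f a ^^ n) x = x + of_int k \<and> P a n x = 1}" for n and k :: int
  define par where "par n k x = (THE a. (f a ^^ n) x = x + of_int k)" for n and k :: int and x
  have "countable (S n k)" if n: "0 < n" for n k
  proof (rule countable_if_isolated)
    fix x assume "x \<in> S n k"
    then obtain a where a: "(f a ^^ n) x = x + of_int k" by (auto simp: S_def)
    from near_periodic_point[OF n this] obtain \<delta> where \<delta>: "0 < \<delta>"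
      "\<And>y a'. 0 < \<bar>y - x\<bar> \<Longrightarrow> \<bar>y - x\<bar> < \<delta> \<Longrightarrow> (f a' ^^ n) y = y + of_int k \<Longrightarrow>
         0 < (P a' n y - 1) * ((f a ^^ n) y - y - of_int k) * (y - x)" by blast
    have "y = x" if y: "y \<in> S n k" "\<bar>y - x\<bar> < \<delta>" for y
    proof (rule ccontr)
      assume "y \<noteq> x"
      moreover obtain a' where "(f a' ^^ n) y = y + of_int k" "P a' n y = 1" using y(1) by (auto simp: S_def)
      ultimately show False using \<delta>(2)[of y a'] y(2) by simp
    qed
    then show "\<exists>\<delta>>0. \<forall>y\<in>S n k. \<bar>y - x\<bar> < \<delta> \<longrightarrow> y = x" using \<delta>(1) by blast
  qed
  then have "countable (\<Union>n\<in>{0<..}. \<Union>k. par n k ` S n k)" by (intro countable_UN countable_image) auto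
  moreover have "?N \<subseteq> (\<Union>n\<in>{0<..}. \<Union>k. par n k ` S n k)"
  proof
    fix a assume "a \<in> ?N"
    then obtain n k x where x: "0 < n" "(f a ^^ n) x = x + of_int k" "P a n x = 1" by blast
    have "par n k x = a" unfolding par_def using parameter_unique[OF x(1) _ x(2)] by (intro the_equality x(2))
    moreover have "x \<in> S n k" using x by (auto simp: S_def)
    ultimately have "a \<in> par n k ` S n k" by blast
    then show "a \<in> (\<Union>n\<in>{0<..}. \<Union>k. par n k ` S n k)" using x(1) by blast
  qed
  ultimately show ?thesis by (rule countable_subset[rotated])
qed

text \<open>
  By \<open>near_periodic_point\<close> the displacement
  \<open>(f a ^^ n) x - x - k\<close> has no zero other than \<open>p\<close> near
  \<open>p\<close>, and at \<open>y\<close> it points towards \<open>p\<close>. So it does at all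
  points between \<open>y\<close> and \<open>p\<close>, and beyond \<open>y\<close> up to the
  distance \<open>\<delta>\<close>.
\<close>

lemma attracting_near_neutral:
  assumes n: "0 < n" and p: "(f a ^^ n) p = p + of_int k" "P a n p = 1"
  shows "\<exists>\<delta>>0. \<forall>a' y. attracting_point a' n k y \<and> \<bar>y - p\<bar> < \<delta> \<longrightarrow>
    (p < y \<and> (f a ^^ n) y < y + of_int k \<and> side_attracting 1 a n k p) \<or>
    (y < p \<and> y + of_int k < (f a ^^ n) y \<and> side_attracting (- 1) a n k p)"
proof -
  obtain \<delta> where \<delta>: "0 < \<delta>" "\<And>x. 0 < \<bar>x - p\<bar> \<Longrightarrow> \<bar>x - p\<bar> < \<delta> \<Longrightarrow> (f a ^^ n) x - x - of_int k \<noteq> 0"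
    "\<And>y a'. 0 < \<bar>y - p\<bar> \<Longrightarrow> \<bar>y - p\<bar> < \<delta> \<Longrightarrow> (f a' ^^ n) y = y + of_int k \<Longrightarrow>
         0 < (P a' n y - 1) * ((f a ^^ n) y - y - of_int k) * (y - p)"
    using near_periodic_point[OF n p(1)] by blast
  define G where "G x = (f a ^^ n) x - x - of_int k" for x
  have cont: "continuous_on S G" for S unfolding G_def by (intro continuous_intros lift.continuous_on_funpow)
  have ne: "G x \<noteq> 0" if "x \<noteq> p" "\<bar>x - p\<bar> < \<delta>" for x using \<delta>(2)[of x] that by (auto simp: G_def)
  have "(p < y \<and> G y < 0 \<and> side_attracting 1 a n k p) \<or> (y < p \<and> 0 < G y \<and> side_attracting (- 1) a n k p)"
    if y: "attracting_point a' n k y" "\<bar>y - p\<bar> < \<delta>" for a' y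
  proof -
    have y1: "(f a' ^^ n) y = y + of_int k" "P a' n y < 1" using y(1) by (auto simp: attracting_point_def)
    have "y \<noteq> p"
    proof
      assume "y = p"
      then have "a' = a" using parameter_unique[OF n y1(1)] p(1) by simp
      then show False using y1(2) p(2) \<open>y = p\<close> by simp
    qed
    then have "0 < (P a' n y - 1) * (G y * (y - p))" using \<delta>(3)[OF _ y(2) y1(1)] by (simp add: G_def mult.assoc)
    then have sg: "G y * (y - p) < 0" using y1(2) by (simp add: zero_less_mult_iff)
    show ?thesis
    proof (cases "p < y")
      case True
      then have Gy: "G y < 0" using sg by (simp add: mult_less_0_iff)
      have "G (p + t) < 0" if t: "0 < t" "t < \<delta>" for t
      proof (rule ccontr)
        assume "\<not> G (p + t) < 0"
        then have "0 \<in> closed_segment (G y) (G (p + t))" using Gy by (simp add: closed_segment_eq_real_ivl)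
        from IVT'_closed_segment_real[OF this cont] obtain x where "x \<in> closed_segment y (p + t)" "G x = 0" by blast
        then show False using ne[of x] True y(2) t by (auto simp: closed_segment_eq_real_ivl split: if_splits)
      qed
      then have "1 * ((f a ^^ n) (p + 1 * t) - of_int k - p) < t" if "0 < t" "t < \<delta>" for t
        using that by (fastforce simp: G_def)
      then show ?thesis using n p \<delta>(1) True Gy unfolding side_attracting_def by blast
    next
      case False
      then have "y < p" using \<open>y \<noteq> p\<close> by simp
      then have Gy: "0 < G y" using sg by (simp add: mult_less_0_iff)
      have "0 < G (p - t)" if t: "0 < t" "t < \<delta>" for t
      proof (rule ccontr)
        assume "\<not> 0 < G (p - t)"
        then have "0 \<in> closed_segment (G y) (G (p - t))" using Gy by (simp add: closed_segment_eq_real_ivl)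
        from IVT'_closed_segment_real[OF this cont] obtain x where "x \<in> closed_segment y (p - t)" "G x = 0" by blast
        then show False using ne[of x] \<open>y < p\<close> y(2) t by (auto simp: closed_segment_eq_real_ivl split: if_splits)
      qed
      then have "- 1 * ((f a ^^ n) (p + - 1 * t) - of_int k - p) < t" if "0 < t" "t < \<delta>" for t
        using that by (fastforce simp: G_def)
      then show ?thesis using n p \<delta>(1) \<open>y < p\<close> Gy unfolding side_attracting_def by blast
    qed
  qed
  then show ?thesis using \<delta>(1) unfolding G_def by (intro exI[of _ \<delta>]) (fastforce simp: algebra_simps)
qed

lemma attracting_point_add_int:
  "attracting_point a n k x \<Longrightarrow> attracting_point a n (k + (2 ^ n - 1) * m) (x + of_int m)"
  by (simp add: attracting_point_def lift.funpow_add_int lift.P_add_int algebra_simps)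

text \<open>
  A limit point \<open>p\<close> of attracting points has multiplier at most 1, and if it is
  neutral then it attracts from the side from which it is approached. For
  \<open>u i < a\<close> the map \<open>f a ^^ n\<close> moves the attracting points of
  \<open>u i\<close> upwards, so that they lie on the left of \<open>p\<close>.
\<close>

lemma limit_of_attracting:
  assumes u: "\<And>i. \<exists>k x. attracting_point (u i) n k x" and lim: "u \<longlonglongrightarrow> a"
  shows "(\<exists>k x. attracting_point a n k x) \<or>
    (\<exists>\<sigma> k p. (\<sigma> = 1 \<or> \<sigma> = - 1) \<and> side_attracting \<sigma> a n k p \<and> ((\<forall>i. u i < a) \<longrightarrow> \<sigma> = - 1))"
proof -
  have n: "0 < n" using u[of 0] by (auto simp: attracting_point_def)
  (* An integer translation changes k, so that k may depend on i; it is eventually constant because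
     it converges. *)
  have "\<exists>k x. x \<in> {0..1} \<and> attracting_point (u i) n k x" for i
  proof -
    obtain k x where kx: "attracting_point (u i) n k x" using u by blast
    have "x + of_int (- \<lfloor>x\<rfloor>) \<in> {0..1}" by auto linarith+
    then show ?thesis using attracting_point_add_int[OF kx, of "- \<lfloor>x\<rfloor>"] by blast
  qed
  then obtain k x where x: "\<And>i. x i \<in> {0..1}" "\<And>i. attracting_point (u i) n (k i) (x i)" by metis
  obtain p r where r: "strict_mono r" "(x \<circ> r) \<longlonglongrightarrow> p"
    using compact_Icc[of "0::real" 1] x(1) unfolding compact_def by metis
  have ulim: "(\<lambda>i. u (r i)) \<longlonglongrightarrow> a" using LIMSEQ_subseq_LIMSEQ[OF lim r(1)] by (simp add: comp_def)
  have xlim: "(\<lambda>i. x (r i)) \<longlonglongrightarrow> p" using r(2) by (simp add: comp_def)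
  have "(\<lambda>i. (f (u (r i)) ^^ n) (x (r i)) - x (r i)) \<longlonglongrightarrow> (f a ^^ n) p - p"
    by (intro tendsto_diff tendsto_f ulim xlim)
  moreover have "(f (u (r i)) ^^ n) (x (r i)) - x (r i) = of_int (k (r i))" for i
    using x(2)[of "r i"] by (simp add: attracting_point_def)
  ultimately have klim: "(\<lambda>i. real_of_int (k (r i))) \<longlonglongrightarrow> (f a ^^ n) p - p" by simp
  have "(f a ^^ n) p - p \<in> \<int>"
    by (rule closed_sequentially[OF closed_Ints _ klim]) simp
  then obtain K where K: "(f a ^^ n) p - p = of_int K" by (auto elim: Ints_cases)
  have "\<forall>\<^sub>F i in sequentially. \<bar>real_of_int (k (r i)) - of_int K\<bar> < 1"
    using tendstoD[OF klim, of 1] by (simp add: K dist_real_def)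
  then have kev: "\<forall>\<^sub>F i in sequentially. k (r i) = K" by eventually_elim linarith
  have p: "(f a ^^ n) p = p + of_int K" using K by simp
  have "(\<lambda>i. P (u (r i)) n (x (r i))) \<longlonglongrightarrow> P a n p" by (intro tendsto_P ulim xlim)
  then have "P a n p \<le> 1" by (rule LIMSEQ_le_const2) (use x(2) in \<open>auto simp: attracting_point_def intro: less_imp_le\<close>)
  show ?thesis
  proof (cases "P a n p < 1")
    case True
    then show ?thesis using n p by (auto simp: attracting_point_def)
  next
    case False
    then have "P a n p = 1" using \<open>P a n p \<le> 1\<close> by simp
    from attracting_near_neutral[OF n p this] obtain \<delta> where \<delta>: "0 < \<delta>"
      "\<And>a' y. attracting_point a' n K y \<Longrightarrow> \<bar>y - p\<bar> < \<delta> \<Longrightarrow>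
        (p < y \<and> (f a ^^ n) y < y + of_int K \<and> side_attracting 1 a n K p) \<or>
        (y < p \<and> y + of_int K < (f a ^^ n) y \<and> side_attracting (- 1) a n K p)" by blast
    have "\<forall>\<^sub>F i in sequentially. \<bar>x (r i) - p\<bar> < \<delta>" using tendstoD[OF xlim \<delta>(1)] by (simp add: dist_real_def)
    from eventually_conj[OF this kev] obtain i where i: "\<bar>x (r i) - p\<bar> < \<delta>" "k (r i) = K"
      unfolding eventually_sequentially by blast
    have at: "attracting_point (u (r i)) n K (x (r i))" using x(2)[of "r i"] i(2) by simp
    from \<delta>(2)[OF at i(1)] show ?thesis
    proof
      assume right: "p < x (r i) \<and> (f a ^^ n) (x (r i)) < x (r i) + of_int K \<and> side_attracting 1 a n K p"
      have "\<not> u (r i) < a"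
      proof
        assume "u (r i) < a"
        then have "(f (u (r i)) ^^ n) (x (r i)) < (f a ^^ n) (x (r i))"
          using f_mono_param[of "u (r i)" a "x (r i)" "x (r i)" n] n by linarith
        then show False using at right by (auto simp: attracting_point_def)
      qed
      then show ?thesis using right by blast
    qed blast
  qed
qed

text \<open>
  The parameters of the interval that have an attracting point of period \<open>n\<close> form an
  open set. It is also relatively closed, since in the limit the point could only become neutral
  with an attracting side, which the attracting orbit of the limit parameter forbids. Hence one
  \<open>n\<close> serves on the whole interval up to \<open>a1\<close>.
\<close>

lemma left_neighbourhood_attracting:
  assumes "0 < \<delta>" and att: "\<And>a. a1 - \<delta> < a \<Longrightarrow> a < a1 \<Longrightarrow> attracting_parameter a"
    and not: "\<not> attracting_parameter a1"
  shows "\<exists>n k p. side_attracting (- 1) a1 n k p"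
proof -
  let ?I = "{a1 - \<delta><..<a1}"
  have "a1 - \<delta> / 2 \<in> ?I" using \<open>0 < \<delta>\<close> by auto
  then obtain n k0 x0 where n: "attracting_point (a1 - \<delta> / 2) n k0 x0"
    using att[of "a1 - \<delta> / 2"] by (auto simp: attracting_parameter_def)
  define A where "A = {a \<in> ?I. \<exists>k x. attracting_point a n k x}"
  have "A = {} \<or> A = ?I"
  proof -
    have "openin (top_of_set ?I) A"
    proof -
      have "open A"
        unfolding open_contains_ball
      proof
        fix a assume a: "a \<in> A"
        then obtain k x where "attracting_point a n k x" by (auto simp: A_def)
        from attracting_point_persists[OF this] have "\<forall>\<^sub>F a' in nhds a. \<exists>x. attracting_point a' n k x" .
        moreover have "\<forall>\<^sub>F a' in nhds a. a' \<in> ?I" using a by (intro eventually_nhds_in_open) (auto simp: A_def)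
        ultimately have "\<forall>\<^sub>F a' in nhds a. a' \<in> A" by eventually_elim (auto simp: A_def)
        then show "\<exists>e>0. ball a e \<subseteq> A" unfolding eventually_nhds_metric by (auto simp: dist_commute subset_eq)
      qed
      then show ?thesis by (rule open_subset[rotated]) (auto simp: A_def)
    qed
    moreover have "closedin (top_of_set ?I) A"
      unfolding closedin_limpt
    proof (intro conjI allI impI)
      show "A \<subseteq> ?I" by (auto simp: A_def)
      fix a assume a: "a islimpt A \<and> a \<in> ?I"
      then obtain u where u: "\<And>i. u i \<in> A - {a}" "u \<longlonglongrightarrow> a" unfolding islimpt_sequential by blast
      have "\<exists>k x. attracting_point (u i) n k x" for i using u(1)[of i] by (simp add: A_def)
      from limit_of_attracting[OF this u(2)] show "a \<in> A"
      proof
        assume "\<exists>k x. attracting_point a n k x"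
        then show ?thesis using a by (simp add: A_def)
      next
        assume "\<exists>\<sigma> k p. (\<sigma> = 1 \<or> \<sigma> = - 1) \<and> side_attracting \<sigma> a n k p \<and> ((\<forall>i. u i < a) \<longrightarrow> \<sigma> = - 1)"
        then obtain \<sigma> k p where s: "\<sigma> = 1 \<or> \<sigma> = - 1" "side_attracting \<sigma> a n k p" by blast
        obtain m l y where "0 < m" "(f a ^^ m) y = y + of_int l" "P a m y < 1"
          using att[of a] a by (auto simp: attracting_parameter_def attracting_point_def)
        then show ?thesis using attracting_excludes_neutral_side s by blast
      qed
    qed
    ultimately show ?thesis using connected_clopen[of ?I] connected_Ioo[of "a1 - \<delta>" a1] by blast
  qed
  moreover have "a1 - \<delta> / 2 \<in> A" using n \<open>a1 - \<delta> / 2 \<in> ?I\<close> by (auto simp: A_def)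
  ultimately have A: "A = ?I" by blast
  define u where "u i = a1 - \<delta> / 2 * inverse (real (Suc i))" for i
  have u: "u i < a1" "a1 - \<delta> < u i" for i
  proof -
    have "0 < inverse (real (Suc i))" "inverse (real (Suc i)) \<le> 1" by (auto simp: inverse_le_1_iff)
    then have "0 < \<delta> / 2 * inverse (real (Suc i))" "\<delta> / 2 * inverse (real (Suc i)) \<le> \<delta> / 2 * 1"
      using \<open>0 < \<delta>\<close> by (auto intro!: mult_pos_pos mult_left_mono simp del: of_nat_Suc)
    then show "u i < a1" "a1 - \<delta> < u i" unfolding u_def using \<open>0 < \<delta>\<close> by linarith+
  qed
  have "(\<lambda>i. a1 - \<delta> / 2 * inverse (real (Suc i))) \<longlonglongrightarrow> a1 - \<delta> / 2 * 0"
    by (intro tendsto_intros LIMSEQ_inverse_real_of_nat)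
  then have lim: "u \<longlonglongrightarrow> a1" by (simp add: u_def[abs_def])
  have "\<exists>k x. attracting_point (u i) n k x" for i
  proof -
    have "u i \<in> A" unfolding A using u[of i] by simp
    then show ?thesis by (simp add: A_def)
  qed
  from limit_of_attracting[OF this lim] obtain \<sigma> k p
    where "side_attracting \<sigma> a1 n k p" "(\<forall>i. u i < a1) \<longrightarrow> \<sigma> = - 1"
    using not unfolding attracting_parameter_def by blast
  then show ?thesis using u(1) by blast
qed

lemma attracting_point_reflect: "attracting_point a n k x \<Longrightarrow> attracting_point (- a) n (- k) (- x)"
  by (simp add: attracting_point_def funpow_reflect P_reflect)

lemma attracting_parameter_reflect: "attracting_parameter (- a) \<longleftrightarrow> attracting_parameter a"
  unfolding attracting_parameter_def using attracting_point_reflect[of a] attracting_point_reflect[of "- a"] by fastforce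

lemma side_attracting_reflect:
  assumes "side_attracting \<sigma> a n k p"
  shows "side_attracting (- \<sigma>) (- a) n (- k) (- p)"
proof -
  obtain \<delta> where \<delta>: "0 < \<delta>" "\<And>x. 0 < x \<Longrightarrow> x < \<delta> \<Longrightarrow> \<sigma> * ((f a ^^ n) (p + \<sigma> * x) - of_int k - p) < x"
    using assms by (auto simp: side_attracting_def)
  have "- \<sigma> * ((f (- a) ^^ n) (- p + - \<sigma> * x) - of_int (- k) - (- p)) < x" if "0 < x" "x < \<delta>" for x
  proof -
    have "(f (- a) ^^ n) (- p + - \<sigma> * x) = - (f a ^^ n) (p + \<sigma> * x)"
      using funpow_reflect[of n a "p + \<sigma> * x"] by simp
    then show ?thesis using \<delta>(2)[OF that] by (simp add: algebra_simps)
  qed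
  then show ?thesis using assms \<delta>(1) unfolding side_attracting_def
    by (intro conjI exI[of _ \<delta>]) (auto simp: funpow_reflect P_reflect)
qed

lemma right_neighbourhood_attracting:
  assumes "0 < \<delta>" and att: "\<And>a. a1 < a \<Longrightarrow> a < a1 + \<delta> \<Longrightarrow> attracting_parameter a"
    and not: "\<not> attracting_parameter a1"
  shows "\<exists>n k p. side_attracting 1 a1 n k p"
proof -
  have "\<exists>n k p. side_attracting (- 1) (- a1) n k p"
  proof (rule left_neighbourhood_attracting[OF assms(1)])
    fix a assume "- a1 - \<delta> < a" "a < - a1"
    then have "attracting_parameter (- a)" by (intro att) auto
    then show "attracting_parameter a" by (simp add: attracting_parameter_reflect)
  qed (simp add: attracting_parameter_reflect not)
  then show ?thesis using side_attracting_reflect[of "- 1" "- a1"] by fastforce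
qed

text \<open>
  The ends \<open>e1\<close> and \<open>e2\<close> are chosen attracting so that an isolated point
  of the set \<open>S\<close> of non-attracting parameters between them is also isolated among all
  non-attracting parameters.
\<close>

theorem expanding_parameters_dense:
  assumes a0: "\<not> attracting_parameter a0" and "0 < \<epsilon>"
  shows "\<exists>a. \<bar>a - a0\<bar> < \<epsilon> \<and> expanding_parameter a"
proof (rule ccontr)
  assume neg: "\<not> ?thesis"
  define N where "N = {a. \<exists>n k x. 0 < n \<and> (f a ^^ n) x = x + of_int k \<and> P a n x = 1}"
  have cN: "countable N" unfolding N_def by (rule countable_neutral_parameters)
  have dich: "attracting_parameter a \<or> a \<in> N" if "\<bar>a - a0\<bar> < \<epsilon>" for a
    unfolding N_def mem_Collect_eq using expanding_or_nonrepelling[of a] neg that by blast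
  have pick: "\<exists>e. l < e \<and> e < r \<and> attracting_parameter e" if "l < r" "a0 - \<epsilon> \<le> l" "r \<le> a0 + \<epsilon>" for l r
  proof (rule ccontr)
    assume none: "\<not> ?thesis"
    have "{l<..<r} \<subseteq> N"
    proof
      fix e assume "e \<in> {l<..<r}"
      then have "l < e" "e < r" "\<bar>e - a0\<bar> < \<epsilon>" using that by auto
      then show "e \<in> N" using dich[of e] none by blast
    qed
    then have "countable {l<..<r}" using cN by (rule countable_subset)
    then show False using uncountable_open_interval[of l r] that(1) by simp
  qed
  obtain e1 where e1: "a0 - \<epsilon> < e1" "e1 < a0" "attracting_parameter e1" using pick[of "a0 - \<epsilon>" a0] \<open>0 < \<epsilon>\<close> by auto
  obtain e2 where e2: "a0 < e2" "e2 < a0 + \<epsilon>" "attracting_parameter e2" using pick[of a0 "a0 + \<epsilon>"] \<open>0 < \<epsilon>\<close> by auto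
  define S where "S = {e1..e2} \<inter> - {a. attracting_parameter a}"
  have "closed S" unfolding S_def using open_attracting_parameters by (intro closed_Int closed_atLeastAtMost) (simp add: closed_open)
  moreover have "S \<subseteq> N"
  proof
    fix a assume "a \<in> S"
    then have "\<not> attracting_parameter a" "\<bar>a - a0\<bar> < \<epsilon>" using e1 e2 by (auto simp: S_def)
    then show "a \<in> N" using dich by blast
  qed
  then have "countable S" using cN by (rule countable_subset)
  moreover have "a0 \<in> S" using a0 e1 e2 by (simp add: S_def)
  ultimately obtain a1 \<delta> where a1: "a1 \<in> S" "0 < \<delta>" "\<And>y. y \<in> S \<Longrightarrow> \<bar>y - a1\<bar> < \<delta> \<Longrightarrow> y = a1"
    using countable_closed_isolated_point[of S] by blast
  have n1: "\<not> attracting_parameter a1" using a1(1) by (simp add: S_def)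
  then have "a1 \<noteq> e1" "a1 \<noteq> e2" using e1(3) e2(3) by auto
  then have b1: "e1 < a1" "a1 < e2" using a1(1) by (auto simp: S_def)
  define d where "d = min \<delta> (min (a1 - e1) (e2 - a1))"
  have d: "0 < d" "d \<le> \<delta>" "d \<le> a1 - e1" "d \<le> e2 - a1" using a1(2) b1 by (auto simp: d_def)
  have near: "attracting_parameter a" if "a \<noteq> a1" "\<bar>a - a1\<bar> < d" for a
  proof (rule ccontr)
    assume "\<not> attracting_parameter a"
    moreover have "e1 \<le> a" "a \<le> e2" using that d by linarith+
    ultimately have "a \<in> S" by (simp add: S_def)
    then show False using a1(3) that d by fastforce
  qed
  obtain n k p where "side_attracting (- 1) a1 n k p"
    using left_neighbourhood_attracting[OF d(1) _ n1] near by fastforce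
  moreover obtain n' k' p' where "side_attracting 1 a1 n' k' p'"
    using right_neighbourhood_attracting[OF d(1) _ n1] near by fastforce
  ultimately show False using opposite_neutral_sides by blast
qed

end

section \<open>Passage to the circle\<close>

lemma proj_exhaust: obtains x where "p = proj x"
  by (induct p rule: circle.abs_induct) blast

lemma double_standard_proj: "double_standard (proj a) b (proj x) = proj (ds_lift b a x)"
  by (simp add: double_standard.abs_eq ds_lift_def)

lemma funpow_double_standard: "(double_standard (proj a) b ^^ n) (proj x) = proj ((ds_lift b a ^^ n) x)"
  by (induction n) (simp_all add: double_standard_proj)

lemma circle_deriv_double_standard:
  assumes "((ds_lift b a ^^ n) has_real_derivative D) (at x)"
  shows "circle_deriv (double_standard (proj a) b ^^ n) (proj x) = D"
  by (rule circle_deriv_eqI, unfold has_circle_derivative_def, intro exI[of _ "ds_lift b a ^^ n"] exI[of _ x])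
    (simp add: funpow_double_standard assms)

lemma has_attracting_orbit_lift:
  assumes D: "\<And>n x. ((ds_lift b a ^^ n) has_real_derivative D n x) (at x)"
  shows "has_attracting_orbit (double_standard (proj a) b) \<longleftrightarrow>
    (\<exists>n k x. 0 < n \<and> (ds_lift b a ^^ n) x = x + of_int k \<and> \<bar>D n x\<bar> < 1)"
proof
  assume "has_attracting_orbit (double_standard (proj a) b)"
  then obtain p n where p: "0 < n" "(double_standard (proj a) b ^^ n) p = p"
    "\<bar>circle_deriv (double_standard (proj a) b ^^ n) p\<bar> < 1"
    unfolding has_attracting_orbit_def by blast
  obtain x where x: "p = proj x" by (rule proj_exhaust)
  have "(ds_lift b a ^^ n) x - x \<in> \<int>"
    using p(2) unfolding x funpow_double_standard by (simp add: proj_eq_iff)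
  then obtain k where "(ds_lift b a ^^ n) x - x = of_int k" by (elim Ints_cases)
  then have "(ds_lift b a ^^ n) x = x + of_int k" by simp
  moreover have "\<bar>D n x\<bar> < 1" using p(3) by (simp add: x circle_deriv_double_standard[OF D])
  ultimately show "\<exists>n k x. 0 < n \<and> (ds_lift b a ^^ n) x = x + of_int k \<and> \<bar>D n x\<bar> < 1" using p(1) by blast
next
  assume "\<exists>n k x. 0 < n \<and> (ds_lift b a ^^ n) x = x + of_int k \<and> \<bar>D n x\<bar> < 1"
  then obtain n k x where x: "0 < n" "(ds_lift b a ^^ n) x = x + of_int k" "\<bar>D n x\<bar> < 1" by blast
  have "(double_standard (proj a) b ^^ n) (proj x) = proj x"
    unfolding funpow_double_standard x(2) by (simp add: proj_eq_iff)
  then show "has_attracting_orbit (double_standard (proj a) b)"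
    unfolding has_attracting_orbit_def using x(1,3) by (metis circle_deriv_double_standard[OF D])
qed

lemma expanding_lift:
  assumes D: "\<And>n x. ((ds_lift b a ^^ n) has_real_derivative D n x) (at x)"
  shows "expanding (double_standard (proj a) b) \<longleftrightarrow> (\<exists>C>0. \<exists>\<kappa>>0. \<forall>n x. C * exp (\<kappa> * real n) \<le> D n x)"
proof -
  have "(\<forall>p. c \<le> circle_deriv (double_standard (proj a) b ^^ n) p) \<longleftrightarrow> (\<forall>x. c \<le> D n x)" for c n
  proof
    assume le: "\<forall>x. c \<le> D n x"
    show "\<forall>p. c \<le> circle_deriv (double_standard (proj a) b ^^ n) p"
    proof
      fix p
      obtain x where "p = proj x" by (rule proj_exhaust)
      then show "c \<le> circle_deriv (double_standard (proj a) b ^^ n) p"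
        using le by (simp add: circle_deriv_double_standard[OF D])
    qed
  next
    assume "\<forall>p. c \<le> circle_deriv (double_standard (proj a) b ^^ n) p"
    then show "\<forall>x. c \<le> D n x" by (metis circle_deriv_double_standard[OF D])
  qed
  then show ?thesis unfolding expanding_def by simp
qed

context double_standard_family
begin

lemma proj_in_attracting_params: "proj a \<in> attracting_params b \<longleftrightarrow> attracting_parameter a"
  unfolding attracting_params_def mem_Collect_eq has_attracting_orbit_lift[OF lift.DERIV_funpow]
  by (simp add: attracting_parameter_def attracting_point_def abs_of_pos lift.P_pos)

lemma proj_in_expanding_params: "proj a \<in> expanding_params b \<longleftrightarrow> expanding_parameter a"
  unfolding expanding_params_def mem_Collect_eq expanding_lift[OF lift.DERIV_funpow]
  by (simp add: expanding_parameter_def)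

end

lemma linear_case: "expanding_params 0 = UNIV" "attracting_params 0 = {}"
proof -
  have D: "((ds_lift 0 a ^^ n) has_real_derivative 2 ^ n) (at x)" for a n x
  proof (induction n)
    case (Suc n)
    have "ds_lift 0 a ^^ Suc n = (\<lambda>x. 2 * (ds_lift 0 a ^^ n) x + a)" by (simp add: fun_eq_iff ds_lift_def)
    then show ?case using Suc by (auto intro!: derivative_eq_intros)
  qed (simp add: id_def)
  have "exp (ln 2 * real n) = 2 ^ n" for n by (simp add: exp_of_nat2_mult)
  then have "proj a \<in> expanding_params 0" for a
    unfolding expanding_params_def mem_Collect_eq expanding_lift[OF D]
    by (intro exI[of _ 1] exI[of _ "ln 2"] conjI allI) (simp_all add: exp_of_nat2_mult)
  then have "p \<in> expanding_params 0" for p by (cases p rule: proj_exhaust) simp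
  then show "expanding_params 0 = UNIV" by blast
  have "proj a \<notin> attracting_params 0" for a
    unfolding attracting_params_def mem_Collect_eq has_attracting_orbit_lift[OF D] by (simp add: not_less)
  then have "p \<notin> attracting_params 0" for p by (cases p rule: proj_exhaust) simp
  then show "attracting_params 0 = {}" by blast
qed

lemma expanding_disjoint_attracting:
  assumes "0 \<le> b" "b < 1"
  shows "expanding_params b \<inter> attracting_params b = {}"
proof (cases "b = 0")
  case False
  then interpret double_standard_family b using assms by unfold_locales auto
  have "\<not> (proj a \<in> expanding_params b \<and> proj a \<in> attracting_params b)" for a
    unfolding proj_in_expanding_params proj_in_attracting_params using expanding_not_attracting by blast
  then have "\<not> (p \<in> expanding_params b \<and> p \<in> attracting_params b)" for p by (cases p rule: proj_exhaust) blast
  then show ?thesis by blast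
qed (simp add: linear_case)

lemma expanding_dense_lift:
  assumes "0 \<le> b" "b < 1" and a: "proj a \<notin> attracting_params b" and "0 < \<epsilon>"
  shows "\<exists>a'. \<bar>a' - a\<bar> < \<epsilon> \<and> proj a' \<in> expanding_params b"
proof (cases "b = 0")
  case True
  then show ?thesis using \<open>0 < \<epsilon>\<close> by (intro exI[of _ a]) (simp add: linear_case)
next
  case False
  then interpret double_standard_family b using assms by unfold_locales auto
  show ?thesis using expanding_parameters_dense[OF _ \<open>0 < \<epsilon>\<close>] a
    by (simp add: proj_in_expanding_params proj_in_attracting_params)
qed

lemma continuous_on_proj: "continuous_on S proj"
  by (rule continuous_on_subset[of UNIV]) (simp_all add: continuous_on_open_vimage open_circle_def)

lemma proj_in_closureI:
  assumes "\<And>\<epsilon>. 0 < \<epsilon> \<Longrightarrow> \<exists>a'. \<bar>a' - a\<bar> < \<epsilon> \<and> proj a' \<in> E"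
  shows "proj a \<in> closure E"
proof (rule ccontr)
  assume "proj a \<notin> closure E"
  then have "a \<in> proj -` (- closure E)" by simp
  moreover have "open (proj -` (- closure E))"
    unfolding open_circle_def[symmetric] by (simp add: open_Compl)
  ultimately obtain \<epsilon> where \<epsilon>: "0 < \<epsilon>" "ball a \<epsilon> \<subseteq> proj -` (- closure E)" by (meson openE)
  obtain a' where "\<bar>a' - a\<bar> < \<epsilon>" "proj a' \<in> E" using assms[OF \<epsilon>(1)] by blast
  then show False using \<epsilon>(2) closure_subset[of E] by (auto simp: dist_real_def abs_minus_commute subset_iff)
qed

text \<open>
  The interior of the interval of parameters consists of attracting ones, and at level
  \<open>b\<close> it is a connected set of attracting pairs, so a single component contains it.
\<close>

lemma interval_in_tongue_closure:
  assumes b: "0 \<le> b" "b < 1" and J: "nondegenerate_circle_interval J" "J \<inter> expanding_params b = {}"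
  shows "\<exists>U\<in>tongues. J \<subseteq> closure (tongue_level U b)"
proof -
  obtain I x y where I: "is_interval I" "x \<in> I" "y \<in> I" "x < y" "J = proj ` I"
    using J(1) unfolding nondegenerate_circle_interval_def by blast
  have cvx: "convex I" using I(1) by (simp add: is_interval_convex_1)
  have "{x<..<y} \<subseteq> interior I"
    using mem_is_interval_1_I[OF I(1-3)] by (intro interior_maximal) auto
  moreover have "(x + y) / 2 \<in> {x<..<y}" using I(4) by auto
  ultimately have mid: "(x + y) / 2 \<in> interior I" by blast
  have att: "proj t \<in> attracting_params b" if t: "t \<in> interior I" for t
  proof (rule ccontr)
    assume not: "proj t \<notin> attracting_params b"
    obtain \<epsilon> where \<epsilon>: "0 < \<epsilon>" "ball t \<epsilon> \<subseteq> I" using t unfolding mem_interior by blast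
    obtain a where a: "\<bar>a - t\<bar> < \<epsilon>" "proj a \<in> expanding_params b"
      using expanding_dense_lift[OF b not \<epsilon>(1)] by blast
    have "a \<in> I" using a(1) \<epsilon>(2) by (auto simp: dist_real_def abs_minus_commute subset_iff)
    then show False using J(2) a(2) I(5) by blast
  qed
  define A where "A = {(a, b). b \<in> {0..1} \<and> has_attracting_orbit (double_standard a b)}"
  define C where "C = (\<lambda>t. (proj t, b)) ` interior I"
  have "connected C" unfolding C_def
    by (intro connected_continuous_image continuous_on_Pair continuous_on_proj continuous_on_const
        convex_connected convex_interior cvx)
  moreover have CA: "C \<subseteq> A" using att b by (auto simp: C_def A_def attracting_params_def)
  moreover define q where "q = (proj ((x + y) / 2), b)"
  have q: "q \<in> C" unfolding q_def C_def using mid by blast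
  define U where "U = connected_component_set A q"
  have U: "U \<in> components A" unfolding U_def using q CA by (intro componentsI) blast
  have "q \<in> A" using q CA by blast
  then have "q \<in> U" unfolding U_def by (simp add: connected_component_refl)
  ultimately have "C \<subseteq> U" using q components_maximal[OF U] by blast
  then have lev: "proj t \<in> tongue_level U b" if "t \<in> interior I" for t
    using that unfolding C_def tongue_level_def by blast
  have "proj s \<in> closure (tongue_level U b)" if "s \<in> I" for s
  proof (rule proj_in_closureI)
    fix \<epsilon> :: real assume "0 < \<epsilon>"
    have "s \<in> closure (interior I)"
      using convex_closure_interior[OF cvx] mid \<open>s \<in> I\<close> closure_subset[of I] by blast
    then obtain t where "t \<in> interior I" "dist t s < \<epsilon>" using \<open>0 < \<epsilon>\<close> unfolding closure_approachable by blast
    then show "\<exists>t. \<bar>t - s\<bar> < \<epsilon> \<and> proj t \<in> tongue_level U b" using lev by (auto simp: dist_real_def)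
  qed
  then have "J \<subseteq> closure (tongue_level U b)" unfolding I(5) by blast
  then show ?thesis using U unfolding tongues_def A_def by blast
qed

theorem theoremB:
  fixes b :: real
  assumes "0 \<le> b" and "b < 1"
  shows "(expanding_params b \<subseteq> - attracting_params b \<and>
          - attracting_params b \<subseteq> closure (expanding_params b)) \<and>
         (\<forall>J. nondegenerate_circle_interval J \<longrightarrow>
            (\<exists>U\<in>tongues. J \<subseteq> closure (tongue_level U b)) \<or>
            J \<inter> expanding_params b \<noteq> {})"
proof (intro conjI allI impI)
  show "expanding_params b \<subseteq> - attracting_params b"
    using expanding_disjoint_attracting[OF assms] by blast
  show "- attracting_params b \<subseteq> closure (expanding_params b)"
  proof
    fix p assume p: "p \<in> - attracting_params b"
    obtain a where a: "p = proj a" by (rule proj_exhaust)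
    show "p \<in> closure (expanding_params b)"
      unfolding a using p expanding_dense_lift[OF assms] by (intro proj_in_closureI) (simp add: a)
  qed
  show "(\<exists>U\<in>tongues. J \<subseteq> closure (tongue_level U b)) \<or> J \<inter> expanding_params b \<noteq> {}"
    if "nondegenerate_circle_interval J" for J
    using interval_in_tongue_closure[OF assms that] by blast
qed

end
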